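(* Let $Y$ be a closed subspace of $JT_G$. Then either $Y$ is Hilbertian (isomorphic to a Hilbert space) or $c_0$ is isomorphic to a subspace of $Y$. In particular, every reflexive closed subspace of $JT_G$ is Hilbertian and complemented in $JT_G$.
   Context: Schreier families: for finite sets, $F<G$ means $\max F<\min G$. $\mathcal S_1=\{F\subset\mathbb N:\#F\le\min F\}$ (with $\emptyset\in\mathcal S_1$), and $\mathcal S_{n+1}=\{\bigcup_{i=1}^dF_i: F_1<\dots<F_d,\ F_i\in\mathcal S_n,\ d\le\min F_1\}$ (together with $\emptyset$). Repeated averages: for infinite $L=\{l_1<l_2<\dots\}\subset\mathbb N$, let $\alpha_k(0,L)=e_{l_k}$. Inductively $\alpha_1(n+1,L)=\frac1{l_1}\sum_{i=1}^{l_1}\alpha_i(n,L)$ and $\alpha_k(n+1,L)=\alpha_1(n+1,L_k)$, where $L_k=L\setminus\bigcup_{i<k}\operatorname{supp}\alpha_i(n+1,L)$. For $n\ge1$ the support of $\alpha_1(n,L)$ is the largest initial segment of $L$ belonging to $\mathcal S_n$, and $\alpha_1(n,L)$ has nonnegative coordinates with sum $1$. $S^{(2)}$ is the completion of $c_{00}(\mathbb N)$ under $\|x\|_{S^{(2)}}=\sup_{F\in\mathcal S_1}(\sum_{i\in F}x(i)^2)^{1/2}$. Tree: fix strictly increasing sequences $(m_j)_{j\in\mathbb N},(n_j)_{j\in\mathbb N}$ of positive integers with $m_j\le n_j$, and a strictly increasing $\gamma:\mathbb N\cup\{\emptyset\}\to\mathbb N$, where $\gamma(\emptyset)<\gamma(n)$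 for all $n\in\mathbb N$. $\mathcal T$ is a tree with root $\emptyset$ whose other nodes form an infinite set $D\subset\mathbb N$; its order is compatible with the usual order on $D$ ($m\preceq n$ implies $m\le n$), the predecessors of each node are linearly ordered, every node (including $\emptyset$) has infinitely many immediate successors, and for every node $n$ (including $\emptyset$) every immediate successor of $n$ is larger than $(3m_{2\gamma(n)+1}^2)^2$. A segment is a set $\{k\in D:m\preceq k\preceq n\}$ with $m\preceq n$ in $D$; a branch is a maximal linearly ordered subset of $D$. Functionals: for each branch $\sigma$, define successive $s_k^\sigma\subset\sigma$ inductively: $j_1=\gamma(\emptyset)$, $j_k=\gamma(\max s_{k-1}^\sigma)$ for $k\ge2$, and $s_k^\sigma$ is the largest initial segment of $\sigma\setminus\bigcup_{i<k}s_i^\sigma$ belonging to $\mathcal S_{n_{2j_k+1}}$. With $\beta_l\ge0$ given by $\beta_l^2=\alpha_1(n_{2j_k+1},\sigma\setminus\bigcup_{i<k}s_i^\sigma)(l)$ for $l\in s_k^\sigma$, put $x_k^\sigma=m_{2j_k+1}^2\sum_{l\in s_k^\sigma}\beta_le_l$ and $\phi_k^\sigma=m_{2j_k+1}^{-2}\sum_{l\in s_k^\sigma}\beta_le_l$, the latter acting on $c_{00}(\mathbb N)$ by the usual pairing. Let $W(\sigma)$ be the set of restrictions $(\sum_{i=1}^n\lambda_i\phi_i^\sigma)|_E$ with $n\in\mathbb N$, $\lambda_i\in\mathbb Q$, $\sum\lambda_i^2\le1$, $E$ an interval of $\mathbb N$, and let $\|x\|_\sigma=\sup\{f(x):f\in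 W(\sigma)\}$. For a segment $s$ let $\|x\|_s=\|x|_s\|_\sigma$ for any branch $\sigma\supset s$ (this does not depend on $\sigma$). $JT_G$ is the completion of $c_{00}(\mathbb N)$ under $$\|x\|=\max\Big\{\|x\|_\infty,\ \sup\Big\|\sum_{i=1}^n\|x\|_{s_i}e_{\min s_i}\Big\|_{S^{(2)}}\Big\},$$ the supremum over all finite families of pairwise disjoint segments $s_1,\dots,s_n$ with $\{\min s_i:i\le n\}\in\mathcal S_1$. Complemented means being the range of a bounded linear projection; isomorphic means linearly homeomorphic. *)

theory Defs
  imports "HOL-Analysis.Analysis"
begin

section \<open>Schreier families and repeated averages\<close>

text \<open>The natural numbers of the mathematics start at 1. The number 0 never belongs to a set
  of a Schreier family, and finitely supported sequences vanish at 0.\<close>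

definition schreier1 :: "nat set set" where
  "schreier1 = {F. F = {} \<or> (finite F \<and> F \<noteq> {} \<and> card F \<le> Min F)}"

text \<open>Only the indices at least 1 are used; index 0 is the usual convention.\<close>

fun schreier :: "nat \<Rightarrow> nat set set" where
  "schreier 0 = insert {} {{i} |i. 1 \<le> i}"
| "schreier (Suc 0) = schreier1"
| "schreier (Suc (Suc N)) = insert {}
     {G. \<exists>d F. 1 \<le> d
            \<and> (\<forall>i\<in>{1..d}. F i \<in> schreier (Suc N) \<and> F i \<noteq> {})
            \<and> (\<forall>i\<in>{1..<d}. Max (F i) < Min (F (Suc i)))
            \<and> d \<le> Min (F 1)
            \<and> G = (\<Union>i\<in>{1..d}. F i)}"

definition supp :: "(nat \<Rightarrow> real) \<Rightarrow> nat set" where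
  "supp x = {l. x l \<noteq> 0}"

definition unit_vec :: "nat \<Rightarrow> nat \<Rightarrow> real" where
  "unit_vec i = indicator {i}"

definition restr :: "(nat \<Rightarrow> real) \<Rightarrow> nat set \<Rightarrow> nat \<Rightarrow> real" where
  "restr x E = (\<lambda>l. if l \<in> E then x l else 0)"

text \<open>\<open>rep_avg N L k\<close> is $\alpha_k(N,L)$ for \<open>k \<ge> 1\<close>. Note that
  \<^const>\<open>enumerate\<close> counts from 0, so that the least element of \<open>L\<close> is \<open>enumerate L 0\<close>.\<close>

function rep_avg :: "nat \<Rightarrow> nat set \<Rightarrow> nat \<Rightarrow> nat \<Rightarrow> real" where
  "rep_avg 0 L k = unit_vec (enumerate L (k - 1))"
| "rep_avg (Suc N) L k =
     (if k \<le> 1 then (\<lambda>l. (1 / real (enumerate L 0)) * (\<Sum>i = 1..enumerate L 0. rep_avg N L i l))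
      else rep_avg (Suc N) (L - (\<Union>i\<in>{1..<k}. supp (rep_avg (Suc N) L i))) 1)"
  by pat_completeness auto
termination
  by (relation "(\<lambda>(N, L, k). N) <*mlex*> Wellfounded.measure (\<lambda>(N, L, k). k)")
     (auto simp: mlex_prod_def intro: wf_mlex)

definition initial_segment :: "nat set \<Rightarrow> nat set \<Rightarrow> bool" where
  "initial_segment I A \<longleftrightarrow> I \<subseteq> A \<and> (\<forall>a\<in>I. \<forall>b\<in>A. b \<le> a \<longrightarrow> b \<in> I)"

definition max_initial :: "nat \<Rightarrow> nat set \<Rightarrow> nat set" where
  "max_initial N A = (GREATEST I. initial_segment I A \<and> I \<in> schreier N)"

section \<open>The norm of the space\<close>

definition c00 :: "(nat \<Rightarrow> real) set" where
  "c00 = {x. finite (supp x) \<and> x 0 = 0}"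

definition sup_norm :: "(nat \<Rightarrow> real) \<Rightarrow> real" where
  "sup_norm x = (SUP l. \<bar>x l\<bar>)"

definition S2_norm :: "(nat \<Rightarrow> real) \<Rightarrow> real" where
  "S2_norm x = (SUP F\<in>schreier1. sqrt (\<Sum>i\<in>F. (x i)\<^sup>2))"

text \<open>The root of the tree is encoded as 0, which is not an element of \<open>D\<close>; accordingly
  \<open>\<gamma> 0\<close> is the value of $\gamma$ at the root. The sequences \<open>m\<close> and \<open>n\<close> are indexed from 1.
  The tree order is the relation \<open>R\<close> on \<open>insert 0 D\<close>.\<close>

locale jt_data =
  fixes m n :: "nat \<Rightarrow> nat" and \<gamma> :: "nat \<Rightarrow> nat" and D :: "nat set" and R :: "nat rel"
begin

definition immediate_succ :: "nat \<Rightarrow> nat \<Rightarrow> bool" where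
  "immediate_succ p k \<longleftrightarrow> (p, k) \<in> R \<and> p \<noteq> k
     \<and> (\<forall>z. (p, z) \<in> R \<and> (z, k) \<in> R \<longrightarrow> z = p \<or> z = k)"

definition segment :: "nat set \<Rightarrow> bool" where
  "segment s \<longleftrightarrow> (\<exists>a\<in>D. \<exists>b\<in>D. (a, b) \<in> R \<and> s = {k\<in>D. (a, k) \<in> R \<and> (k, b) \<in> R})"

definition branch :: "nat set \<Rightarrow> bool" where
  "branch \<sigma> \<longleftrightarrow> \<sigma> \<subseteq> D \<and> \<sigma> \<in> Chains R
     \<and> (\<forall>\<tau>. \<tau> \<subseteq> D \<and> \<tau> \<in> Chains R \<and> \<sigma> \<subseteq> \<tau> \<longrightarrow> \<tau> = \<sigma>)"

text \<open>\<open>blk \<sigma> k\<close> is the set $s_k^\sigma$ for \<open>k \<ge> 1\<close>.\<close>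

function blk :: "nat set \<Rightarrow> nat \<Rightarrow> nat set" where
  "blk \<sigma> k = max_initial
     (n (2 * (if k \<le> 1 then \<gamma> 0 else \<gamma> (Max (blk \<sigma> (k - 1)))) + 1))
     (\<sigma> - (\<Union>i\<in>{1..<k}. blk \<sigma> i))"
  by pat_completeness auto
termination
  by (relation "Wellfounded.measure snd") auto

definition blk_rest :: "nat set \<Rightarrow> nat \<Rightarrow> nat set" where
  "blk_rest \<sigma> k = \<sigma> - (\<Union>i\<in>{1..<k}. blk \<sigma> i)"

definition blk_ind :: "nat set \<Rightarrow> nat \<Rightarrow> nat" where
  "blk_ind \<sigma> k = (if k \<le> 1 then \<gamma> 0 else \<gamma> (Max (blk \<sigma> (k - 1))))"

definition \<beta> :: "nat set \<Rightarrow> nat \<Rightarrow> nat \<Rightarrow> real" where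
  "\<beta> \<sigma> k l = sqrt (rep_avg (n (2 * blk_ind \<sigma> k + 1)) (blk_rest \<sigma> k) 1 l)"

definition \<phi> :: "nat set \<Rightarrow> nat \<Rightarrow> (nat \<Rightarrow> real) \<Rightarrow> real" where
  "\<phi> \<sigma> k x = (1 / (real (m (2 * blk_ind \<sigma> k + 1)))\<^sup>2) * (\<Sum>l\<in>blk \<sigma> k. \<beta> \<sigma> k l * x l)"

definition W :: "nat set \<Rightarrow> ((nat \<Rightarrow> real) \<Rightarrow> real) set" where
  "W \<sigma> = {(\<lambda>x. \<Sum>i = 1..N. c i * \<phi> \<sigma> i (restr x E)) | N c E.
            (\<forall>i\<in>{1..N}. c i \<in> \<rat>) \<and> (\<Sum>i = 1..N. (c i)\<^sup>2) \<le> 1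
            \<and> (\<forall>a\<in>E. \<forall>b\<in>E. {a..b} \<subseteq> E)}"

definition branch_norm :: "nat set \<Rightarrow> (nat \<Rightarrow> real) \<Rightarrow> real" where
  "branch_norm \<sigma> x = (SUP f\<in>W \<sigma>. f x)"

text \<open>The value does not depend on the chosen branch.\<close>

definition segment_norm :: "nat set \<Rightarrow> (nat \<Rightarrow> real) \<Rightarrow> real" where
  "segment_norm s x = branch_norm (SOME \<sigma>. branch \<sigma> \<and> s \<subseteq> \<sigma>) (restr x s)"

definition segment_families :: "nat set set set" where
  "segment_families = {A. finite A \<and> (\<forall>s\<in>A. segment s) \<and> disjoint A \<and> Min ` A \<in> schreier1}"

definition JTG_norm :: "(nat \<Rightarrow> real) \<Rightarrow> real" where
  "JTG_norm x = max (sup_norm x)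
     (SUP A\<in>segment_families. S2_norm (\<lambda>l. \<Sum>s\<in>A. segment_norm s x * unit_vec (Min s) l))"

end

text \<open>The predecessors of a node are well-ordered because they form a finite chain.\<close>

locale jt_tree = jt_data +
  assumes m_incr: "strict_mono_on {1..} m" and m_pos: "\<And>j. 1 \<le> j \<Longrightarrow> 0 < m j"
    and n_incr: "strict_mono_on {1..} n" and n_pos: "\<And>j. 1 \<le> j \<Longrightarrow> 0 < n j"
    and m_le_n: "\<And>j. 1 \<le> j \<Longrightarrow> m j \<le> n j"
    and gamma_incr: "strict_mono \<gamma>" and gamma_pos: "0 < \<gamma> 0"
    and D_infinite: "infinite D" and root_notin: "0 \<notin> D"
    and order: "partial_order_on (insert 0 D) R"
    and root: "\<And>k. k \<in> D \<Longrightarrow> (0, k) \<in> R"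
    and compatible: "\<And>a b. (a, b) \<in> R \<Longrightarrow> a \<le> b"
    and predecessors: "\<And>b. b \<in> insert 0 D \<Longrightarrow> {a. (a, b) \<in> R} \<in> Chains R"
    and infinite_succ: "\<And>p. p \<in> insert 0 D \<Longrightarrow> infinite {k. immediate_succ p k}"
    and large_succ: "\<And>p k. p \<in> insert 0 D \<Longrightarrow> immediate_succ p k \<Longrightarrow>
                       (3 * (m (2 * \<gamma> p + 1))\<^sup>2)\<^sup>2 < k"

section \<open>Banach space notions\<close>

text \<open>\<open>X\<close> is a completion of the normed space \<open>(V, N)\<close>, realised inside a Banach space; \<open>\<iota>\<close> is
  the embedding. Completions are unique up to isometric isomorphism, and not restricting
  \<open>X\<close> to be the whole type makes a realisation available in one type, such as
  \<open>nat \<Rightarrow>\<^sub>C real\<close>, whatever the norm of a space of countable dimension.\<close>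

definition is_completion ::
    "(nat \<Rightarrow> real) set \<Rightarrow> ((nat \<Rightarrow> real) \<Rightarrow> real) \<Rightarrow> ((nat \<Rightarrow> real) \<Rightarrow> 'a::banach) \<Rightarrow> 'a set \<Rightarrow> bool" where
  "is_completion V N \<iota> X \<longleftrightarrow>
     (\<forall>x\<in>V. \<forall>y\<in>V. \<iota> (\<lambda>l. x l + y l) = \<iota> x + \<iota> y)
     \<and> (\<forall>c. \<forall>x\<in>V. \<iota> (\<lambda>l. c * x l) = c *\<^sub>R \<iota> x)
     \<and> (\<forall>x\<in>V. norm (\<iota> x) = N x)
     \<and> X = closure (\<iota> ` V)"

definition linear_on :: "'a::real_vector set \<Rightarrow> ('a \<Rightarrow> 'b::real_vector) \<Rightarrow> bool" where
  "linear_on V T \<longleftrightarrow> (\<forall>x\<in>V. \<forall>y\<in>V. T (x + y) = T x + T y) \<and> (\<forall>c. \<forall>x\<in>V. T (c *\<^sub>R x) = c *\<^sub>R T x)"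

definition bounded_linear_on ::
    "'a::real_normed_vector set \<Rightarrow> ('a \<Rightarrow> 'b::real_normed_vector) \<Rightarrow> bool" where
  "bounded_linear_on V T \<longleftrightarrow> linear_on V T \<and> (\<exists>K. \<forall>x\<in>V. norm (T x) \<le> K * norm x)"

definition linear_homeomorphism ::
    "'a::real_vector topology \<Rightarrow> 'b::real_vector topology \<Rightarrow> ('a \<Rightarrow> 'b) \<Rightarrow> bool" where
  "linear_homeomorphism A B T \<longleftrightarrow> linear_on (topspace A) T \<and> homeomorphic_map A B T"

definition inner_dist :: "('a::real_vector \<Rightarrow> 'a \<Rightarrow> real) \<Rightarrow> 'a \<Rightarrow> 'a \<Rightarrow> real" where
  "inner_dist ip x y = sqrt (ip (x - y) (x - y))"

definition hilbert_space_on :: "'a::real_vector set \<Rightarrow> ('a \<Rightarrow> 'a \<Rightarrow> real) \<Rightarrow> bool" where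
  "hilbert_space_on H ip \<longleftrightarrow> subspace H
     \<and> (\<forall>x\<in>H. \<forall>y\<in>H. ip x y = ip y x)
     \<and> (\<forall>y\<in>H. linear_on H (\<lambda>x. ip x y))
     \<and> (\<forall>x\<in>H. 0 \<le> ip x x \<and> (ip x x = 0 \<longrightarrow> x = 0))
     \<and> Metric_space.mcomplete H (inner_dist ip)"

text \<open>The Hilbert space \<open>H\<close> carries its own inner product and topology. Taking it inside the
  vector space underlying \<open>'a\<close> is no restriction: the structure of any Hilbert
  space isomorphic to \<open>Y\<close> can be transported to the set \<open>Y\<close>.\<close>

definition hilbertian :: "'a::real_normed_vector set \<Rightarrow> bool" where
  "hilbertian Y \<longleftrightarrow> (\<exists>(H :: 'a set) ip T. hilbert_space_on H ip
     \<and> linear_homeomorphism (top_of_set Y) (Metric_space.mtopology H (inner_dist ip)) T)"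

text \<open>\<open>nat \<Rightarrow>\<^sub>C real\<close> is the space of bounded sequences with the supremum norm.\<close>

definition c0 :: "(nat \<Rightarrow>\<^sub>C real) set" where
  "c0 = {f. apply_bcontfun f \<longlonglongrightarrow> 0}"

definition contains_c0 :: "'a::real_normed_vector set \<Rightarrow> bool" where
  "contains_c0 Y \<longleftrightarrow> (\<exists>Z T. subspace Z \<and> Z \<subseteq> Y
     \<and> linear_homeomorphism (top_of_set c0) (top_of_set Z) T)"

text \<open>Functionals on \<open>Y\<close> are represented by functions vanishing off \<open>Y\<close>.\<close>

definition dual :: "'a::real_normed_vector set \<Rightarrow> ('a \<Rightarrow> real) set" where
  "dual Y = {f. bounded_linear_on Y f \<and> (\<forall>x. x \<notin> Y \<longrightarrow> f x = 0)}"

definition dual_norm :: "'a::real_normed_vector set \<Rightarrow> ('a \<Rightarrow> real) \<Rightarrow> real" where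
  "dual_norm Y f = (SUP x\<in>{x\<in>Y. norm x \<le> 1}. \<bar>f x\<bar>)"

definition bidual :: "'a::real_normed_vector set \<Rightarrow> (('a \<Rightarrow> real) \<Rightarrow> real) set" where
  "bidual Y = {\<Phi>.
     (\<forall>f\<in>dual Y. \<forall>g\<in>dual Y. \<Phi> (\<lambda>x. f x + g x) = \<Phi> f + \<Phi> g)
     \<and> (\<forall>c. \<forall>f\<in>dual Y. \<Phi> (\<lambda>x. c * f x) = c * \<Phi> f)
     \<and> (\<exists>K. \<forall>f\<in>dual Y. \<bar>\<Phi> f\<bar> \<le> K * dual_norm Y f)}"

definition reflexive :: "'a::real_normed_vector set \<Rightarrow> bool" where
  "reflexive Y \<longleftrightarrow> (\<forall>\<Phi>\<in>bidual Y. \<exists>y\<in>Y. \<forall>f\<in>dual Y. \<Phi> f = f y)"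

definition complemented_in :: "'a::real_normed_vector set \<Rightarrow> 'a set \<Rightarrow> bool" where
  "complemented_in Y X \<longleftrightarrow> (\<exists>P. bounded_linear_on X P \<and> P ` X = Y \<and> (\<forall>x\<in>X. P (P x) = P x))"

definition closed_subspace_of :: "'a::real_normed_vector set \<Rightarrow> 'a set \<Rightarrow> bool" where
  "closed_subspace_of Y X \<longleftrightarrow> subspace Y \<and> closed Y \<and> Y \<subseteq> X"

end

theory Submission
  imports Defs "HOL-Library.Diagonal_Subsequence"
begin

text \<open>The coefficient and the block of a node in the functionals \<open>\<phi>\<close> depend only on its predecessors, so
  every branch \<open>\<sigma>\<close> yields a bounded operator $x \mapsto (\phi_i^\sigma(x))_i$ from the space into $\ell_2$,
  and so does every downward closed chain ("path"). If finitely many of these operators together with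
  finitely many coordinates bound the norm from below on \<open>Y\<close>, they define an equivalent inner product on
  \<open>Y\<close>, and the orthogonal projection with respect to it extends to the whole space.

  Otherwise \<open>Y\<close> contains, up to small perturbations, normalized blocks on which any given finite set of
  these operators is as small as desired. By the Schreier condition on the families of segments, the
  paths on which the operator of a given block is not small have boundedly many initial parts; a
  compactness argument then produces any finite number of blocks such that no path is bad for two of
  them. Their sum is large by the lower $\ell_2$-estimate, whereas all its segment norms remain
  bounded; hence \<open>Y\<close> almost contains normalized blocks with arbitrarily small segment norms. A rapidly
  chosen sequence of these is equivalent to the basis of $c_0$, since a segment family whose least
  minimum is \<open>p\<close> has at most \<open>p\<close> members. The series of these blocks defines an element of the bidual
  that is not represented in \<open>Y\<close>: evaluation at the coordinates shows that a representing vector would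
  have interval projections of norm 1 arbitrarily far out.\<close>

section \<open>Schreier families and repeated averages\<close>

text \<open>The obstacle is that there are uncountably many branches, whereas non-coercivity gives
  control over only finitely many paths at a time. Bounding the number of histories does not
  suffice, since the paths that are bad for a block vary with the block. The choice therefore runs
  backwards: limits of the bad paths of far-out blocks are found before any block is fixed, the
  earlier blocks are made small on these limits, and only then is the far-out block taken; a path
  that is bad for it agrees with one of the limits on the earlier blocks and cannot be bad for
  those. Small segment norms come from a self-improvement. If every normalized block near
  \<open>Y\<close> had a segment norm above \<delta>, a sum of N separated blocks would have norm at
  least \<delta> sqrt N but segment norms at most 4: at most three blocks count fully, the others
  add N * (1/N). Its normalization is again a block near \<open>Y\<close> and contradicts the
  assumption as soon as \<delta>^2 sqrt N \<ge> 4. To make this manageable, rational combinations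
  and interval restrictions in the norm are replaced by finite l2-sums \<open>sqn\<close>.\<close>

lemma finite_schreier: "F \<in> schreier N \<Longrightarrow> finite F"
  by (induction N arbitrary: F rule: schreier.induct) (auto simp: schreier1_def)

lemma singleton_in_schreier: "1 \<le> i \<Longrightarrow> {i} \<in> schreier N"
proof (induction N rule: schreier.induct)
  case (3 N)
  then show ?case
    by (auto intro!: exI[of _ 1] exI[of _ "\<lambda>_. {i}"])
qed (auto simp: schreier1_def)

lemma empty_in_schreier [simp]: "{} \<in> schreier N"
  by (induction N rule: schreier.induct) (auto simp: schreier1_def)

lemma successive_Min_less:
  assumes "\<forall>i\<in>{1..d}. finite (F i) \<and> F i \<noteq> {}"
    and "\<forall>i\<in>{1..<d}. Max (F i) < Min (F (Suc i))"
    and "1 \<le> i" "i < j" "j \<le> d"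
  shows "Max (F i) < Min (F j)"
  using assms(4,5)
proof (induction j)
  case (Suc j)
  show ?case
  proof (cases "i = j")
    case True
    then show ?thesis using assms(2,3) Suc.prems by auto
  next
    case False
    then have "Max (F i) < Min (F j)" using Suc by auto
    also have "\<dots> \<le> Max (F j)" using assms(1,3) Suc.prems by simp
    also have "\<dots> < Min (F (Suc j))" using assms(2,3) Suc.prems by auto
    finally show ?thesis .
  qed
qed simp

text \<open>Only the pieces up to the last one that meets \<open>{..l}\<close> survive the cut. The
  earlier ones lie below a point of that piece and stay nonempty; the number of pieces does not grow
  and the least element does not drop.\<close>

lemma schreier_initial:
  assumes "G \<in> schreier N"
  shows "G \<inter> {..l} \<in> schreier N"
  using assms
proof (induction N arbitrary: G rule: schreier.induct)
  case 1
  then show ?case by auto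
next
  case 2
  show ?case
  proof (cases "G \<inter> {..l} = {}")
    case False
    with 2 have G: "finite G" "G \<noteq> {}" "card G \<le> Min G" by (auto simp: schreier1_def)
    have "card (G \<inter> {..l}) \<le> card G" using G by (auto intro: card_mono)
    also have "\<dots> \<le> Min (G \<inter> {..l})" using G False by (meson Int_lower1 Min_antimono order_trans)
    finally show ?thesis using G False by (simp add: schreier1_def)
  qed (simp add: schreier1_def)
next
  case (3 N)
  show ?case
  proof (cases "G \<inter> {..l} = {}")
    case False
    with "3.prems" obtain d F where d: "1 \<le> d"
      and F: "\<forall>i\<in>{1..d}. F i \<in> schreier (Suc N) \<and> F i \<noteq> {}"
      and succ: "\<forall>i\<in>{1..<d}. Max (F i) < Min (F (Suc i))"
      and dmin: "d \<le> Min (F 1)" and G: "G = (\<Union>i\<in>{1..d}. F i)" by auto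
    have fin: "\<forall>i\<in>{1..d}. finite (F i) \<and> F i \<noteq> {}" using F finite_schreier by blast
    define I where "I = {i\<in>{1..d}. F i \<inter> {..l} \<noteq> {}}"
    have I: "finite I" "I \<noteq> {}" using False G by (auto simp: I_def)
    define e where "e = Max I"
    have "e \<in> I" using I by (simp add: e_def)
    then have e: "1 \<le> e" "e \<le> d" "F e \<inter> {..l} \<noteq> {}" by (auto simp: I_def)
    have ne: "F i \<inter> {..l} \<noteq> {}" if "1 \<le> i" "i \<le> e" for i
    proof (cases "i = e")
      case False
      then have "Max (F i) < Min (F e)"
        using successive_Min_less[OF fin succ] that e by simp
      moreover obtain x where x: "x \<in> F e" "x \<le> l" using e by auto
      moreover have "Min (F e) \<le> x" using fin e x by simp
      moreover have "Max (F i) \<in> F i" using fin that e by simp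
      ultimately show ?thesis by (metis IntI atMost_iff emptyE less_or_eq_imp_le order_trans)
    qed (use e in simp)
    have "Max (F i \<inter> {..l}) < Min (F (Suc i) \<inter> {..l})" if "i \<in> {1..<e}" for i
    proof -
      have i: "i \<in> {1..d}" "Suc i \<in> {1..d}" "i \<in> {1..<d}" using that e by auto
      have "Max (F i \<inter> {..l}) \<le> Max (F i)"
        using fin i ne[of i] that by (intro Max_mono) auto
      also have "\<dots> < Min (F (Suc i))" using succ i by blast
      also have "\<dots> \<le> Min (F (Suc i) \<inter> {..l})"
        using fin i ne[of "Suc i"] that by (intro Min_antimono) auto
      finally show ?thesis .
    qed
    moreover have "e \<le> Min (F 1 \<inter> {..l})"
    proof -
      have "e \<le> Min (F 1)" using e dmin by simp
      also have "\<dots> \<le> Min (F 1 \<inter> {..l})" using fin d ne[of 1] e by (intro Min_antimono) auto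
      finally show ?thesis .
    qed
    moreover have "G \<inter> {..l} = (\<Union>i\<in>{1..e}. F i \<inter> {..l})"
    proof -
      have "i \<le> e" if "i \<in> {1..d}" "x \<in> F i" "x \<le> l" for i x
        unfolding e_def using that I(1) by (intro Max_ge) (auto simp: I_def)
      then have "i \<in> {1..e}" if "i \<in> {1..d}" "x \<in> F i" "x \<le> l" for i x
        using that by (meson atLeastAtMost_iff)
      moreover have "{1..e} \<subseteq> {1..d}" using e by auto
      ultimately show ?thesis unfolding G by blast
    qed
    ultimately show ?thesis
      unfolding schreier.simps using e F 3 ne
      by (intro insertI2 CollectI exI[of _ e] exI[of _ "\<lambda>i. F i \<inter> {..l}"] conjI ballI "3.IH") auto
  qed simp
qed

text \<open>This is why a largest initial segment in a Schreier family exists. An element of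
  \<open>A\<close> caps the number of pieces, so it suffices to bound unions of exactly
  \<open>t\<close> pieces; there the last piece starts after one of finitely many cuts and is itself
  an initial segment of what remains.\<close>

lemma schreier_initial_bounded:
  assumes "infinite (A :: nat set)"
  shows "\<exists>B. \<forall>l\<in>A. A \<inter> {..l} \<in> schreier N \<longrightarrow> l \<le> B"
  using assms
proof (induction N arbitrary: A rule: schreier.induct)
  case 1
  obtain a where "a \<in> A" using infinite_imp_nonempty[OF 1] by blast
  have "l \<le> a" if "l \<in> A" "A \<inter> {..l} \<in> schreier 0" for l
  proof (rule ccontr)
    assume "\<not> l \<le> a"
    then have "{a, l} \<subseteq> A \<inter> {..l}" "a \<noteq> l" using that \<open>a \<in> A\<close> by auto
    then have "card {a, l} \<le> card (A \<inter> {..l})" by (intro card_mono) auto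
    moreover have "card (A \<inter> {..l}) \<le> 1" using that by auto
    ultimately show False using \<open>a \<noteq> l\<close> by simp
  qed
  then show ?case by blast
next
  case 2
  obtain a where "a \<in> A" using infinite_imp_nonempty[OF 2] by blast
  obtain T where T: "T \<subseteq> A" "finite T" "card T = Suc a"
    using infinite_arbitrarily_large[OF 2] by blast
  have "l \<le> Max (insert a T)" if l: "l \<in> A" "A \<inter> {..l} \<in> schreier (Suc 0)" for l
  proof (rule ccontr)
    assume "\<not> ?thesis"
    then have "\<forall>x\<in>insert a T. x < l" using T by (simp add: not_le)
    then have *: "T \<subseteq> A \<inter> {..l}" "a \<in> A \<inter> {..l}" using T \<open>a \<in> A\<close> by auto
    have "Suc a \<le> card (A \<inter> {..l})" using T * by (metis card_mono finite_Int finite_atMost)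
    also have "\<dots> \<le> Min (A \<inter> {..l})" using l * by (auto simp: schreier1_def)
    also have "\<dots> \<le> a" using * by (intro Min_le) auto
    finally show False by simp
  qed
  then show ?case by blast
next
  case (3 N)
  let ?S = "schreier (Suc N)"
  define succ where "succ t F \<longleftrightarrow> (\<forall>i\<in>{1..t}. F i \<in> ?S \<and> F i \<noteq> {})
    \<and> (\<forall>i\<in>{1..<t}. Max (F i) < Min (F (Suc i)))" for t :: nat and F
  have IH: "\<exists>B. \<forall>l\<in>A. A \<inter> {..l} \<in> ?S \<longrightarrow> l \<le> B" if "infinite A" for A
    using "3.IH"[of 1 1 A] that by simp
  \<comment> \<open>One bound for each cut \<open>j\<close>, to be used where \<open>j\<close> is
    the end of the first \<open>t\<close> pieces.\<close>
  have "\<forall>j. \<exists>B. \<forall>l\<in>A - {..j}. (A - {..j}) \<inter> {..l} \<in> ?S \<longrightarrow> l \<le> B"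
    using IH "3.prems" by (simp del: Diff_iff)
  then obtain g where g: "\<And>j l. l \<in> A - {..j} \<Longrightarrow> (A - {..j}) \<inter> {..l} \<in> ?S \<Longrightarrow> l \<le> g j"
    by metis
  obtain g0 where g0: "\<And>l. l \<in> A \<Longrightarrow> A \<inter> {..l} \<in> ?S \<Longrightarrow> l \<le> g0"
    using IH[OF "3.prems"] by blast
  have "\<exists>B. \<forall>F. \<forall>l\<in>A. succ t F \<and> A \<inter> {..l} = (\<Union>i\<in>{1..t}. F i) \<longrightarrow> l \<le> B" for t
  proof (induction t)
    case (Suc t)
    then obtain B where B: "\<And>F l. l \<in> A \<Longrightarrow> succ t F \<Longrightarrow> A \<inter> {..l} = (\<Union>i\<in>{1..t}. F i) \<Longrightarrow> l \<le> B"
      by metis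
    have "l \<le> Max (insert g0 (g ` {..B}))"
      if l: "l \<in> A" and F: "succ (Suc t) F" and U: "A \<inter> {..l} = (\<Union>i\<in>{1..Suc t}. F i)" for F l
    proof (cases "t = 0")
      case True
      then have "A \<inter> {..l} = F 1" "F 1 \<in> ?S" using U F by (auto simp: succ_def)
      then have "l \<le> g0" using g0 l by auto
      then show ?thesis by (simp add: Max_ge_iff)
    next
      case False
      have fin: "\<forall>i\<in>{1..Suc t}. finite (F i) \<and> F i \<noteq> {}"
        using F finite_schreier unfolding succ_def by blast
      have sc: "\<forall>i\<in>{1..<Suc t}. Max (F i) < Min (F (Suc i))" using F by (auto simp: succ_def)
      note less = successive_Min_less[OF fin sc]
      define j where "j = Max (F t)"
      have jF: "j \<in> F t" using fin False by (simp add: j_def)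
      then have j: "j \<in> A" "j \<le> l" using U False by auto
      have 1: "x \<le> j" if "i \<in> {1..t}" "x \<in> F i" for i x
      proof (cases "i = t")
        case False
        then have "Max (F i) < Min (F t)" using less[of i t] that by simp
        moreover have "x \<le> Max (F i)" "Min (F t) \<le> j" using fin that jF by auto
        ultimately show ?thesis by simp
      qed (use fin that in \<open>auto simp: j_def\<close>)
      have 2: "j < x" if "x \<in> F (Suc t)" for x
      proof -
        have "j < Min (F (Suc t))" using less[of t "Suc t"] False by (simp add: j_def)
        also have "\<dots> \<le> x" using fin that by simp
        finally show ?thesis .
      qed
      have "{1..Suc t} = insert (Suc t) {1..t}" by auto
      then have U': "(\<Union>i\<in>{1..Suc t}. F i) = (\<Union>i\<in>{1..t}. F i) \<union> F (Suc t)"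
        by (simp only: UN_insert Un_commute)
      have "A \<inter> {..j} = (\<Union>i\<in>{1..t}. F i)"
      proof -
        have "A \<inter> {..j} = (A \<inter> {..l}) \<inter> {..j}" using j by auto
        also have "\<dots> = (\<Union>i\<in>{1..t}. F i)" unfolding U U' using 1 2 by (auto, fastforce)
        finally show ?thesis .
      qed
      moreover have "succ t F" using F by (auto simp: succ_def)
      ultimately have "j \<le> B" using B j by blast
      have "(A - {..j}) \<inter> {..l} = A \<inter> {..l} - {..j}" by auto
      also have "\<dots> = F (Suc t)" unfolding U U' using 1 2 by (auto, fastforce)
      finally have eq: "(A - {..j}) \<inter> {..l} = F (Suc t)" .
      then have S: "(A - {..j}) \<inter> {..l} \<in> ?S" using F by (auto simp: succ_def)
      have "Suc t \<in> {1..Suc t}" by simp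
      then obtain x where "x \<in> F (Suc t)" using fin by blast
      then have "x \<in> A" "x \<le> l" "j < x" using U 2 by auto
      then have "l \<in> A - {..j}" using l by auto
      then have "l \<le> g j" using g S by blast
      then show ?thesis using \<open>j \<le> B\<close> by (subst Max_ge_iff) auto
    qed
    then show ?case by blast
  qed auto
  then obtain B where B: "\<And>t F l. l \<in> A \<Longrightarrow> succ t F \<Longrightarrow> A \<inter> {..l} = (\<Union>i\<in>{1..t}. F i) \<Longrightarrow> l \<le> B t"
    by metis
  obtain a where "a \<in> A" using infinite_imp_nonempty[OF "3.prems"] by blast
  \<comment> \<open>If \<open>a\<close> is covered by the pieces, the least element of the first
    piece is at most \<open>a\<close>, and hence so is the number of pieces.\<close>
  have "l \<le> Max (insert a (B ` {..a}))" if l: "l \<in> A" "A \<inter> {..l} \<in> schreier (Suc (Suc N))" for l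
  proof (cases "l \<le> a")
    case False
    then have a: "a \<in> A \<inter> {..l}" using \<open>a \<in> A\<close> by auto
    with l obtain d F where d: "1 \<le> d"
      and F: "\<forall>i\<in>{1..d}. F i \<in> schreier (Suc N) \<and> F i \<noteq> {}"
      and sc: "\<forall>i\<in>{1..<d}. Max (F i) < Min (F (Suc i))"
      and dmin: "d \<le> Min (F 1)" and G: "A \<inter> {..l} = (\<Union>i\<in>{1..d}. F i)" by auto
    have fin: "\<forall>i\<in>{1..d}. finite (F i) \<and> F i \<noteq> {}" using F finite_schreier by blast
    obtain i where i: "i \<in> {1..d}" "a \<in> F i" using a G by blast
    have "Min (F 1) \<le> Min (F i)"
    proof (cases "i = 1")
      case False
      then have "Max (F 1) < Min (F i)" using successive_Min_less[OF fin sc] i by simp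
      moreover have "Min (F 1) \<le> Max (F 1)" using fin d by simp
      ultimately show ?thesis by simp
    qed simp
    also have "\<dots> \<le> a" using fin i by simp
    finally have "d \<le> a" using dmin by simp
    moreover have "l \<le> B d" using B[of l d F] l F sc G by (auto simp: succ_def)
    ultimately show ?thesis by (subst Max_ge_iff) auto
  qed (simp add: Max_ge_iff)
  then show ?case by blast
qed

text \<open>Turns the \<open>GREATEST\<close> of the definition into a pointwise test. Boundedness
  makes the set of points passing the test finite, hence a Schreier set cut at its maximum, and
  every competitor is contained in it.\<close>

lemma mem_max_initial:
  assumes "infinite A"
  shows "l \<in> max_initial N A \<longleftrightarrow> l \<in> A \<and> A \<inter> {..l} \<in> schreier N"
proof -
  define I where "I = {l\<in>A. A \<inter> {..l} \<in> schreier N}"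
  obtain B where "\<forall>l\<in>A. A \<inter> {..l} \<in> schreier N \<longrightarrow> l \<le> B"
    using schreier_initial_bounded[OF assms] by blast
  then have "\<And>l. l \<in> I \<Longrightarrow> l \<le> B" by (auto simp: I_def)
  then have fin: "finite I" by (meson finite_nat_set_iff_bounded_le)
  have init: "initial_segment I A"
    unfolding initial_segment_def
  proof (intro conjI ballI impI)
    fix a b assume "a \<in> I" "b \<in> A" "b \<le> a"
    from \<open>a \<in> I\<close> have "A \<inter> {..a} \<in> schreier N" by (simp add: I_def)
    then have "(A \<inter> {..a}) \<inter> {..b} \<in> schreier N" by (rule schreier_initial)
    moreover have "(A \<inter> {..a}) \<inter> {..b} = A \<inter> {..b}" using \<open>b \<le> a\<close> by auto
    ultimately show "b \<in> I" using \<open>b \<in> A\<close> by (simp add: I_def)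
  qed (auto simp: I_def)
  have eq: "J = A \<inter> {..Max J}" if "initial_segment J A" "finite J" "J \<noteq> {}" for J
  proof -
    have "Max J \<in> J" using that by simp
    moreover have "J \<subseteq> {..Max J}" using that(2) by auto
    ultimately show ?thesis using that(1) unfolding initial_segment_def by blast
  qed
  have "I \<in> schreier N"
  proof (cases "I = {}")
    case False
    then have "Max I \<in> I" using fin by simp
    then show ?thesis using eq[OF init fin False] by (simp add: I_def)
  qed simp
  moreover have "J \<subseteq> I" if J: "initial_segment J A" "J \<in> schreier N" for J
  proof (cases "J = {}")
    case False
    have f: "finite J" using J finite_schreier by blast
    then have "Max J \<in> A" using J Max_in[of J] False unfolding initial_segment_def by blast
    then have "Max J \<in> I" using eq[OF J(1) f False] J by (simp add: I_def)
    then show ?thesis using init J f False by (auto simp: initial_segment_def)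
  qed simp
  ultimately have "max_initial N A = I"
    unfolding max_initial_def using init by (intro Greatest_equality) auto
  then show ?thesis by (simp add: I_def)
qed

lemma finite_max_initial:
  assumes "infinite A"
  shows "finite (max_initial N A)"
proof -
  obtain B where "\<forall>l\<in>A. A \<inter> {..l} \<in> schreier N \<longrightarrow> l \<le> B"
    using schreier_initial_bounded[OF assms] by blast
  then show ?thesis
    using mem_max_initial[OF assms] finite_nat_set_iff_bounded_le by metis
qed

section \<open>Repeated averages: support, size, and dependence on initial parts\<close>

declare rep_avg.simps(2) [simp del]

lemma rep_avg_first:
  "k \<le> 1 \<Longrightarrow> rep_avg (Suc N) L k
     = (\<lambda>l. (1 / real (enumerate L 0)) * (\<Sum>i = 1..enumerate L 0. rep_avg N L i l))"
  by (subst rep_avg.simps(2)) (simp only: if_True)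

lemma rep_avg_later:
  "\<not> k \<le> 1 \<Longrightarrow> rep_avg (Suc N) L k
     = rep_avg (Suc N) (L - (\<Union>i\<in>{1..<k}. supp (rep_avg (Suc N) L i))) 1"
  by (subst rep_avg.simps(2)) (simp only: if_False)

text \<open>Finiteness keeps the sets from which supports have been removed infinite, so that
  \<open>enumerate\<close> keeps its meaning along the recursion.\<close>

lemma finite_supp_rep_avg:
  assumes "infinite L"
  shows "finite (supp (rep_avg N L k)) \<and> supp (rep_avg N L k) \<subseteq> L"
  using assms
proof (induction N arbitrary: L k)
  case 0
  have "supp (rep_avg 0 L k) = {enumerate L (k - 1)}"
    by (auto simp: supp_def unit_vec_def indicator_def)
  then show ?case using 0 by (auto simp: enumerate_in_set)
next
  case (Suc N)
  have one: "finite (supp (rep_avg (Suc N) L 1)) \<and> supp (rep_avg (Suc N) L 1) \<subseteq> L"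
    if "infinite L" for L
  proof -
    have "supp (rep_avg (Suc N) L 1) \<subseteq> (\<Union>i\<in>{1..enumerate L 0}. supp (rep_avg N L i))"
      by (auto simp: rep_avg_first supp_def dest: sum.not_neutral_contains_not_neutral)
    moreover have "finite (\<Union>i\<in>{1..enumerate L 0}. supp (rep_avg N L i))"
      "(\<Union>i\<in>{1..enumerate L 0}. supp (rep_avg N L i)) \<subseteq> L"
      using Suc.IH[OF that] by auto
    ultimately show ?thesis by (meson finite_subset subset_trans)
  qed
  show ?case
  proof (induction k rule: less_induct)
    case (less k)
    show ?case
    proof (cases "k \<le> 1")
      case True
      then have "rep_avg (Suc N) L k = rep_avg (Suc N) L 1" by (simp only: rep_avg_first)
      then show ?thesis using one[OF Suc.prems] by simp
    next
      case False
      define L' where "L' = L - (\<Union>i\<in>{1..<k}. supp (rep_avg (Suc N) L i))"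
      have "infinite L'" using less Suc.prems by (auto simp: L'_def)
      moreover have "rep_avg (Suc N) L k = rep_avg (Suc N) L' 1"
        unfolding L'_def by (rule rep_avg_later[OF False])
      ultimately show ?thesis using one[of L'] by (auto simp: L'_def)
    qed
  qed
qed

lemma rep_avg_bounds: "0 \<le> rep_avg N L k l \<and> rep_avg N L k l \<le> 1"
proof (induction N arbitrary: L k)
  case 0
  then show ?case by (simp add: unit_vec_def)
next
  case (Suc N)
  have one: "0 \<le> rep_avg (Suc N) L 1 l \<and> rep_avg (Suc N) L 1 l \<le> 1" for L
  proof -
    define a where "a = enumerate L 0"
    have "0 \<le> (\<Sum>i = 1..a. rep_avg N L i l)" using Suc by (simp add: sum_nonneg)
    moreover have "(\<Sum>i = 1..a. rep_avg N L i l) \<le> real (card {1..a}) * 1"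
      using Suc by (intro sum_bounded_above) auto
    ultimately show ?thesis by (auto simp: rep_avg_first a_def divide_simps)
  qed
  show ?case
  proof (cases "k \<le> 1")
    case True
    then have "rep_avg (Suc N) L k = rep_avg (Suc N) L 1" by (simp only: rep_avg_first)
    then show ?thesis using one by simp
  next
    case False
    then have "rep_avg (Suc N) L k
        = rep_avg (Suc N) (L - (\<Union>i\<in>{1..<k}. supp (rep_avg (Suc N) L i))) 1"
      by (rule rep_avg_later)
    then show ?thesis using one by presburger
  qed
qed

lemma enumerate_eq_cong:
  assumes "infinite (L :: nat set)" "infinite L'" "L \<inter> {..q} = L' \<inter> {..q}" "enumerate L k \<le> q"
  shows "enumerate L' k = enumerate L k"
  using assms(4)
proof (induction k rule: less_induct)
  case (less k)
  let ?a = "enumerate L k"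
  have in': "?a \<in> L'" using less.prems enumerate_in_set[OF assms(1), of k] assms(3) by blast
  have IH: "enumerate L' j = enumerate L j" if "j < k" for j
    using less that enumerate_mono[OF that assms(1)] by simp
  obtain i where i: "enumerate L' i = ?a" using enumerate_Ex[OF assms(2) in'] by auto
  have "\<not> i < k" using IH[of i] i enumerate_mono[OF _ assms(1), of i k] by auto
  moreover have "\<not> k < i"
  proof
    assume "k < i"
    then have "enumerate L' k < ?a" using i enumerate_mono[OF _ assms(2)] by metis
    then have "enumerate L' k \<le> q" using less.prems by linarith
    then have "enumerate L' k \<in> L"
      using enumerate_in_set[OF assms(2), of k] assms(3) by blast
    then obtain j where j: "enumerate L j = enumerate L' k" using enumerate_Ex[OF assms(1)] by blast
    then have "j < k" using \<open>enumerate L' k < ?a\<close> enumerate_mono_iff[OF assms(1)] by metis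
    then have "enumerate L' j = enumerate L' k" using IH j by simp
    then show False using \<open>j < k\<close> enumerate_mono[OF _ assms(2)] by (metis less_irrefl)
  qed
  ultimately show ?case using i by simp
qed

text \<open>The recursion inspects the least element and removes supports, and below
  \<open>q\<close> both are determined by the part of \<open>L\<close> below \<open>q\<close>. If
  the least elements exceed \<open>q\<close>, the two averages may have different lengths, but both
  vanish up to \<open>q\<close>.\<close>

lemma rep_avg_cong:
  assumes "infinite L" "infinite L'" "L \<inter> {..q} = L' \<inter> {..q}" "l \<le> q"
  shows "rep_avg N L k l = rep_avg N L' k l"
  using assms
proof (induction N arbitrary: L L' k l)
  case 0
  have "l = enumerate L (k - 1) \<longleftrightarrow> l = enumerate L' (k - 1)"
    using enumerate_eq_cong[OF 0(1,2,3), of "k - 1"]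
      enumerate_eq_cong[OF 0(2,1) 0(3)[symmetric], of "k - 1"] 0(4) by metis
  then show ?case by (auto simp: unit_vec_def indicator_def)
next
  case (Suc N)
  have one: "rep_avg (Suc N) L 1 l = rep_avg (Suc N) L' 1 l"
    if L: "infinite L" "infinite L'" "L \<inter> {..q} = L' \<inter> {..q}" "l \<le> q" for L L' l
  proof (cases "enumerate L 0 \<le> q \<or> enumerate L' 0 \<le> q")
    case True
    then have "enumerate L 0 = enumerate L' 0"
      using enumerate_eq_cong[OF L(1,2,3), of 0]
        enumerate_eq_cong[OF L(2,1) L(3)[symmetric], of 0] by metis
    then show ?thesis using Suc.IH[OF L] by (simp add: rep_avg_first)
  next
    case False
    have "l \<notin> L" "l \<notin> L'" using False L enumerate_0 Least_le by (metis order_trans)+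
    then have "rep_avg (Suc N) L 1 l = 0" "rep_avg (Suc N) L' 1 l = 0"
      using finite_supp_rep_avg L unfolding supp_def by blast+
    then show ?thesis by simp
  qed
  have "\<forall>l\<le>q. rep_avg (Suc N) L k l = rep_avg (Suc N) L' k l"
  proof (induction k rule: less_induct)
    case (less k)
    show ?case
    proof (cases "k \<le> 1")
      case True
      then have "rep_avg (Suc N) L k = rep_avg (Suc N) L 1" "rep_avg (Suc N) L' k = rep_avg (Suc N) L' 1"
        by (simp_all only: rep_avg_first)
      then show ?thesis using one[OF Suc.prems(1-3)] by simp
    next
      case False
      define M where "M L = L - (\<Union>i\<in>{1..<k}. supp (rep_avg (Suc N) L i))" for L
      have "infinite (M L)" "infinite (M L')"
        using finite_supp_rep_avg Suc.prems by (auto simp: M_def)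
      moreover have "M L \<inter> {..q} = M L' \<inter> {..q}"
      proof -
        have "x \<in> supp (rep_avg (Suc N) L i) \<longleftrightarrow> x \<in> supp (rep_avg (Suc N) L' i)"
          if "i \<in> {1..<k}" "x \<le> q" for i x
          using less that by (simp add: supp_def)
        then show ?thesis using Suc.prems(3) unfolding M_def by blast
      qed
      moreover have "rep_avg (Suc N) L k = rep_avg (Suc N) (M L) 1" for L
        unfolding M_def by (rule rep_avg_later[OF False])
      ultimately show ?thesis using one[of "M L" "M L'"] by simp
    qed
  qed
  then show ?case using Suc.prems(4) by blast
qed

declare (in jt_data) blk.simps [simp del]

section \<open>The norm in terms of node coefficients\<close>

abbreviation order_convex :: "nat set \<Rightarrow> bool" where
  "order_convex E \<equiv> \<forall>a\<in>E. \<forall>b\<in>E. {a..b} \<subseteq> E"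

context jt_tree
begin

section \<open>The tree order, paths and branches\<close>

lemma R_refl: "a \<in> insert 0 D \<Longrightarrow> (a, a) \<in> R"
  using order by (auto simp: partial_order_on_def preorder_on_def refl_on_def)

lemma R_trans: "(a, b) \<in> R \<Longrightarrow> (b, c) \<in> R \<Longrightarrow> (a, c) \<in> R"
  using order by (auto simp: partial_order_on_def preorder_on_def dest: transD)

lemma R_field: "(a, b) \<in> R \<Longrightarrow> a \<in> insert 0 D \<and> b \<in> insert 0 D"
  using order by (auto simp: partial_order_on_def preorder_on_def)

lemma D_pos: "l \<in> D \<Longrightarrow> 1 \<le> l"
  using root_notin by (cases l) auto

lemma chain_leD: "C \<in> Chains R \<Longrightarrow> a \<in> C \<Longrightarrow> b \<in> C \<Longrightarrow> a \<le> b \<Longrightarrow> (a, b) \<in> R"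
  using compatible unfolding Chains_def by (metis (mono_tags, lifting) mem_Collect_eq le_antisym)

definition path :: "nat set \<Rightarrow> bool" where
  "path h \<longleftrightarrow> h \<subseteq> D \<and> h \<in> Chains R \<and> (\<forall>a\<in>D. \<forall>b\<in>h. (a, b) \<in> R \<longrightarrow> a \<in> h)"

lemma ex_branch:
  assumes "C \<subseteq> D" "C \<in> Chains R"
  shows "\<exists>\<sigma>. branch \<sigma> \<and> C \<subseteq> \<sigma>"
proof -
  \<comment> \<open>Zorn's lemma is applied to the sets \<tau> for which
    \<open>C \<union> \<tau>\<close> is a chain in \<open>D\<close>, not to the supersets of
    \<open>C\<close>, so that the union of an empty family also belongs to \<open>A\<close>.\<close>
  define A where "A = {\<tau>. C \<union> \<tau> \<subseteq> D \<and> C \<union> \<tau> \<in> Chains R}"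
  have "\<Union>\<C> \<in> A" if \<C>: "subset.chain A \<C>" for \<C>
  proof -
    have sub: "\<C> \<subseteq> A" using \<C> by (simp add: subset.chain_def)
    have "(a, b) \<in> R \<or> (b, a) \<in> R" if "a \<in> C \<union> \<Union>\<C>" "b \<in> C \<union> \<Union>\<C>" for a b
    proof -
      have "\<exists>X\<in>insert {} \<C>. a \<in> C \<union> X" "\<exists>X\<in>insert {} \<C>. b \<in> C \<union> X" using that by auto
      then obtain X Y where XY: "X \<in> insert {} \<C>" "a \<in> C \<union> X" "Y \<in> insert {} \<C>" "b \<in> C \<union> Y"
        by blast
      then have "X \<subseteq> Y \<or> Y \<subseteq> X" using \<C> by (auto simp: subset.chain_def)
      then obtain Z where "Z \<in> insert {} \<C>" "a \<in> C \<union> Z" "b \<in> C \<union> Z" using XY by blast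
      moreover have "C \<union> Z \<in> Chains R"
        using \<open>Z \<in> insert {} \<C>\<close> sub assms by (auto simp: A_def)
      ultimately show ?thesis by (auto simp: Chains_def)
    qed
    then show ?thesis using sub assms by (auto simp: A_def Chains_def)
  qed
  then obtain M where M: "M \<in> A" "\<And>X. X \<in> A \<Longrightarrow> M \<subseteq> X \<Longrightarrow> X = M"
    using subset_Zorn'[of A] by blast
  have "M \<union> C = M" using M by (auto simp: A_def Un_commute)
  then have "C \<subseteq> M" by blast
  moreover have "branch M"
    unfolding branch_def
  proof (intro conjI allI impI)
    show "M \<subseteq> D" "M \<in> Chains R" using M \<open>C \<subseteq> M\<close> by (auto simp: A_def Un_absorb1)
    fix \<tau> assume "\<tau> \<subseteq> D \<and> \<tau> \<in> Chains R \<and> M \<subseteq> \<tau>"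
    then show "\<tau> = M" using M \<open>C \<subseteq> M\<close> by (auto simp: A_def Un_absorb1)
  qed
  ultimately show ?thesis by blast
qed

lemma branch_insert:
  assumes "branch \<sigma>" "a \<in> D" "\<And>c. c \<in> \<sigma> \<Longrightarrow> (a, c) \<in> R \<or> (c, a) \<in> R"
  shows "a \<in> \<sigma>"
proof -
  have "insert a \<sigma> \<in> Chains R" using assms R_refl by (auto simp: branch_def Chains_def)
  moreover have "insert a \<sigma> \<subseteq> D" using assms by (auto simp: branch_def)
  ultimately have "insert a \<sigma> = \<sigma>" using assms(1) unfolding branch_def by blast
  then show ?thesis by blast
qed

lemma branch_path:
  assumes "branch \<sigma>"
  shows "path \<sigma>"
  unfolding path_def
proof (intro conjI ballI impI)
  show "\<sigma> \<subseteq> D" "\<sigma> \<in> Chains R" using assms by (auto simp: branch_def)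
  fix a b assume a: "a \<in> D" "b \<in> \<sigma>" "(a, b) \<in> R"
  show "a \<in> \<sigma>"
  proof (rule branch_insert[OF assms a(1)])
    fix c assume "c \<in> \<sigma>"
    then have "(c, b) \<in> R \<or> (b, c) \<in> R" using \<open>\<sigma> \<in> Chains R\<close> a by (auto simp: Chains_def)
    then show "(a, c) \<in> R \<or> (c, a) \<in> R"
    proof
      assume "(c, b) \<in> R"
      then show ?thesis using predecessors[of b] a \<open>\<sigma> \<subseteq> D\<close> by (auto simp: Chains_def)
    qed (use a R_trans in blast)
  qed
qed

text \<open>A finite branch would end at its largest node, or at the root if it is empty, and an
  immediate successor would extend it.\<close>

lemma branch_infinite:
  assumes "branch \<sigma>"
  shows "infinite \<sigma>"
proof
  assume fin: "finite \<sigma>"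
  define t where "t = (if \<sigma> = {} then 0 else Max \<sigma>)"
  have \<sigma>: "\<sigma> \<subseteq> D" "\<sigma> \<in> Chains R" using assms by (auto simp: branch_def)
  have t: "t \<in> insert 0 D" using \<sigma>(1) Max_in[OF fin] unfolding t_def by (cases "\<sigma> = {}") auto
  obtain k where k: "immediate_succ t k" using infinite_succ[OF t] infinite_imp_nonempty by blast
  then have "(t, k) \<in> R" "t \<noteq> k" by (auto simp: immediate_succ_def)
  then have "t < k" using compatible by (simp add: le_neq_implies_less)
  then have "k \<in> D" using R_field[OF \<open>(t, k) \<in> R\<close>] by auto
  have "k \<in> \<sigma>"
  proof (rule branch_insert[OF assms \<open>k \<in> D\<close>])
    fix c assume c: "c \<in> \<sigma>"
    then have "t \<in> \<sigma>" "c \<le> t" using fin by (auto simp: t_def)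
    then have "(c, t) \<in> R" using c chain_leD \<sigma> by blast
    then show "(k, c) \<in> R \<or> (c, k) \<in> R" using \<open>(t, k) \<in> R\<close> R_trans by blast
  qed
  then have "k \<le> t" using fin by (auto simp: t_def)
  then show False using \<open>t < k\<close> by simp
qed

definition preds :: "nat \<Rightarrow> nat set" where
  "preds l = {k\<in>D. (k, l) \<in> R}"

lemma preds_chain: "l \<in> D \<Longrightarrow> preds l \<in> Chains R"
  using predecessors[of l] by (auto simp: preds_def Chains_def)

lemma path_preds: "l \<in> D \<Longrightarrow> path (preds l)"
  unfolding path_def using preds_chain R_trans by (auto simp: preds_def)

text \<open>On a chain the numerical order and the tree order agree. So all paths through
  \<open>l\<close> have the same part up to \<open>l\<close>, and a common node forces a common
  history.\<close>

lemma path_atMost: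
  assumes "path h" "l \<in> h"
  shows "h \<inter> {..l} = preds l"
  using assms chain_leD[of h] compatible by (auto simp: path_def preds_def)

section \<open>The blocks of a branch and their dependence on initial parts\<close>

lemma blk_eq: "blk \<sigma> k = max_initial (n (2 * blk_ind \<sigma> k + 1)) (blk_rest \<sigma> k)"
  by (subst blk.simps) (simp add: blk_ind_def blk_rest_def)

context
  fixes \<sigma> :: "nat set"
  assumes inf: "infinite \<sigma>" and pos: "\<sigma> \<subseteq> {1..}"
begin

lemma finite_blk: "finite (blk \<sigma> k)"
proof (induction k rule: less_induct)
  case (less k)
  then have "infinite (blk_rest \<sigma> k)" using inf by (auto simp: blk_rest_def)
  then show ?case unfolding blk_eq by (rule finite_max_initial)
qed

lemma infinite_blk_rest: "infinite (blk_rest \<sigma> k)"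
  using finite_blk inf by (auto simp: blk_rest_def)

lemma mem_blk:
  "l \<in> blk \<sigma> k \<longleftrightarrow> l \<in> blk_rest \<sigma> k \<and> blk_rest \<sigma> k \<inter> {..l} \<in> schreier (n (2 * blk_ind \<sigma> k + 1))"
  unfolding blk_eq by (rule mem_max_initial[OF infinite_blk_rest])

lemma blk_initial:
  assumes "l \<in> blk \<sigma> k" "x \<in> blk_rest \<sigma> k" "x \<le> l"
  shows "x \<in> blk \<sigma> k"
proof -
  have "(blk_rest \<sigma> k \<inter> {..l}) \<inter> {..x} \<in> schreier (n (2 * blk_ind \<sigma> k + 1))"
    using assms(1) mem_blk by (intro schreier_initial[of "blk_rest \<sigma> k \<inter> {..l}"]) auto
  moreover have "(blk_rest \<sigma> k \<inter> {..l}) \<inter> {..x} = blk_rest \<sigma> k \<inter> {..x}" using assms(3) by auto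
  ultimately show ?thesis using mem_blk assms(2) by metis
qed

lemma blk_subset: "blk \<sigma> k \<subseteq> \<sigma>"
  using mem_blk[of _ k] unfolding blk_rest_def by blast

lemma blk_disjoint: "1 \<le> i \<Longrightarrow> i < j \<Longrightarrow> l \<in> blk \<sigma> j \<Longrightarrow> l \<notin> blk \<sigma> i"
  using mem_blk[of l j] unfolding blk_rest_def by force

lemma blk_rest_Suc: "1 \<le> k \<Longrightarrow> blk_rest \<sigma> (Suc k) = blk_rest \<sigma> k - blk \<sigma> k"
  by (auto simp: blk_rest_def less_Suc_eq)

text \<open>Each step removes at least the least remaining node, because singletons are Schreier
  sets. Consequently the blocks exhaust \<sigma>.\<close>

lemma blk_rest_ge:
  assumes "1 \<le> k" "l \<in> blk_rest \<sigma> k"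
  shows "k \<le> l"
  using assms
proof (induction k arbitrary: l rule: dec_induct)
  case base
  then show ?case using pos by (auto simp: blk_rest_def)
next
  case (step k)
  then have l: "l \<in> blk_rest \<sigma> k" "l \<notin> blk \<sigma> k" using blk_rest_Suc by auto
  then have "k \<le> l" using step by blast
  moreover have "l \<noteq> k"
  proof
    assume "l = k"
    then have "blk_rest \<sigma> k \<inter> {..l} = {l}" using step.IH l by force
    then have "l \<in> blk \<sigma> k" using l mem_blk singleton_in_schreier[of l] step.hyps \<open>l = k\<close> by simp
    then show False using l by simp
  qed
  ultimately show ?case by simp
qed

lemma blk_cover:
  assumes "l \<in> \<sigma>"
  shows "\<exists>k\<ge>1. l \<in> blk \<sigma> k"
proof (rule ccontr)
  assume "\<not> ?thesis"
  then have "l \<in> blk_rest \<sigma> (Suc l)" using assms by (auto simp: blk_rest_def)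
  then have "Suc l \<le> l"
    using blk_rest_ge[of "Suc l" l] by simp
  then show False by simp
qed

end

text \<open>The index at step \<open>k + 1\<close> is read off the maximum of block
  \<open>k\<close>, which may lie beyond \<open>q\<close>. It is known from the part up to
  \<open>q\<close> as soon as some node up to \<open>q\<close> remains, since block \<open>k\<close>
  then ended before that node; hence the condition in the conclusion, and the simultaneous
  induction.\<close>

lemma blk_ind_cong:
  assumes \<sigma>: "infinite \<sigma>" "\<sigma> \<subseteq> {1..}" and \<tau>: "infinite \<tau>" "\<tau> \<subseteq> {1..}"
    and eq: "\<sigma> \<inter> {..q} = \<tau> \<inter> {..q}" and "1 \<le> k"
  shows "blk_rest \<sigma> k \<inter> {..q} = blk_rest \<tau> k \<inter> {..q}
    \<and> (blk_rest \<sigma> k \<inter> {..q} \<noteq> {} \<longrightarrow> blk_ind \<sigma> k = blk_ind \<tau> k)"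
  using assms(6)
proof (induction k rule: dec_induct)
  case base
  then show ?case using eq by (auto simp: blk_rest_def blk_ind_def)
next
  case (step k)
  note S = blk_rest_Suc[OF \<sigma> step.hyps(1)] blk_rest_Suc[OF \<tau> step.hyps(1)]
  show ?case
  proof (cases "blk_rest \<sigma> k \<inter> {..q} = {}")
    case True
    then show ?thesis using step.IH S by blast
  next
    case False
    then have ind: "blk_ind \<sigma> k = blk_ind \<tau> k" and rest: "blk_rest \<sigma> k \<inter> {..q} = blk_rest \<tau> k \<inter> {..q}"
      using step.IH by auto
    have mem: "l \<in> blk \<sigma> k \<longleftrightarrow> l \<in> blk \<tau> k" if "l \<le> q" for l
    proof -
      have "{..l} = {..q} \<inter> {..l}" using that by auto
      then have "blk_rest \<sigma> k \<inter> {..l} = blk_rest \<tau> k \<inter> {..l}" using rest by blast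
      moreover have "l \<in> blk_rest \<sigma> k \<longleftrightarrow> l \<in> blk_rest \<tau> k" using rest that by blast
      ultimately show ?thesis unfolding mem_blk[OF \<sigma>] mem_blk[OF \<tau>] ind by simp
    qed
    have rest': "blk_rest \<sigma> (Suc k) \<inter> {..q} = blk_rest \<tau> (Suc k) \<inter> {..q}"
      unfolding S using rest mem by blast
    moreover have "blk_ind \<sigma> (Suc k) = blk_ind \<tau> (Suc k)" if ne: "blk_rest \<sigma> (Suc k) \<inter> {..q} \<noteq> {}"
    proof -
      obtain r where r0: "r \<in> blk_rest \<sigma> (Suc k) \<inter> {..q}"
        using ne by (metis ex_in_conv)
      then have "r \<in> blk_rest \<tau> (Suc k) \<inter> {..q}" unfolding rest' .
      with r0 have r: "r \<in> blk_rest \<sigma> (Suc k)" "r \<in> blk_rest \<tau> (Suc k)" "r \<le> q"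
        by (simp_all only: Int_iff atMost_iff)
      have "l \<le> q" if "l \<in> blk \<sigma> k \<or> l \<in> blk \<tau> k" for l
      proof (rule ccontr)
        assume "\<not> l \<le> q"
        then have "r \<le> l" using r by simp
        then show False
          using that r S blk_initial[OF \<sigma>, of l k r] blk_initial[OF \<tau>, of l k r] by blast
      qed
      then have "blk \<sigma> k = blk \<tau> k" using mem by blast
      then show ?thesis using step.hyps by (simp add: blk_ind_def)
    qed
    ultimately show ?thesis by blast
  qed
qed

section \<open>Block numbers and coefficients of nodes\<close>

definition branch_of :: "nat \<Rightarrow> nat set" where
  "branch_of l = (SOME \<sigma>. branch \<sigma> \<and> l \<in> \<sigma>)"

text \<open>\<open>THE\<close> is legitimate because the blocks of a branch are disjoint and cover
  it. That the choice of the branch does not matter is the content of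
  \<open>blk_cong\<close>.\<close>

definition idx :: "nat \<Rightarrow> nat" where
  "idx l = (THE k. 1 \<le> k \<and> l \<in> blk (branch_of l) k)"

definition node_coeff :: "nat \<Rightarrow> real" where
  "node_coeff l = 1 / (real (m (2 * blk_ind (branch_of l) (idx l) + 1)))\<^sup>2 * \<beta> (branch_of l) (idx l) l"

lemma branch_of: "l \<in> D \<Longrightarrow> branch (branch_of l) \<and> l \<in> branch_of l"
  unfolding branch_of_def using ex_branch[of "{l}"] R_refl
  by (intro someI_ex[where P = "\<lambda>\<sigma>. branch \<sigma> \<and> l \<in> \<sigma>"]) (auto simp: Chains_def)

lemma branch_inf_pos: "branch \<sigma> \<Longrightarrow> infinite \<sigma>" "branch \<sigma> \<Longrightarrow> \<sigma> \<subseteq> {1..}"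
  using branch_infinite D_pos by (auto simp: branch_def)

lemma blk_cong:
  assumes "branch \<sigma>" "branch \<tau>" "l \<in> \<sigma>" "l \<in> \<tau>" "1 \<le> k"
  shows "l \<in> blk \<sigma> k \<longleftrightarrow> l \<in> blk \<tau> k"
    and "l \<in> blk \<sigma> k \<Longrightarrow> blk_ind \<sigma> k = blk_ind \<tau> k \<and> \<beta> \<sigma> k l = \<beta> \<tau> k l"
proof -
  note \<sigma> = branch_inf_pos[OF assms(1)] and \<tau> = branch_inf_pos[OF assms(2)]
  have "\<sigma> \<inter> {..l} = \<tau> \<inter> {..l}" using path_atMost branch_path assms by metis
  note * = blk_ind_cong[OF \<sigma> \<tau> this assms(5)]
  then show iff: "l \<in> blk \<sigma> k \<longleftrightarrow> l \<in> blk \<tau> k"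
    using mem_blk[OF \<sigma>, of l k] mem_blk[OF \<tau>, of l k] by fastforce
  assume l: "l \<in> blk \<sigma> k"
  then have ind: "blk_ind \<sigma> k = blk_ind \<tau> k" using * mem_blk[OF \<sigma>] by blast
  have "rep_avg N (blk_rest \<sigma> k) 1 l = rep_avg N (blk_rest \<tau> k) 1 l" for N
    using * by (intro rep_avg_cong[of _ _ l] infinite_blk_rest \<sigma> \<tau>) auto
  with ind show "blk_ind \<sigma> k = blk_ind \<tau> k \<and> \<beta> \<sigma> k l = \<beta> \<tau> k l" by (simp add: \<beta>_def)
qed

lemma mem_blk_iff_idx:
  assumes "branch \<sigma>" "l \<in> \<sigma>"
  shows "1 \<le> idx l" "1 \<le> k \<Longrightarrow> l \<in> blk \<sigma> k \<longleftrightarrow> idx l = k"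
proof -
  have "l \<in> D" using assms by (auto simp: branch_def)
  note b = branch_of[OF this]
  note ip = branch_inf_pos[of "branch_of l"]
  obtain k0 where k0: "1 \<le> k0" "l \<in> blk (branch_of l) k0"
    using blk_cover[of "branch_of l" l] b ip by blast
  have uniq: "k = k0" if "1 \<le> k" "l \<in> blk (branch_of l) k" for k
    using that k0 blk_disjoint[of "branch_of l"] b ip by (metis linorder_neqE_nat)
  have idx: "idx l = k0" unfolding idx_def by (rule the_equality) (use k0 uniq in blast)+
  show "1 \<le> idx l" using idx k0 by simp
  assume "1 \<le> k"
  then show "l \<in> blk \<sigma> k \<longleftrightarrow> idx l = k"
    using blk_cong(1)[of \<sigma> "branch_of l" l k] b assms idx k0 uniq by metis
qed

lemma node_coeff_eq:
  assumes "branch \<sigma>" "l \<in> \<sigma>"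
  shows "node_coeff l = 1 / (real (m (2 * blk_ind \<sigma> (idx l) + 1)))\<^sup>2 * \<beta> \<sigma> (idx l) l"
proof -
  have "l \<in> D" using assms by (auto simp: branch_def)
  note b = branch_of[OF this] and i = mem_blk_iff_idx[OF assms]
  then show ?thesis
    using blk_cong(2)[of "branch_of l" \<sigma> l "idx l"] assms i(1) mem_blk_iff_idx(2)[of "branch_of l" l "idx l"]
    by (simp add: node_coeff_def)
qed

lemma abs_node_coeff_le: "\<bar>node_coeff l\<bar> \<le> 1"
proof -
  define M where "M = real (m (2 * blk_ind (branch_of l) (idx l) + 1))"
  define B where "B = \<beta> (branch_of l) (idx l) l"
  have "1 \<le> M" using m_pos[of "2 * blk_ind (branch_of l) (idx l) + 1"] by (simp add: M_def)
  then have "0 \<le> 1 / M\<^sup>2" "1 / M\<^sup>2 \<le> 1" by (simp_all add: divide_simps)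
  moreover have "0 \<le> B" "B \<le> 1" using rep_avg_bounds by (simp_all add: B_def \<beta>_def)
  ultimately have "0 \<le> 1 / M\<^sup>2 * B" "1 / M\<^sup>2 * B \<le> 1" by (auto simp del: times_divide_eq_left intro: mult_le_one)
  moreover have "node_coeff l = 1 / M\<^sup>2 * B" by (simp add: node_coeff_def M_def B_def)
  ultimately show ?thesis by linarith
qed

text \<open>Truncating the $\ell_2$-sum at the block index \<open>K\<close>, and not at the node, makes \<open>sqn\<close> linear
  inside, monotone in \<open>K\<close>, and meaningful for sequences of infinite support.\<close>

definition blk_sum :: "nat set \<Rightarrow> nat \<Rightarrow> (nat \<Rightarrow> real) \<Rightarrow> real" where
  "blk_sum s i x = (\<Sum>l\<in>{l\<in>s. idx l = i}. node_coeff l * x l)"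

definition sqn :: "nat \<Rightarrow> nat set \<Rightarrow> (nat \<Rightarrow> real) \<Rightarrow> real" where
  "sqn K s x = L2_set (\<lambda>i. blk_sum s i x) {..K}"

lemma \<phi>_eq_blk_sum:
  assumes "branch \<sigma>" "1 \<le> k"
  shows "\<phi> \<sigma> k x = blk_sum \<sigma> k x"
proof -
  have "blk \<sigma> k = {l\<in>\<sigma>. idx l = k}"
    using mem_blk_iff_idx(2)[OF assms(1)] assms(2) blk_subset[OF branch_inf_pos[OF assms(1)]] by blast
  then show ?thesis
    unfolding \<phi>_def blk_sum_def sum_distrib_left
    by (intro sum.cong) (auto simp: node_coeff_eq[OF assms(1)])
qed

lemma idx_pos: "l \<in> D \<Longrightarrow> 1 \<le> idx l"
  using mem_blk_iff_idx(1) branch_of by blast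

text \<open>This allows \<open>blk_sum\<close> to be used on infinite paths: a sum over an infinite
  set would be 0 by convention.\<close>

lemma finite_idx_class:
  assumes "path h"
  shows "finite {l\<in>h. idx l = i}"
proof (cases "1 \<le> i")
  case True
  obtain \<sigma> where \<sigma>: "branch \<sigma>" "h \<subseteq> \<sigma>" using ex_branch assms unfolding path_def by blast
  then have "{l\<in>h. idx l = i} \<subseteq> blk \<sigma> i" using mem_blk_iff_idx(2) True by auto
  then show ?thesis using finite_blk[OF branch_inf_pos[OF \<sigma>(1)]] finite_subset by blast
next
  case False
  then have "{l\<in>h. idx l = i} = {}" using idx_pos assms by (fastforce simp: path_def)
  then show ?thesis by (simp only: finite.emptyI)
qed

lemma blk_sum_add: "blk_sum s i (\<lambda>l. x l + y l) = blk_sum s i x + blk_sum s i y"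
  by (simp add: blk_sum_def distrib_left sum.distrib)

lemma blk_sum_scale: "blk_sum s i (\<lambda>l. c * x l) = c * blk_sum s i x"
  by (simp add: blk_sum_def sum_distrib_left mult_ac)

lemma blk_sum_restr:
  assumes "finite {l\<in>s. idx l = i}"
  shows "blk_sum s i (restr x E) = blk_sum (s \<inter> E) i x"
proof -
  have "blk_sum (s \<inter> E) i x = (\<Sum>l\<in>{l\<in>s. idx l = i} \<inter> E. node_coeff l * x l)"
    unfolding blk_sum_def by (intro sum.cong) auto
  also have "\<dots> = (\<Sum>l\<in>{l\<in>s. idx l = i}. if l \<in> E then node_coeff l * x l else 0)"
    by (rule sum.inter_restrict[OF assms])
  finally show ?thesis unfolding blk_sum_def restr_def by (auto intro: sum.cong)
qed

lemma sqn_nonneg [simp]: "0 \<le> sqn K s x"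
  by (simp add: sqn_def)

lemma sqn_mono: "K \<le> K' \<Longrightarrow> sqn K s x \<le> sqn K' s x"
  unfolding sqn_def L2_set_def by (intro real_sqrt_le_mono sum_mono2) auto

lemma sqn_add: "sqn K s (\<lambda>l. x l + y l) \<le> sqn K s x + sqn K s y"
  unfolding sqn_def blk_sum_add by (rule L2_set_triangle_ineq)

lemma sqn_scale: "sqn K s (\<lambda>l. c * x l) = \<bar>c\<bar> * sqn K s x"
  by (simp add: sqn_def blk_sum_scale L2_set_def power_mult_distrib real_sqrt_mult
      flip: sum_distrib_left)

lemma sqn_empty [simp]: "sqn K {} x = 0"
  by (simp add: sqn_def blk_sum_def L2_set_def)

section \<open>Segments as finite pieces of paths\<close>

lemma segmentD:
  assumes "segment s"
  shows "finite s" "s \<noteq> {}" "s \<subseteq> D" "s \<in> Chains R" "1 \<le> Min s"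
    "\<exists>h p q. path h \<and> s = h \<inter> {p..q}"
proof -
  obtain a b where ab: "a \<in> D" "b \<in> D" "(a, b) \<in> R" "s = {k\<in>D. (a, k) \<in> R \<and> (k, b) \<in> R}"
    using assms by (auto simp: segment_def)
  show ne: "s \<noteq> {}" and "s \<subseteq> D" using ab R_refl by auto
  have "s \<subseteq> {..b}" using ab compatible by auto
  then show "finite s" using finite_subset by blast
  then have "Min s \<in> s" using ne by simp
  then show "1 \<le> Min s" using D_pos \<open>s \<subseteq> D\<close> by blast
  show "s \<in> Chains R" using preds_chain[OF ab(2)] ab(4) by (auto simp: preds_def Chains_def)
  have "a \<in> preds b" using ab by (auto simp: preds_def)
  then have "s = preds b \<inter> {a..b}"
    unfolding ab(4) using compatible chain_leD[OF preds_chain[OF ab(2)] \<open>a \<in> preds b\<close>]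
    by (fastforce simp: preds_def)
  then show "\<exists>h p q. path h \<and> s = h \<inter> {p..q}" using path_preds[OF ab(2)] by blast
qed

lemma segment_of_path:
  assumes "path h" "h \<inter> {p..q} \<noteq> {}"
  shows "segment (h \<inter> {p..q})"
proof -
  let ?s = "h \<inter> {p..q}"
  define a b where "a = Min ?s" and "b = Max ?s"
  have a: "a \<in> ?s" and b: "b \<in> ?s" and le: "\<And>k. k \<in> ?s \<Longrightarrow> a \<le> k \<and> k \<le> b"
    using assms(2) unfolding a_def b_def by (intro Min_in Max_in Min_le Max_ge conjI; simp)+
  have h: "h \<subseteq> D" "\<And>x y. x \<in> h \<Longrightarrow> y \<in> h \<Longrightarrow> x \<le> y \<Longrightarrow> (x, y) \<in> R"
    "\<And>x y. x \<in> D \<Longrightarrow> y \<in> h \<Longrightarrow> (x, y) \<in> R \<Longrightarrow> x \<in> h"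
    using assms(1) chain_leD by (auto simp: path_def)
  have "?s = {k\<in>D. (a, k) \<in> R \<and> (k, b) \<in> R}" (is "_ = ?t")
  proof
    show "?s \<subseteq> ?t" using h a b le by auto
    show "?t \<subseteq> ?s"
    proof
      fix k assume k: "k \<in> ?t"
      then have "k \<in> h" using h(3) b by blast
      moreover have "a \<le> k" "k \<le> b" using k compatible by auto
      ultimately show "k \<in> ?s" using a b by auto
    qed
  qed
  moreover have "a \<in> D" "b \<in> D" "(a, b) \<in> R" using a b h le by auto
  ultimately show ?thesis unfolding segment_def by blast
qed

lemma segment_Int:
  assumes "segment s" "s \<inter> E \<noteq> {}" "order_convex E"
  shows "segment (s \<inter> E)"
proof -
  obtain h p q where h: "path h" "s = h \<inter> {p..q}" using segmentD(6)[OF assms(1)] by blast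
  have f: "finite (s \<inter> E)" using segmentD(1)[OF assms(1)] by simp
  let ?a = "Min (s \<inter> E)" and ?b = "Max (s \<inter> E)"
  have ab: "?a \<in> s \<inter> E" "?b \<in> s \<inter> E" using Min_in[OF f assms(2)] Max_in[OF f assms(2)] by blast+
  have "s \<inter> E = h \<inter> {?a..?b}"
  proof
    show "s \<inter> E \<subseteq> h \<inter> {?a..?b}" using h f by auto
    have "{?a..?b} \<subseteq> E" using assms(3) ab by blast
    moreover have "{?a..?b} \<subseteq> {p..q}" using ab h(2) by auto
    ultimately show "h \<inter> {?a..?b} \<subseteq> s \<inter> E" using h(2) by blast
  qed
  then show ?thesis using segment_of_path[OF h(1), of ?a ?b] assms(2) by simp
qed

lemma restr_restr: "restr (restr x A) B = restr x (A \<inter> B)"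
  by (auto simp: restr_def)

lemma blk_sum_segment_restr: "segment s \<Longrightarrow> blk_sum s i (restr x E) = blk_sum (s \<inter> E) i x"
  using segmentD(1) by (intro blk_sum_restr) auto

lemma sqn_segment_restr: "segment s \<Longrightarrow> sqn K s (restr x E) = sqn K (s \<inter> E) x"
  by (simp add: sqn_def blk_sum_segment_restr)

lemma blk_sum_zero: "s \<subseteq> D \<Longrightarrow> blk_sum s 0 x = 0"
  using idx_pos unfolding blk_sum_def by (intro sum.neutral) fastforce

lemma sqn_eq_from_1:
  assumes "s \<subseteq> D"
  shows "sqn K s x = L2_set (\<lambda>i. blk_sum s i x) {1..K}"
proof -
  have "{..K} = insert 0 {1..K}" by auto
  then show ?thesis using blk_sum_zero[OF assms] by (simp add: sqn_def)
qed

lemma sqn_le_sum_abs: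
  assumes "finite s"
  shows "sqn K s x \<le> (\<Sum>l\<in>s. \<bar>x l\<bar>)"
proof -
  have "sqn K s x \<le> (\<Sum>i\<le>K. \<bar>blk_sum s i x\<bar>)" unfolding sqn_def by (rule L2_set_le_sum_abs)
  also have "\<dots> \<le> (\<Sum>i\<le>K. \<Sum>l\<in>{l\<in>s. idx l = i}. \<bar>x l\<bar>)"
    unfolding blk_sum_def
  proof (intro sum_mono order_trans[OF sum_abs])
    fix i l
    show "\<bar>node_coeff l * x l\<bar> \<le> \<bar>x l\<bar>"
      using mult_right_mono[OF abs_node_coeff_le[of l] abs_ge_zero[of "x l"]] by (simp add: abs_mult)
  qed
  also have "\<dots> = (\<Sum>l\<in>(\<Union>i\<in>{..K}. {l\<in>s. idx l = i}). \<bar>x l\<bar>)"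
    using assms by (subst sum.UNION_disjoint) auto
  also have "\<dots> \<le> (\<Sum>l\<in>s. \<bar>x l\<bar>)" using assms by (intro sum_mono2) auto
  finally show ?thesis .
qed

section \<open>Segment norms compared with truncated square sums\<close>

context
  fixes s and \<sigma>
  assumes s: "segment s" and \<sigma>: "\<sigma> = (SOME \<sigma>. branch \<sigma> \<and> s \<subseteq> \<sigma>)"
begin

lemma segment_branch: "branch \<sigma>" "s \<subseteq> \<sigma>"
  using ex_branch[OF segmentD(3,4)[OF s]] someI_ex[of "\<lambda>\<sigma>. branch \<sigma> \<and> s \<subseteq> \<sigma>"]
  unfolding \<sigma> by auto

lemma \<phi>_restr:
  assumes "1 \<le> i"
  shows "\<phi> \<sigma> i (restr (restr x s) E) = blk_sum (s \<inter> E) i x"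
proof -
  have "\<sigma> \<inter> (s \<inter> E) = s \<inter> E" using segment_branch by auto
  then show ?thesis
    using blk_sum_restr[OF finite_idx_class[OF branch_path[OF segment_branch(1)]], of i x "s \<inter> E"]
    by (simp add: \<phi>_eq_blk_sum[OF segment_branch(1) assms] restr_restr)
qed

lemma segment_norm_eq: "segment_norm s x = (SUP f\<in>W \<sigma>. f (restr x s))"
  by (simp add: segment_norm_def branch_norm_def \<sigma>)

text \<open>The Cauchy-Schwarz inequality removes the coefficients. The interval \<open>E\<close>
  has to stay, since cutting a block can destroy cancellations and increase its sum.\<close>

lemma W_le_sqn:
  assumes "f \<in> W \<sigma>"
  shows "\<exists>E K. order_convex E \<and> f (restr x s) \<le> sqn K (s \<inter> E) x"
proof -
  obtain N c E where f: "f = (\<lambda>x. \<Sum>i = 1..N. c i * \<phi> \<sigma> i (restr x E))"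
    and c: "(\<Sum>i = 1..N. (c i)\<^sup>2) \<le> 1" and E: "order_convex E"
    using assms by (auto simp: W_def)
  have "f (restr x s) = (\<Sum>i = 1..N. c i * blk_sum (s \<inter> E) i x)"
    unfolding f by (intro sum.cong refl) (simp add: \<phi>_restr)
  also have "\<dots> \<le> (\<Sum>i = 1..N. \<bar>c i\<bar> * \<bar>blk_sum (s \<inter> E) i x\<bar>)"
    by (intro sum_mono) (simp flip: abs_mult)
  also have "\<dots> \<le> L2_set c {1..N} * L2_set (\<lambda>i. blk_sum (s \<inter> E) i x) {1..N}"
    by (rule L2_set_mult_ineq)
  also have "\<dots> \<le> 1 * L2_set (\<lambda>i. blk_sum (s \<inter> E) i x) {1..N}"
    using c by (intro mult_right_mono L2_set_nonneg) (simp add: L2_set_def)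
  also have "\<dots> = sqn N (s \<inter> E) x"
    using segmentD(3)[OF s] by (subst sqn_eq_from_1) auto
  finally show ?thesis using E by blast
qed

lemma W_bdd: "bdd_above ((\<lambda>f. f (restr x s)) ` W \<sigma>)"
proof (rule bdd_aboveI2)
  fix f assume "f \<in> W \<sigma>"
  then obtain E K where "f (restr x s) \<le> sqn K (s \<inter> E) x" using W_le_sqn by blast
  also have "\<dots> \<le> (\<Sum>l\<in>s \<inter> E. \<bar>x l\<bar>)" using segmentD(1)[OF s] by (intro sqn_le_sum_abs) auto
  also have "\<dots> \<le> (\<Sum>l\<in>s. \<bar>x l\<bar>)" using segmentD(1)[OF s] by (intro sum_mono2) auto
  finally show "f (restr x s) \<le> (\<Sum>l\<in>s. \<bar>x l\<bar>)" .
qed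

lemma W_nonempty: "W \<sigma> \<noteq> {}"
proof -
  have "(\<lambda>x. \<Sum>i = 1..0. 0 * \<phi> \<sigma> i (restr x UNIV)) \<in> W \<sigma>"
    unfolding W_def by (intro CollectI exI[of _ 0] exI[of _ UNIV] exI[of _ "\<lambda>_. 0"]) simp
  then show ?thesis by blast
qed

text \<open>On a finite segment only finitely many sets \<open>s \<inter> E\<close> and block
  numbers occur, so one pair of \<open>E\<close> and \<open>K\<close> dominates all
  functionals.\<close>

lemma segment_norm_le_sqn:
  "\<exists>E K. order_convex E \<and> segment_norm s x \<le> sqn K (s \<inter> E) x"
proof -
  define K0 where "K0 = Max (idx ` s)"
  have fs: "finite s" using segmentD(1)[OF s] .
  have K0: "sqn K t x \<le> sqn K0 t x" if "t \<subseteq> s" for t K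
  proof (cases "K \<le> K0")
    case False
    have "blk_sum t i x = 0" if "i > K0" for i
    proof -
      have "idx l \<le> K0" if "l \<in> t" for l using \<open>t \<subseteq> s\<close> that fs unfolding K0_def by (intro Max_ge) auto
      then have "{l\<in>t. idx l = i} = {}" using that by fastforce
      then show ?thesis unfolding blk_sum_def by (simp only: sum.empty)
    qed
    then have "sqn K t x = sqn K0 t x"
      unfolding sqn_def L2_set_def using False
      by (intro arg_cong[of _ _ sqrt] sum.mono_neutral_right) auto
    then show ?thesis by simp
  qed (rule sqn_mono)
  define T where "T = {s \<inter> E | E. order_convex E}"
  have T: "finite T" using fs by (intro finite_subset[of T "Pow s"]) (auto simp: T_def)
  have "s \<in> T" unfolding T_def using Int_UNIV_right[of s] by blast
  then have "Max ((\<lambda>t. sqn K0 t x) ` T) \<in> (\<lambda>t. sqn K0 t x) ` T" using T by (intro Max_in) auto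
  then obtain t where t: "t \<in> T" "Max ((\<lambda>t. sqn K0 t x) ` T) = sqn K0 t x" by auto
  have "segment_norm s x \<le> sqn K0 t x"
    unfolding segment_norm_eq
  proof (rule cSUP_least[OF W_nonempty])
    fix f assume "f \<in> W \<sigma>"
    from W_le_sqn[OF this, of x] obtain E K
      where E: "order_convex E" "f (restr x s) \<le> sqn K (s \<inter> E) x"
      by (elim exE conjE)
    have "sqn K (s \<inter> E) x \<le> sqn K0 (s \<inter> E) x" by (rule K0) auto
    also have "\<dots> \<le> sqn K0 t x"
      unfolding t(2)[symmetric] using T E(1) by (intro Max_ge) (auto simp: T_def)
    finally show "f (restr x s) \<le> sqn K0 t x" using E(2) by simp
  qed
  moreover obtain E where "t = s \<inter> E" "order_convex E" using t(1) unfolding T_def by blast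
  ultimately show ?thesis by (intro exI[of _ E] exI[of _ K0] conjI) simp_all
qed

lemma sqn_le_segment_norm: "sqn K s x \<le> segment_norm s x"
proof (rule field_le_epsilon)
  fix e :: real assume "0 < e"
  define q where "q = sqn K s x"
  define v where "v i = blk_sum s i x" for i
  define S where "S = (\<Sum>i = 1..K. \<bar>v i\<bar>)"
  have q: "q = L2_set v {1..K}"
    unfolding q_def v_def using segmentD(3)[OF s] by (rule sqn_eq_from_1)
  have S: "0 \<le> S" by (simp add: S_def sum_nonneg)
  define d where "d = e / (S + 1)"
  have d: "0 < d" using \<open>0 < e\<close> S by (simp add: d_def)
  \<comment> \<open>Rounding towards 0 keeps the sum of the squares at most 1.\<close>
  have "\<exists>r\<in>\<rat>. \<bar>r\<bar> \<le> \<bar>c\<bar> \<and> \<bar>r - c\<bar> \<le> d" for c :: real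
  proof (cases "c = 0")
    case False
    define lo hi where "lo = (if c > 0 then max 0 (c - d) else c)"
      and "hi = (if c > 0 then c else min 0 (c + d))"
    have "lo < hi" using d False by (auto simp: lo_def hi_def)
    then obtain r where "r \<in> \<rat>" "lo < r" "r < hi" using Rats_dense_in_real by blast
    then show ?thesis
      using d False by (intro bexI[of _ r]) (auto simp: lo_def hi_def abs_if split: if_splits)
  qed (use d in auto)
  then obtain \<rho> where \<rho>: "\<And>c. \<rho> c \<in> \<rat>" "\<And>c. \<bar>\<rho> c\<bar> \<le> \<bar>c\<bar>" "\<And>c. \<bar>\<rho> c - c\<bar> \<le> d" by metis
  define c where "c i = \<rho> (v i / q)" for i
  define f where "f = (\<lambda>x. \<Sum>i = 1..K. c i * \<phi> \<sigma> i (restr x UNIV))"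
  \<comment> \<open>If \<open>q = 0\<close>, all quotients are 0 by convention and the following
    estimates remain valid.\<close>
  have vv: "(\<Sum>i = 1..K. (v i)\<^sup>2) = q\<^sup>2" unfolding q L2_set_def by (simp add: sum_nonneg)
  have "(\<Sum>i = 1..K. (c i)\<^sup>2) \<le> (\<Sum>i = 1..K. (v i / q)\<^sup>2)"
    unfolding c_def by (intro sum_mono) (use \<rho>(2) abs_le_square_iff in blast)
  also have "\<dots> = (\<Sum>i = 1..K. (v i)\<^sup>2) / q\<^sup>2" by (simp add: power_divide sum_divide_distrib)
  also have "\<dots> \<le> 1" unfolding vv by simp
  finally have "f \<in> W \<sigma>"
    unfolding f_def W_def using \<rho>(1) by (auto simp: c_def intro!: exI[of _ K] exI[of _ c] exI[of _ UNIV])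
  then have "f (restr x s) \<le> segment_norm s x"
    unfolding segment_norm_eq by (intro cSUP_upper W_bdd)
  moreover have "f (restr x s) = (\<Sum>i = 1..K. c i * v i)"
    unfolding f_def v_def by (intro sum.cong refl) (simp add: \<phi>_restr)
  moreover have "(\<Sum>i = 1..K. v i / q * v i) - (\<Sum>i = 1..K. c i * v i) \<le> e"
  proof -
    have "(\<Sum>i = 1..K. v i / q * v i) - (\<Sum>i = 1..K. c i * v i) = (\<Sum>i = 1..K. (v i / q - c i) * v i)"
      by (simp add: left_diff_distrib sum_subtractf)
    also have "\<dots> \<le> (\<Sum>i = 1..K. d * \<bar>v i\<bar>)"
    proof (rule sum_mono)
      fix i
      have "(v i / q - c i) * v i \<le> \<bar>v i / q - c i\<bar> * \<bar>v i\<bar>" by (simp flip: abs_mult)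
      also have "\<dots> \<le> d * \<bar>v i\<bar>"
        using \<rho>(3)[of "v i / q"] by (intro mult_right_mono) (auto simp: c_def abs_minus_commute)
      finally show "(v i / q - c i) * v i \<le> d * \<bar>v i\<bar>" .
    qed
    also have "\<dots> = d * S" by (simp add: S_def flip: sum_distrib_left)
    also have "\<dots> = e * (S / (S + 1))" by (simp add: d_def)
    also have "\<dots> \<le> e * 1" using \<open>0 < e\<close> S by (intro mult_left_mono) auto
    finally show ?thesis by simp
  qed
  moreover have "(\<Sum>i = 1..K. v i / q * v i) = q"
  proof -
    have "(\<Sum>i = 1..K. v i / q * v i) = (\<Sum>i = 1..K. (v i)\<^sup>2) / q"
      by (simp add: sum_divide_distrib power2_eq_square)
    then show ?thesis unfolding vv by (simp add: power2_eq_square)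
  qed
  ultimately show "sqn K s x \<le> segment_norm s x + e" by (simp add: q_def)
qed

end

lemma segment_norm_nonneg: "segment s \<Longrightarrow> 0 \<le> segment_norm s x"
  using sqn_le_segment_norm[OF _ refl, of s 0 x] sqn_nonneg order_trans by blast

lemma segment_norm_le_sum_abs:
  assumes "segment s"
  shows "segment_norm s x \<le> (\<Sum>l\<in>s. \<bar>x l\<bar>)"
proof -
  obtain E K where "segment_norm s x \<le> sqn K (s \<inter> E) x"
    using segment_norm_le_sqn[OF assms refl] by blast
  also have "\<dots> \<le> (\<Sum>l\<in>s \<inter> E. \<bar>x l\<bar>)" using segmentD(1)[OF assms] by (intro sqn_le_sum_abs) auto
  also have "\<dots> \<le> (\<Sum>l\<in>s. \<bar>x l\<bar>)" using segmentD(1)[OF assms] by (intro sum_mono2) auto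
  finally show ?thesis .
qed

section \<open>The norm through families of segments\<close>

lemma inj_on_Min_family:
  assumes "\<forall>s\<in>A. segment s" "disjoint A"
  shows "inj_on Min A"
proof (rule inj_onI)
  fix s t assume st: "s \<in> A" "t \<in> A" "Min s = Min t"
  have "Min s \<in> s" "Min t \<in> t" using st assms(1) segmentD(1,2) by (blast intro: Min_in)+
  then have "s \<inter> t \<noteq> {}" using st(3) by auto
  then show "s = t" using assms(2) st by (auto simp: disjoint_def)
qed

text \<open>The minima of the family form a Schreier set themselves, and the supremum over all
  Schreier sets is attained there.\<close>

lemma S2_norm_family:
  assumes A: "A \<in> segment_families"
  shows "S2_norm (\<lambda>l. \<Sum>s\<in>A. c s * unit_vec (Min s) l) = L2_set c A"
proof -
  define g where "g l = (\<Sum>s\<in>A. c s * unit_vec (Min s) l)" for l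
  have fin: "finite A" and inj: "inj_on Min A" and sch: "Min ` A \<in> schreier1"
    using A inj_on_Min_family by (auto simp: segment_families_def)
  have g: "g (Min s) = c s" if "s \<in> A" for s
  proof -
    have "g (Min s) = (\<Sum>t\<in>A. if t = s then c t else 0)"
      unfolding g_def unit_vec_def indicator_def using inj that
      by (intro sum.cong) (auto simp: inj_on_def)
    then show ?thesis using fin that by simp
  qed
  have g0: "g l = 0" if "l \<notin> Min ` A" for l
    unfolding g_def unit_vec_def using that by (intro sum.neutral) (auto simp: indicator_def)
  have eq: "(\<Sum>i\<in>Min ` A. (g i)\<^sup>2) = (\<Sum>s\<in>A. (c s)\<^sup>2)"
    using inj g by (simp add: sum.reindex)
  have le: "sqrt (\<Sum>i\<in>F. (g i)\<^sup>2) \<le> L2_set c A" if "F \<in> schreier1" for F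
  proof -
    have "finite F" using that by (auto simp: schreier1_def)
    then have "(\<Sum>i\<in>F. (g i)\<^sup>2) = (\<Sum>i\<in>F \<inter> Min ` A. (g i)\<^sup>2)"
      using g0 by (intro sum.mono_neutral_right) auto
    also have "\<dots> \<le> (\<Sum>i\<in>Min ` A. (g i)\<^sup>2)" using fin by (intro sum_mono2) auto
    finally show ?thesis unfolding L2_set_def eq by simp
  qed
  have "S2_norm g = L2_set c A"
    unfolding S2_norm_def
  proof (rule antisym)
    show "(SUP F\<in>schreier1. sqrt (\<Sum>i\<in>F. (g i)\<^sup>2)) \<le> L2_set c A"
      using le sch by (intro cSUP_least) auto
    have "L2_set c A = sqrt (\<Sum>i\<in>Min ` A. (g i)\<^sup>2)" unfolding L2_set_def eq ..
    also have "\<dots> \<le> (SUP F\<in>schreier1. sqrt (\<Sum>i\<in>F. (g i)\<^sup>2))"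
      using le by (intro cSUP_upper sch bdd_aboveI2)
    finally show "L2_set c A \<le> (SUP F\<in>schreier1. sqrt (\<Sum>i\<in>F. (g i)\<^sup>2))" .
  qed
  then show ?thesis by (simp add: g_def[abs_def])
qed

lemma JTG_norm_eq:
  "JTG_norm x = max (sup_norm x) (SUP A\<in>segment_families. L2_set (\<lambda>s. segment_norm s x) A)"
  unfolding JTG_norm_def by (simp add: S2_norm_family cong: SUP_cong_simp)

lemma segment_families_nonempty: "{} \<in> segment_families"
  by (simp add: segment_families_def schreier1_def)

lemma L2_segment_norm_bound:
  assumes "finite (supp x)" "A \<in> segment_families"
  shows "L2_set (\<lambda>s. segment_norm s x) A \<le> (\<Sum>l\<in>supp x. \<bar>x l\<bar>)"
proof -
  have A: "finite A" "\<And>s. s \<in> A \<Longrightarrow> segment s" "disjoint A"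
    using assms by (auto simp: segment_families_def)
  have "L2_set (\<lambda>s. segment_norm s x) A \<le> (\<Sum>s\<in>A. segment_norm s x)"
    using A segment_norm_nonneg by (intro L2_set_le_sum) auto
  also have "\<dots> \<le> (\<Sum>s\<in>A. \<Sum>l\<in>s. \<bar>x l\<bar>)"
    using A segment_norm_le_sum_abs by (intro sum_mono) auto
  also have "\<dots> = (\<Sum>l\<in>(\<Union>s\<in>A. s). \<bar>x l\<bar>)"
    using A segmentD(1) by (intro sum.UNION_disjoint[symmetric]) (auto simp: disjoint_def)
  also have "\<dots> = (\<Sum>l\<in>(\<Union>s\<in>A. s) \<inter> supp x. \<bar>x l\<bar>)"
    using A segmentD(1) by (intro sum.mono_neutral_right) (auto simp: supp_def)
  also have "\<dots> \<le> (\<Sum>l\<in>supp x. \<bar>x l\<bar>)" using assms by (intro sum_mono2) auto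
  finally show ?thesis .
qed

lemma L2_sqn_le_JTG_norm:
  assumes "finite (supp x)" "A \<in> segment_families"
  shows "L2_set (\<lambda>s. sqn K s x) A \<le> JTG_norm x"
proof -
  have "L2_set (\<lambda>s. sqn K s x) A \<le> L2_set (\<lambda>s. segment_norm s x) A"
    using assms(2) sqn_le_segment_norm[OF _ refl]
    by (intro L2_set_mono) (auto simp: segment_families_def)
  also have "\<dots> \<le> (SUP A\<in>segment_families. L2_set (\<lambda>s. segment_norm s x) A)"
    using L2_segment_norm_bound[OF assms(1)] by (intro cSUP_upper assms(2) bdd_aboveI2)
  finally show ?thesis unfolding JTG_norm_eq by simp
qed

text \<open>The lower l2-estimate. If all nodes of the segments are at least the number of segments,
  the minima form a Schreier set. The truncations may differ from segment to segment, since by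
  monotonicity the largest one serves for all.\<close>

lemma sqrt_card_mult_le_JTG_norm:
  assumes x: "finite (supp x)" and T: "finite T" and seg: "\<And>g. g \<in> T \<Longrightarrow> segment (s g)"
    and eq: "\<And>g g' c. g \<in> T \<Longrightarrow> g' \<in> T \<Longrightarrow> c \<in> s g \<Longrightarrow> c \<in> s g' \<Longrightarrow> g = g'"
    and card: "\<And>g c. g \<in> T \<Longrightarrow> c \<in> s g \<Longrightarrow> card T \<le> c"
    and le: "\<And>g. g \<in> T \<Longrightarrow> e \<le> sqn (K g) (s g) x" and e: "0 \<le> e"
  shows "sqrt (real (card T)) * e \<le> JTG_norm x"
proof -
  have inj: "inj_on s T"
  proof (rule inj_onI)
    fix g g' assume g: "g \<in> T" "g' \<in> T" "s g = s g'"
    obtain c where "c \<in> s g" using segmentD(2)[OF seg[OF g(1)]] by blast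
    then show "g = g'" using eq[OF g(1,2)] g(3) by simp
  qed
  have "disjoint (s ` T)" unfolding disjoint_def using eq by blast
  moreover have "Min ` (s ` T) \<in> schreier1"
  proof (cases "T = {}")
    case False
    have "card (Min ` (s ` T)) \<le> card T"
      using card_image_le[OF T, of s] card_image_le[of "s ` T" Min] T by simp
    also have "\<dots> \<le> Min (Min ` (s ` T))"
      using T False card Min_in[OF segmentD(1,2)[OF seg]] by (intro Min.boundedI) auto
    finally show ?thesis using T by (auto simp: schreier1_def)
  qed (simp add: schreier1_def)
  ultimately have A: "s ` T \<in> segment_families" using T seg by (auto simp: segment_families_def)
  define K' where "K' = Max (K ` T)"
  have sq: "e \<le> sqn K' (s g) x" if "g \<in> T" for g
    using le[OF that] sqn_mono[of "K g" K' "s g" x] that T by (simp add: K'_def)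
  have "real (card T) * e\<^sup>2 \<le> (\<Sum>g\<in>T. (sqn K' (s g) x)\<^sup>2)"
    using sq e by (intro sum_bounded_below power_mono)
  also have "\<dots> = (\<Sum>t\<in>s ` T. (sqn K' t x)\<^sup>2)" using inj by (simp add: sum.reindex)
  finally have "sqrt (real (card T) * e\<^sup>2) \<le> L2_set (\<lambda>t. sqn K' t x) (s ` T)"
    unfolding L2_set_def by (rule real_sqrt_le_mono)
  then show ?thesis using L2_sqn_le_JTG_norm[OF x A, of K'] e by (simp add: real_sqrt_mult)
qed

lemma abs_le_JTG_norm:
  assumes "finite (supp x)"
  shows "\<bar>x l\<bar> \<le> JTG_norm x"
proof -
  have "\<bar>x l\<bar> \<le> (\<Sum>l\<in>supp x. \<bar>x l\<bar>)" for l
    using assms by (cases "x l = 0") (auto simp: sum_nonneg supp_def intro!: member_le_sum)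
  then have "bdd_above (range (\<lambda>l. \<bar>x l\<bar>))" by (rule bdd_aboveI2)
  then have "\<bar>x l\<bar> \<le> sup_norm x" unfolding sup_norm_def by (intro cSUP_upper) auto
  then show ?thesis unfolding JTG_norm_eq by simp
qed

text \<open>Every member may be cut by its own interval: minima move up and the number of members
  does not grow, so the Schreier condition survives.\<close>

lemma segment_families_shrink:
  assumes A: "A \<in> segment_families" and E: "\<And>s. s \<in> A \<Longrightarrow> order_convex (E s)"
  shows "(\<lambda>s. s \<inter> E s) ` A - {{}} \<in> segment_families"
    and "inj_on (\<lambda>s. s \<inter> E s) {s\<in>A. s \<inter> E s \<noteq> {}}"
proof -
  let ?B = "(\<lambda>s. s \<inter> E s) ` A - {{}}"
  have A': "finite A" "\<And>s. s \<in> A \<Longrightarrow> segment s" "disjoint A" "Min ` A \<in> schreier1"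
    using A by (auto simp: segment_families_def)
  have inj: "s = t" if "s \<in> A" "t \<in> A" "x \<in> s" "x \<in> t" for s t x
    using that A'(3) by (auto simp: disjoint_def)
  have "segment u" if u: "u \<in> ?B" for u
  proof -
    obtain s where s: "s \<in> A" "u = s \<inter> E s" "u \<noteq> {}" using u by blast
    then show ?thesis using segment_Int[OF A'(2)[OF s(1)] _ E[OF s(1)]] by simp
  qed
  moreover have "disjoint ?B" unfolding disjoint_def using inj by blast
  moreover have "Min ` ?B \<in> schreier1"
  proof (cases "?B = {}")
    case False
    then have ne: "A \<noteq> {}" by auto
    have le: "Min (Min ` A) \<le> Min u" if u: "u \<in> ?B" for u
    proof -
      obtain s where s: "s \<in> A" "u = s \<inter> E s" "u \<noteq> {}" using u by blast
      have "Min (Min ` A) \<le> Min s" using s A'(1) by simp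
      also have "\<dots> \<le> Min u" using s segmentD(1)[OF A'(2)] by (intro Min_antimono) auto
      finally show ?thesis .
    qed
    have "card (Min ` ?B) \<le> card ?B" using A'(1) by (intro card_image_le) auto
    also have "\<dots> \<le> card ((\<lambda>s. s \<inter> E s) ` A)" using A'(1) by (intro card_mono) auto
    also have "\<dots> \<le> card A" using A'(1) by (rule card_image_le)
    also have "\<dots> = card (Min ` A)"
      using inj_on_Min_family A' by (intro card_image[symmetric]) auto
    also have "\<dots> \<le> Min (Min ` A)" using A'(4) ne by (auto simp: schreier1_def)
    also have "\<dots> \<le> Min (Min ` ?B)"
      using le A'(1) False by (intro Min.boundedI) auto
    finally show ?thesis using A'(1) by (auto simp: schreier1_def)
  qed (simp add: schreier1_def)
  ultimately show "?B \<in> segment_families" using A'(1) by (simp add: segment_families_def)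
  show "inj_on (\<lambda>s. s \<inter> E s) {s\<in>A. s \<inter> E s \<noteq> {}}"
    using inj by (intro inj_onI) blast
qed

lemma L2_set_sqn_shrink:
  assumes A: "A \<in> segment_families" and E: "\<And>s. s \<in> A \<Longrightarrow> order_convex (E s)"
  shows "L2_set (\<lambda>s. sqn K (s \<inter> E s) x) A = L2_set (\<lambda>s. sqn K s x) ((\<lambda>s. s \<inter> E s) ` A - {{}})"
proof -
  let ?A = "{s\<in>A. s \<inter> E s \<noteq> {}}"
  have fin: "finite A" using A by (simp add: segment_families_def)
  have im: "(\<lambda>s. s \<inter> E s) ` A - {{}} = (\<lambda>s. s \<inter> E s) ` ?A" by auto
  have "(\<Sum>s\<in>A. (sqn K (s \<inter> E s) x)\<^sup>2) = (\<Sum>s\<in>?A. (sqn K (s \<inter> E s) x)\<^sup>2)"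
    using fin by (intro sum.mono_neutral_right) auto
  also have "\<dots> = (\<Sum>s\<in>(\<lambda>s. s \<inter> E s) ` ?A. (sqn K s x)\<^sup>2)"
    by (subst sum.reindex[OF segment_families_shrink(2)[OF assms]]) auto
  finally show ?thesis unfolding L2_set_def im by simp
qed

text \<open>The intervals by which \<open>segment_norm\<close> differs from \<open>sqn\<close> are
  absorbed into the family: cutting each segment by its interval yields another admissible
  family.\<close>

lemma JTG_norm_leI:
  assumes "\<And>l. \<bar>x l\<bar> \<le> C"
    and "\<And>A K. A \<in> segment_families \<Longrightarrow> L2_set (\<lambda>s. sqn K s x) A \<le> C"
  shows "JTG_norm x \<le> C"
  unfolding JTG_norm_eq
proof (intro max.boundedI)
  show "sup_norm x \<le> C" unfolding sup_norm_def using assms(1) by (intro cSUP_least) auto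
  show "(SUP A\<in>segment_families. L2_set (\<lambda>s. segment_norm s x) A) \<le> C"
  proof (rule cSUP_least)
    fix A assume A: "A \<in> segment_families"
    then have seg: "finite A" "\<And>s. s \<in> A \<Longrightarrow> segment s" by (auto simp: segment_families_def)
    have "\<forall>s\<in>A. \<exists>E K. order_convex E \<and> segment_norm s x \<le> sqn K (s \<inter> E) x"
      using segment_norm_le_sqn[OF seg(2) refl] by blast
    then obtain E K where E: "\<And>s. s \<in> A \<Longrightarrow> order_convex (E s)"
      and K: "\<And>s. s \<in> A \<Longrightarrow> segment_norm s x \<le> sqn (K s) (s \<inter> E s) x" by metis
    define K' where "K' = Max (K ` A)"
    have "segment_norm s x \<le> sqn K' (s \<inter> E s) x" if "s \<in> A" for s
      using K[OF that] sqn_mono[of "K s" K' "s \<inter> E s" x] that seg(1) by (simp add: K'_def)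
    then have "L2_set (\<lambda>s. segment_norm s x) A \<le> L2_set (\<lambda>s. sqn K' (s \<inter> E s) x) A"
      using seg segment_norm_nonneg by (intro L2_set_mono) auto
    also have "\<dots> = L2_set (\<lambda>s. sqn K' s x) ((\<lambda>s. s \<inter> E s) ` A - {{}})"
      by (rule L2_set_sqn_shrink[OF A E])
    also have "\<dots> \<le> C" by (rule assms(2)[OF segment_families_shrink(1)[OF A E]])
    finally show "L2_set (\<lambda>s. segment_norm s x) A \<le> C" .
  qed (use segment_families_nonempty in blast)
qed

lemma JTG_norm_restr_le:
  assumes "finite (supp x)" "order_convex E"
  shows "JTG_norm (restr x E) \<le> JTG_norm x"
proof (rule JTG_norm_leI)
  show "\<bar>restr x E l\<bar> \<le> JTG_norm x" for l
    using abs_le_JTG_norm[OF assms(1), of l] by (auto simp: restr_def)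
  fix A K assume A: "A \<in> segment_families"
  have "L2_set (\<lambda>s. sqn K s (restr x E)) A = L2_set (\<lambda>s. sqn K (s \<inter> E) x) A"
    using A by (intro L2_set_cong refl sqn_segment_restr) (auto simp: segment_families_def)
  also have "\<dots> = L2_set (\<lambda>s. sqn K s x) ((\<lambda>s. s \<inter> E) ` A - {{}})"
    using assms(2) by (intro L2_set_sqn_shrink A)
  also have "\<dots> \<le> JTG_norm x"
    using assms by (intro L2_sqn_le_JTG_norm segment_families_shrink(1) A) auto
  finally show "L2_set (\<lambda>s. sqn K s (restr x E)) A \<le> JTG_norm x" .
qed

lemma singleton_in_segment_families: "segment s \<Longrightarrow> {s} \<in> segment_families"
  using segmentD(5) by (auto simp: segment_families_def schreier1_def)

lemma sqn_le_JTG_norm: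
  assumes "finite (supp x)" "segment s"
  shows "sqn K s x \<le> JTG_norm x"
  using L2_sqn_le_JTG_norm[OF assms(1) singleton_in_segment_families[OF assms(2)], of K] by simp

lemma JTG_norm_le_sum_abs:
  assumes "finite (supp x)"
  shows "JTG_norm x \<le> (\<Sum>l\<in>supp x. \<bar>x l\<bar>)"
proof (rule JTG_norm_leI)
  show "\<bar>x l\<bar> \<le> (\<Sum>l\<in>supp x. \<bar>x l\<bar>)" for l
    using assms by (cases "x l = 0") (auto simp: sum_nonneg supp_def intro!: member_le_sum)
  fix A K assume A: "A \<in> segment_families"
  have "L2_set (\<lambda>s. sqn K s x) A \<le> L2_set (\<lambda>s. segment_norm s x) A"
    using A sqn_le_segment_norm[OF _ refl] by (intro L2_set_mono) (auto simp: segment_families_def)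
  also have "\<dots> \<le> (\<Sum>l\<in>supp x. \<bar>x l\<bar>)" using assms A by (rule L2_segment_norm_bound)
  finally show "L2_set (\<lambda>s. sqn K s x) A \<le> (\<Sum>l\<in>supp x. \<bar>x l\<bar>)" .
qed

lemma path_sqn_le_JTG_norm:
  assumes "finite (supp x)" "path h"
  shows "sqn K h x \<le> JTG_norm x"
proof -
  obtain q where "\<forall>l\<in>supp x. l \<le> q" using assms(1) finite_nat_set_iff_bounded_le by blast
  then have "restr x {0..q} = x" by (fastforce simp: restr_def supp_def)
  then have "blk_sum h i x = blk_sum (h \<inter> {0..q}) i x" for i
    using blk_sum_restr[OF finite_idx_class[OF assms(2)], of i x "{0..q}"] by simp
  then have eq: "sqn K h x = sqn K (h \<inter> {0..q}) x" by (simp add: sqn_def)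
  show ?thesis
  proof (cases "h \<inter> {0..q} = {}")
    case True
    have "0 \<le> \<bar>x 0\<bar>" by simp
    also have "\<dots> \<le> JTG_norm x" using assms(1) by (rule abs_le_JTG_norm)
    finally show ?thesis unfolding eq True by simp
  qed (use eq sqn_le_JTG_norm[OF assms(1) segment_of_path[OF assms(2)]] in simp)
qed

end

section \<open>Subspaces on which a bounded semi-inner product is coercive\<close>

text \<open>The form may be degenerate on \<open>X\<close>. It becomes definite only on a subspace
  where it controls the norm, so the projection below is orthogonal for the form while its
  continuity is measured in the norm.\<close>

locale semi_inner_on =
  fixes X :: "'a::banach set" and ip :: "'a \<Rightarrow> 'a \<Rightarrow> real" and C :: real
  assumes subspace_X: "subspace X"
    and ip_sym: "\<And>x y. x \<in> X \<Longrightarrow> y \<in> X \<Longrightarrow> ip x y = ip y x"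
    and ip_add: "\<And>x y z. x \<in> X \<Longrightarrow> y \<in> X \<Longrightarrow> z \<in> X \<Longrightarrow> ip (x + y) z = ip x z + ip y z"
    and ip_scale: "\<And>c x z. x \<in> X \<Longrightarrow> z \<in> X \<Longrightarrow> ip (c *\<^sub>R x) z = c * ip x z"
    and ip_nonneg: "\<And>x. x \<in> X \<Longrightarrow> 0 \<le> ip x x"
    and ip_bound: "\<And>x. x \<in> X \<Longrightarrow> ip x x \<le> C * (norm x)\<^sup>2"
begin

lemma X_simps:
  "x \<in> X \<Longrightarrow> y \<in> X \<Longrightarrow> x + y \<in> X" "x \<in> X \<Longrightarrow> y \<in> X \<Longrightarrow> x - y \<in> X" "x \<in> X \<Longrightarrow> c *\<^sub>R x \<in> X" "0 \<in> X"
  using subspace_X by (auto simp: subspace_add subspace_diff subspace_scale subspace_0)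

lemma ip_square_add:
  assumes "x \<in> X" "y \<in> X"
  shows "ip (x + c *\<^sub>R y) (x + c *\<^sub>R y) = ip x x + 2 * c * ip x y + c\<^sup>2 * ip y y"
proof -
  have r: "ip z (x + c *\<^sub>R y) = ip z x + c * ip z y" if "z \<in> X" for z
    using assms that by (simp add: ip_sym[of z] ip_add ip_scale X_simps)
  have "ip (x + c *\<^sub>R y) (x + c *\<^sub>R y) = ip x (x + c *\<^sub>R y) + c * ip y (x + c *\<^sub>R y)"
    using assms by (simp add: ip_add ip_scale X_simps)
  then show ?thesis
    using assms r[of x] r[of y] ip_sym[of y x] by (simp add: algebra_simps power2_eq_square)
qed

lemma ip_zero_left: "z \<in> X \<Longrightarrow> ip 0 z = 0"
  using ip_scale[of z z 0] by simp

definition sn :: "'a \<Rightarrow> real" where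
  "sn x = sqrt (ip x x)"

lemma sn_square: "x \<in> X \<Longrightarrow> (sn x)\<^sup>2 = ip x x"
  using ip_nonneg by (simp add: sn_def)

lemma sn_nonneg: "x \<in> X \<Longrightarrow> 0 \<le> sn x"
  using ip_nonneg by (simp add: sn_def)

lemma sn_le: "x \<in> X \<Longrightarrow> sn x \<le> sqrt C * norm x"
  unfolding sn_def using ip_bound[of x] by (metis norm_ge_zero real_sqrt_le_mono real_sqrt_mult real_sqrt_unique)

lemma ip_le_sn:
  assumes "x \<in> X" "y \<in> X"
  shows "ip x y \<le> sn x * sn y"
proof -
  have pos: "0 \<le> ip x x + 2 * c * ip x y + c\<^sup>2 * ip y y" for c
    using ip_nonneg[of "x + c *\<^sub>R y"] assms by (simp add: ip_square_add X_simps)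
  have "(ip x y)\<^sup>2 \<le> ip x x * ip y y"
  proof (cases "ip y y = 0")
    case True
    have "ip x y = 0"
    proof (rule ccontr)
      assume "ip x y \<noteq> 0"
      \<comment> \<open>For \<open>ip y y = 0\<close> the quadratic in \<open>c\<close> is affine,
        and this scalar gives it the value -1.\<close>
      then have "2 * (- (ip x x + 1) / (2 * ip x y)) * ip x y = - (ip x x + 1)" by simp
      then show False using pos[of "- (ip x x + 1) / (2 * ip x y)"] True by simp
    qed
    then show ?thesis using True by simp
  next
    case False
    then have "0 < ip y y" using ip_nonneg[OF assms(2)] by simp
    then show ?thesis
      using pos[of "- ip x y / ip y y"]
      by (simp add: power_divide field_simps power2_eq_square)
  qed
  then have "(ip x y)\<^sup>2 \<le> (sn x * sn y)\<^sup>2" using assms by (simp add: power_mult_distrib sn_square)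
  then show ?thesis using assms sn_nonneg by (metis abs_le_square_iff abs_of_nonneg abs_ge_self order_trans mult_nonneg_nonneg)
qed

lemma sn_triangle:
  assumes "x \<in> X" "y \<in> X"
  shows "sn (x + y) \<le> sn x + sn y"
proof -
  have "(sn (x + y))\<^sup>2 = (sn x)\<^sup>2 + 2 * ip x y + (sn y)\<^sup>2"
    using ip_square_add[OF assms, of 1] assms by (simp add: sn_square X_simps)
  also have "\<dots> \<le> (sn x + sn y)\<^sup>2" using ip_le_sn[OF assms] by (simp add: power2_sum)
  finally show ?thesis using assms sn_nonneg by (meson add_nonneg_nonneg power2_le_imp_le)
qed

lemma sn_minus_commute: "x \<in> X \<Longrightarrow> y \<in> X \<Longrightarrow> sn (x - y) = sn (y - x)"
proof -
  assume "x \<in> X" "y \<in> X"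
  then have "ip (0 + (-1) *\<^sub>R (x - y)) (0 + (-1) *\<^sub>R (x - y)) = ip (x - y) (x - y)"
    using ip_scale[of 0 _ 0]
    by (subst ip_square_add) (auto simp: X_simps dest: ip_scale[of 0 "x - y" 0])
  then show ?thesis by (simp add: sn_def)
qed

end

locale coercive_subspace = semi_inner_on X ip C for X :: "'a::banach set" and ip C +
  fixes Y :: "'a set" and c :: real
  assumes YX: "Y \<subseteq> X" and subspace_Y: "subspace Y" and closed_Y: "closed Y"
    and coercive: "\<And>y. y \<in> Y \<Longrightarrow> norm y \<le> c * sqrt (ip y y)"
    and c_pos: "0 < c" and C_pos: "0 < C"
begin

lemma Y_simps:
  "x \<in> Y \<Longrightarrow> y \<in> Y \<Longrightarrow> x + y \<in> Y" "x \<in> Y \<Longrightarrow> y \<in> Y \<Longrightarrow> x - y \<in> Y" "x \<in> Y \<Longrightarrow> r *\<^sub>R x \<in> Y" "0 \<in> Y"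
  using subspace_Y by (auto simp: subspace_add subspace_diff subspace_scale subspace_0)

lemma norm_le_sn: "y \<in> Y \<Longrightarrow> norm y \<le> c * sn y"
  using coercive by (simp add: sn_def)

lemma complete_Y: "complete Y"
  using closed_Y complete_eq_closed by blast

lemma sn_Cauchy_converges:
  assumes "range f \<subseteq> Y" and "\<And>e. 0 < e \<Longrightarrow> \<exists>M. \<forall>j k. M \<le> j \<longrightarrow> M \<le> k \<longrightarrow> sn (f j - f k) < e"
  shows "\<exists>y\<in>Y. f \<longlonglongrightarrow> y"
proof -
  have "Cauchy f"
    unfolding Cauchy_def
  proof (intro allI impI)
    fix e :: real assume "0 < e"
    then obtain M where M: "\<And>j k. M \<le> j \<Longrightarrow> M \<le> k \<Longrightarrow> sn (f j - f k) < e / c"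
      using assms(2)[of "e / c"] c_pos by auto
    have "dist (f j) (f k) < e" if "M \<le> j" "M \<le> k" for j k
    proof -
      have "f j - f k \<in> Y" using assms(1) by (intro Y_simps(2)) auto
      then have "norm (f j - f k) \<le> c * sn (f j - f k)" by (rule norm_le_sn)
      also have "\<dots> < c * (e / c)" using M[OF that] c_pos by (rule mult_strict_left_mono)
      finally show ?thesis using c_pos by (simp add: dist_norm)
    qed
    then show "\<exists>M. \<forall>j\<ge>M. \<forall>k\<ge>M. dist (f j) (f k) < e" by blast
  qed
  moreover have "\<forall>k. f k \<in> Y" using assms(1) by blast
  ultimately show ?thesis using complete_Y[unfolded complete_def, THEN spec, of f] by simp
qed

text \<open>Completeness is needed only along \<open>Y\<close>: a minimizing sequence in
  \<open>Y\<close> is Cauchy for the form, hence for the norm by coercivity.\<close>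

lemma orthogonal_projection:
  assumes x: "x \<in> X"
  shows "\<exists>p\<in>Y. \<forall>z\<in>Y. ip (x - p) z = 0"
proof -
  define V where "V = (\<lambda>y. ip (x - y) (x - y)) ` Y"
  define \<delta> where "\<delta> = Inf V"
  have xY: "x - y \<in> X" if "y \<in> Y" for y using that x YX by (intro X_simps(2)) auto
  have V0: "V \<noteq> {}" using Y_simps(4) by (auto simp: V_def)
  have Vb: "bdd_below V" using ip_nonneg xY by (auto simp: V_def intro!: bdd_belowI)
  have \<delta>: "\<delta> \<le> ip (x - y) (x - y)" if "y \<in> Y" for y
    unfolding \<delta>_def using Vb that by (intro cInf_lower) (auto simp: V_def)
  have "\<exists>y\<in>Y. ip (x - y) (x - y) < \<delta> + 1 / Suc k" for k
    using cInf_lessD[OF V0, of "\<delta> + 1 / Suc k"] by (auto simp: \<delta>_def V_def)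
  then obtain f where f: "\<And>k. f k \<in> Y" "\<And>k. ip (x - f k) (x - f k) < \<delta> + 1 / Suc k" by metis
  \<comment> \<open>Parallelogram identity; the midpoint \<open>w\<close> lies in \<open>Y\<close>,
    so its squared distance from \<open>x\<close> is at least \<delta>.\<close>
  have par: "ip (f j - f k) (f j - f k) \<le> 2 / Suc j + 2 / Suc k" for j k
  proof -
    define u where "u = x - f j"
    define v where "v = x - f k"
    define w where "w = (1/2) *\<^sub>R (f j + f k)"
    have uv: "u \<in> X" "v \<in> X" and w: "w \<in> Y" using f xY by (auto simp: u_def v_def w_def Y_simps)
    have "u + 1 *\<^sub>R v = 2 *\<^sub>R (x - w)" by (simp add: u_def v_def w_def algebra_simps scaleR_2)
    then have "ip u u + 2 * ip u v + ip v v = ip (2 *\<^sub>R (x - w)) (2 *\<^sub>R (x - w))"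
      using ip_square_add[OF uv, of 1] by simp
    also have "\<dots> = 4 * ip (x - w) (x - w)"
      using xY[OF w] by (simp add: ip_scale ip_sym[of "x - w" "2 *\<^sub>R (x - w)"] X_simps)
    finally have 1: "4 * \<delta> \<le> ip u u + 2 * ip u v + ip v v" using \<delta>[OF w] by simp
    have "v + (-1) *\<^sub>R u = f j - f k" by (simp add: u_def v_def)
    then have "ip (f j - f k) (f j - f k) = ip v v - 2 * ip v u + ip u u"
      using ip_square_add[OF uv(2,1), of "-1"] by simp
    then show ?thesis using 1 f(2)[of j] f(2)[of k] ip_sym[OF uv] by (simp add: u_def v_def)
  qed
  have "\<exists>M. \<forall>j k. M \<le> j \<longrightarrow> M \<le> k \<longrightarrow> sn (f j - f k) < e" if "0 < e" for e
  proof -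
    obtain M where M: "4 / e\<^sup>2 < real M" using reals_Archimedean2 by blast
    have "sn (f j - f k) < e" if "M \<le> j" "M \<le> k" for j k
    proof -
      have M0: "0 < real M" using M \<open>0 < e\<close> by (smt (verit) divide_nonneg_nonneg zero_le_power2)
      have "2 / Suc i < e\<^sup>2 / 2" if "M \<le> i" for i
      proof -
        have "2 / real (Suc i) < 2 / real M" using that M0 by (intro divide_strict_left_mono) auto
        also have "\<dots> \<le> e\<^sup>2 / 2" using M M0 \<open>0 < e\<close> by (simp add: field_simps)
        finally show ?thesis .
      qed
      from this[OF that(1)] this[OF that(2)] have "ip (f j - f k) (f j - f k) < e\<^sup>2"
        using par[of j k] by linarith
      then show ?thesis unfolding sn_def using \<open>0 < e\<close> by (simp add: real_less_lsqrt)
    qed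
    then show ?thesis by blast
  qed
  then obtain p where p: "p \<in> Y" "f \<longlonglongrightarrow> p" using sn_Cauchy_converges[of f] f(1) by blast
  have "sn (x - p) \<le> sqrt \<delta>"
  proof (rule LIMSEQ_le_const)
    have \<delta>0: "0 \<le> \<delta>" unfolding \<delta>_def using V0 ip_nonneg xY by (intro cInf_greatest) (auto simp: V_def)
    have "(\<lambda>k. sqrt (\<delta> + 1 / Suc k) + sqrt C * norm (f k - p)) \<longlonglongrightarrow> sqrt (\<delta> + 0) + sqrt C * norm (p - p)"
      using p(2) LIMSEQ_inverse_real_of_nat
      by (intro tendsto_intros) (auto simp: inverse_eq_divide)
    then show "(\<lambda>k. sqrt (\<delta> + 1 / Suc k) + sqrt C * norm (f k - p)) \<longlonglongrightarrow> sqrt \<delta>" by simp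
    have "sn (x - p) \<le> sqrt (\<delta> + 1 / Suc k) + sqrt C * norm (f k - p)" for k
    proof -
      have "sn (x - p) \<le> sn (x - f k) + sn (f k - p)"
        using sn_triangle[of "x - f k" "f k - p"] xY f(1) p Y_simps(2)[OF f(1)[of k] p(1)] YX by auto
      also have "sn (f k - p) \<le> sqrt C * norm (f k - p)" using f(1) p YX Y_simps by (intro sn_le) auto
      also have "sn (x - f k) \<le> sqrt (\<delta> + 1 / Suc k)" unfolding sn_def using f(2)[of k] by simp
      finally show ?thesis by simp
    qed
    then show "\<exists>N. \<forall>k\<ge>N. sn (x - p) \<le> sqrt (\<delta> + 1 / Suc k) + sqrt C * norm (f k - p)" by blast
  qed
  then have min: "ip (x - p) (x - p) \<le> \<delta>" by (simp add: sn_def)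
  have "ip (x - p) z = 0" if z: "z \<in> Y" for z
  proof (rule ccontr)
    assume ne: "ip (x - p) z \<noteq> 0"
    define a where "a = ip (x - p) z"
    define b where "b = ip z z"
    have *: "0 \<le> 2 * t * a + t\<^sup>2 * b" for t
    proof -
      have "p - t *\<^sub>R z \<in> Y" using p z by (intro Y_simps(2,3))
      from \<delta>[OF this] have "\<delta> \<le> ip ((x - p) + t *\<^sub>R z) ((x - p) + t *\<^sub>R z)" by (simp add: algebra_simps)
      also have "\<dots> = ip (x - p) (x - p) + 2 * t * a + t\<^sup>2 * b"
        unfolding a_def b_def using xY p z YX by (intro ip_square_add) auto
      finally show ?thesis using min by simp
    qed
    have b: "0 \<le> b" using ip_nonneg z YX by (auto simp: b_def)
    \<comment> \<open>The optimal step would be \<open>- a / b\<close>. Adding 1 to the denominator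
      avoids division by 0 and still gives a negative increment, namely
      \<open>- (t^2 * (b + 2))\<close>.\<close>
    define t where "t = - a / (b + 1)"
    have a: "a = - t * (b + 1)" using b by (simp add: t_def)
    have "2 * t * a + t\<^sup>2 * b = - (t\<^sup>2 * (b + 2))"
      by (subst a) (simp add: algebra_simps power2_eq_square)
    moreover have "0 < t\<^sup>2 * (b + 2)" using b ne by (auto simp: t_def a_def)
    ultimately show False using *[of t] by simp
  qed
  then show ?thesis using p by blast
qed

text \<open>Coercivity makes the form definite on \<open>Y\<close>, hence the projection unique;
  linearity follows because sums and multiples of projections satisfy the same orthogonality
  condition.\<close>

lemma complemented: "complemented_in Y X"
proof -
  obtain P where P: "\<And>x. x \<in> X \<Longrightarrow> P x \<in> Y" "\<And>x z. x \<in> X \<Longrightarrow> z \<in> Y \<Longrightarrow> ip (x - P x) z = 0"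
    using orthogonal_projection by metis
  have uniq: "P x = p" if x: "x \<in> X" and p: "p \<in> Y" "\<And>z. z \<in> Y \<Longrightarrow> ip (x - p) z = 0" for x p
  proof -
    define z where "z = P x - p"
    have z: "z \<in> Y" using P(1)[OF x] p Y_simps by (auto simp: z_def)
    have m: "x - p \<in> X" "x - P x \<in> X" "z \<in> X"
      using x p z P(1)[OF x] YX by (auto intro: X_simps(2))
    have "ip ((x - p) + (-1) *\<^sub>R (x - P x)) z = ip (x - p) z + ip ((-1) *\<^sub>R (x - P x)) z"
      by (intro ip_add m X_simps(3))
    also have "ip ((-1) *\<^sub>R (x - P x)) z = (-1) * ip (x - P x) z" by (intro ip_scale m)
    finally have "ip z z = 0" using p(2)[OF z] P(2)[OF x z] by (simp add: z_def)
    then have "norm z \<le> 0" using coercive[OF z] by simp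
    then show ?thesis by (simp add: z_def)
  qed
  have "P (x + y) = P x + P y" if "x \<in> X" "y \<in> X" for x y
  proof (rule uniq)
    fix z assume z: "z \<in> Y"
    have "ip ((x - P x) + (y - P y)) z = 0"
      using z that P YX X_simps by (subst ip_add) (auto simp: subset_iff)
    then show "ip (x + y - (P x + P y)) z = 0" by (simp add: algebra_simps)
  qed (use that P X_simps Y_simps in auto)
  moreover have "P (r *\<^sub>R x) = r *\<^sub>R P x" if "x \<in> X" for r x
  proof (rule uniq)
    fix z assume z: "z \<in> Y"
    have "ip (r *\<^sub>R (x - P x)) z = 0"
      using z that P YX X_simps by (subst ip_scale) (auto simp: subset_iff)
    then show "ip (r *\<^sub>R x - r *\<^sub>R P x) z = 0" by (simp add: algebra_simps)
  qed (use that P X_simps Y_simps in auto)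
  moreover have "norm (P x) \<le> (c * sqrt C) * norm x" if x: "x \<in> X" for x
  proof -
    have p: "P x \<in> Y" "P x \<in> X" "x - P x \<in> X" using P(1)[OF x] YX x X_simps by auto
    have "ip ((x - P x) + P x) (P x) = ip (x - P x) (P x) + ip (P x) (P x)"
      by (rule ip_add) (use p in auto)
    then have eq: "ip x (P x) = (sn (P x))\<^sup>2" using P(2)[OF x p(1)] p sn_square by simp
    have "sn (P x) \<le> sn x"
    proof (cases "sn (P x) = 0")
      case False
      then have "0 < sn (P x)" using sn_nonneg[OF p(2)] by simp
      moreover have "sn (P x) * sn (P x) \<le> sn x * sn (P x)"
        using ip_le_sn[OF x p(2)] eq by (simp add: power2_eq_square)
      ultimately show ?thesis by simp
    qed (use sn_nonneg x in simp)
    have "norm (P x) \<le> c * sn (P x)" using norm_le_sn p by blast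
    also have "\<dots> \<le> c * (sqrt C * norm x)"
      using \<open>sn (P x) \<le> sn x\<close> sn_le[OF x] c_pos by (intro mult_left_mono) auto
    finally show ?thesis by simp
  qed
  ultimately have "bounded_linear_on X P" unfolding bounded_linear_on_def linear_on_def by blast
  moreover have fixed: "P y = y" if "y \<in> Y" for y
    using that YX by (intro uniq) (auto simp: ip_zero_left subset_iff)
  then have "P ` X = Y" using P(1) YX by (force simp: image_iff)
  ultimately show ?thesis unfolding complemented_in_def using P(1) fixed by blast
qed

text \<open>On \<open>Y\<close> the form and the norm bound each other and therefore induce the same
  topology, so the identity serves as the isomorphism.\<close>

lemma hilbertian: "hilbertian Y"
proof -
  \<comment> \<open>the metric space locale requires a distance that is nonnegative and symmetric on the whole type\<close>
  define jp where "jp x y = (if x \<in> Y \<and> y \<in> Y then ip x y else 0)" for x y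
  have d: "inner_dist jp x y = sn (x - y)" if "x \<in> Y" "y \<in> Y" for x y
    using that Y_simps by (simp add: inner_dist_def jp_def sn_def)
  have d0: "inner_dist jp x y = 0" if "x - y \<notin> Y" for x y
    using that by (simp add: inner_dist_def jp_def)
  have neg: "x - y \<in> Y \<longleftrightarrow> y - x \<in> Y" for x y
    using subspace_neg[OF subspace_Y] by (metis minus_diff_eq)
  interpret M: Metric_space Y "inner_dist jp"
  proof
    fix x y
    show "0 \<le> inner_dist jp x y" using ip_nonneg YX by (auto simp: inner_dist_def jp_def)
    show "inner_dist jp x y = inner_dist jp y x"
    proof (cases "x - y \<in> Y")
      case True
      then have "jp (x - y) (x - y) = (sn (x - y))\<^sup>2" "jp (y - x) (y - x) = (sn (y - x))\<^sup>2"
        using neg[of x y] YX by (auto simp: jp_def sn_square)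
      moreover have "sn (x - y) = sn (y - x)"
        using sn_minus_commute[of "x - y" 0] sn_minus_commute[of 0 "x - y"] True YX X_simps(4)
        by auto
      ultimately show ?thesis by (simp add: inner_dist_def)
    qed (use d0 neg in metis)
  next
    fix x y assume xy: "x \<in> Y" "y \<in> Y"
    have "x - y \<in> Y" using xy by (rule Y_simps(2))
    then show "inner_dist jp x y = 0 \<longleftrightarrow> x = y"
      using norm_le_sn[of "x - y"] d[OF xy] sn_le[of 0] sn_nonneg[of 0] X_simps(4) by auto
  next
    fix x y z assume "x \<in> Y" "y \<in> Y" "z \<in> Y"
    then show "inner_dist jp x z \<le> inner_dist jp x y + inner_dist jp y z"
      using sn_triangle[of "x - y" "y - z"] YX Y_simps(2) by (auto simp: d subset_iff)
  qed
  have sn1: "dist x y \<le> c * sn (x - y)" "sn (x - y) \<le> sqrt C * dist x y" if "x \<in> Y" "y \<in> Y" for x y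
    using that norm_le_sn[of "x - y"] sn_le[of "x - y"] YX Y_simps(2) by (auto simp: dist_norm)
  have top: "M.mtopology = top_of_set Y"
    unfolding topology_eq
  proof (intro allI)
    fix U
    show "openin M.mtopology U \<longleftrightarrow> openin (top_of_set Y) U"
      unfolding M.openin_mtopology openin_euclidean_subtopology_iff
    proof (intro conj_cong refl)
      assume U: "U \<subseteq> Y"
      show "(\<forall>x. x \<in> U \<longrightarrow> (\<exists>r>0. M.mball x r \<subseteq> U)) \<longleftrightarrow> (\<forall>x\<in>U. \<exists>e>0. \<forall>y\<in>Y. dist y x < e \<longrightarrow> y \<in> U)"
      proof (intro iffI ballI allI impI)
        fix x assume "x \<in> U" "\<forall>x. x \<in> U \<longrightarrow> (\<exists>r>0. M.mball x r \<subseteq> U)"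
        then obtain r where r: "r > 0" "M.mball x r \<subseteq> U" by blast
        have "y \<in> U" if "y \<in> Y" "dist y x < r / sqrt C" for y
        proof -
          have "sn (x - y) \<le> sqrt C * dist x y" using sn1(2) that U \<open>x \<in> U\<close> by blast
          also have "\<dots> < sqrt C * (r / sqrt C)"
            using that C_pos by (intro mult_strict_left_mono) (auto simp: dist_commute)
          finally have "sn (x - y) < r" using C_pos by simp
          then have "y \<in> M.mball x r" using U that \<open>x \<in> U\<close> d[of x y] by (simp add: subset_iff)
          then show ?thesis using r(2) by blast
        qed
        then show "\<exists>e>0. \<forall>y\<in>Y. dist y x < e \<longrightarrow> y \<in> U"
          using r(1) C_pos by (intro exI[of _ "r / sqrt C"]) auto
      next
        fix x assume "x \<in> U" "\<forall>x\<in>U. \<exists>e>0. \<forall>y\<in>Y. dist y x < e \<longrightarrow> y \<in> U"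
        then obtain e where e: "e > 0" "\<And>y. y \<in> Y \<Longrightarrow> dist y x < e \<Longrightarrow> y \<in> U" by blast
        have "M.mball x (e / c) \<subseteq> U"
        proof
          fix y assume y: "y \<in> M.mball x (e / c)"
          then have "x \<in> Y" "y \<in> Y" "sn (x - y) < e / c" using d by auto
          then have "dist x y \<le> c * sn (x - y)" "c * sn (x - y) < c * (e / c)"
            using sn1(1) c_pos by (auto intro: mult_strict_left_mono simp del: times_divide_eq_right)
          then show "y \<in> U" using e(2)[OF \<open>y \<in> Y\<close>] c_pos by (simp add: dist_commute)
        qed
        then show "\<exists>r>0. M.mball x r \<subseteq> U" using e(1) c_pos by (intro exI[of _ "e / c"]) auto
      qed
    qed
  qed
  have "M.mcomplete"
    unfolding M.mcomplete_def
  proof (intro allI impI)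
    fix f assume f: "M.MCauchy f"
    then have fY: "range f \<subseteq> Y" by (simp add: M.MCauchy_def)
    have "\<exists>N. \<forall>j k. N \<le> j \<longrightarrow> N \<le> k \<longrightarrow> sn (f j - f k) < e" if "0 < e" for e
      using f that fY d unfolding M.MCauchy_def by (metis rangeI subsetD)
    then obtain y where "y \<in> Y" "f \<longlonglongrightarrow> y" using sn_Cauchy_converges[OF fY] by blast
    then have "limitin (top_of_set Y) f y sequentially"
      using fY by (simp add: limitin_subtopology image_subset_iff)
    then show "\<exists>x. limitin M.mtopology f x sequentially" unfolding top by blast
  qed
  moreover have "\<forall>x\<in>Y. 0 \<le> jp x x \<and> (jp x x = 0 \<longrightarrow> x = 0)"
    using ip_nonneg coercive YX by (fastforce simp: jp_def)
  moreover have "\<forall>x\<in>Y. \<forall>y\<in>Y. jp x y = jp y x" using ip_sym YX by (auto simp: jp_def)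
  moreover have "\<forall>y\<in>Y. linear_on Y (\<lambda>x. jp x y)"
    unfolding linear_on_def jp_def using Y_simps YX ip_add ip_scale by (auto simp: subset_iff)
  ultimately have "hilbert_space_on Y jp"
    unfolding hilbert_space_on_def using subspace_Y by blast
  moreover have "linear_homeomorphism (top_of_set Y) M.mtopology id"
    unfolding linear_homeomorphism_def top by (simp add: linear_on_def)
  ultimately show ?thesis unfolding hilbertian_def by blast
qed

end

section \<open>Sequences equivalent to the unit vector basis of c0\<close>

locale c0_sequence =
  fixes z :: "nat \<Rightarrow> 'a::banach" and C c :: real
  assumes upper: "\<And>N a B. 0 \<le> B \<Longrightarrow> (\<And>k. k < N \<Longrightarrow> \<bar>a k\<bar> \<le> B) \<Longrightarrow> norm (\<Sum>k<N. a k *\<^sub>R z k) \<le> C * B"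
    and lower: "\<And>N a k. k < N \<Longrightarrow> c * \<bar>a k\<bar> \<le> norm (\<Sum>k<N. a k *\<^sub>R z k)"
    and c_pos: "0 < c"
begin

lemma C_nonneg: "0 \<le> C"
  using upper[of 1 0 "\<lambda>_. 0"] by simp

text \<open>A tail is a finite sum whose head coefficients are 0, so the upper estimate applies with
  the small bound for the tail.\<close>

lemma summable_c0:
  assumes "a \<longlonglongrightarrow> 0"
  shows "summable (\<lambda>k. a k *\<^sub>R z k)"
  unfolding summable_Cauchy
proof (intro allI impI)
  fix e :: real assume "0 < e"
  define d where "d = e / (C + 1)"
  have d: "0 < d" using \<open>0 < e\<close> C_nonneg by (simp add: d_def)
  then obtain M where M: "\<And>k. M \<le> k \<Longrightarrow> \<bar>a k\<bar> < d"
    using LIMSEQ_D[OF assms d] by auto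
  have "norm (\<Sum>k = i..<j. a k *\<^sub>R z k) < e" if "M \<le> i" for i j
  proof -
    have "(\<Sum>k = i..<j. a k *\<^sub>R z k) = (\<Sum>k<j. (if i \<le> k then a k else 0) *\<^sub>R z k)"
      by (intro sum.mono_neutral_cong_left) auto
    also have "norm \<dots> \<le> C * d"
      using M that d by (intro upper) (auto intro: less_imp_le)
    also have "\<dots> < e"
    proof -
      have "C * d < (C + 1) * d" using d by simp
      also have "\<dots> = e" using C_nonneg by (simp add: d_def)
      finally show ?thesis .
    qed
    finally show ?thesis .
  qed
  then show "\<exists>N. \<forall>m\<ge>N. \<forall>n. norm (\<Sum>k = m..<n. a k *\<^sub>R z k) < e" by blast
qed

definition synth :: "(nat \<Rightarrow>\<^sub>C real) \<Rightarrow> 'a" where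
  "synth f = (\<Sum>k. apply_bcontfun f k *\<^sub>R z k)"

lemma synth_sums: "f \<in> c0 \<Longrightarrow> (\<lambda>n. \<Sum>k<n. apply_bcontfun f k *\<^sub>R z k) \<longlonglongrightarrow> synth f"
  unfolding synth_def by (intro summable_LIMSEQ summable_c0) (simp add: c0_def)

lemma subspace_c0: "subspace c0"
  unfolding subspace_def c0_def
  by (auto simp: zero_bcontfun.rep_eq plus_bcontfun.rep_eq scaleR_bcontfun.rep_eq
      intro: tendsto_add_zero tendsto_mult_right_zero)

lemma linear_on_synth: "linear_on c0 synth"
  unfolding linear_on_def
proof (intro conjI ballI allI)
  fix f g assume "f \<in> c0" "g \<in> c0"
  then show "synth (f + g) = synth f + synth g"
    unfolding synth_def by (simp add: plus_bcontfun.rep_eq scaleR_add_left summable_c0 c0_def suminf_add)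
next
  fix r f assume "f \<in> c0"
  then have "summable (\<lambda>k. apply_bcontfun f k *\<^sub>R z k)" by (simp add: summable_c0 c0_def)
  then show "synth (r *\<^sub>R f) = r *\<^sub>R synth f"
    unfolding synth_def by (simp add: scaleR_bcontfun.rep_eq suminf_scaleR_right flip: scaleR_scaleR)
qed

lemma norm_synth_le:
  assumes "f \<in> c0"
  shows "norm (synth f) \<le> C * norm f"
proof (rule LIMSEQ_le_const2[OF tendsto_norm[OF synth_sums[OF assms]]])
  have "norm (\<Sum>k<n. apply_bcontfun f k *\<^sub>R z k) \<le> C * norm f" for n
    using norm_bounded[of f] by (intro upper) auto
  then show "\<exists>N. \<forall>n\<ge>N. norm (\<Sum>k<n. apply_bcontfun f k *\<^sub>R z k) \<le> C * norm f" by blast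
qed

lemma norm_le_norm_synth:
  assumes "f \<in> c0"
  shows "c * norm f \<le> norm (synth f)"
proof -
  have "c * \<bar>apply_bcontfun f k\<bar> \<le> norm (synth f)" for k
  proof (rule LIMSEQ_le_const[OF tendsto_norm[OF synth_sums[OF assms]]])
    show "\<exists>N. \<forall>n\<ge>N. c * \<bar>apply_bcontfun f k\<bar> \<le> norm (\<Sum>k<n. apply_bcontfun f k *\<^sub>R z k)"
      using lower[of k] by (intro exI[of _ "Suc k"]) auto
  qed
  then have "norm f \<le> norm (synth f) / c"
    using c_pos by (intro norm_bound) (simp add: field_simps)
  then show ?thesis using c_pos by (simp add: field_simps)
qed

text \<open>Both estimates pass to the limit, so \<open>synth\<close> and its inverse on the range
  are Lipschitz; closedness of \<open>Y\<close> keeps the limits in \<open>Y\<close>.\<close>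

lemma contains_c0:
  assumes "subspace Y" "closed Y" "\<And>k. z k \<in> Y"
  shows "contains_c0 Y"
proof -
  have diff: "synth f - synth g = synth (f - g)" "f - g \<in> c0" if "f \<in> c0" "g \<in> c0" for f g
  proof -
    have g: "(-1) *\<^sub>R g \<in> c0" using that subspace_c0 subspace_scale by blast
    have "synth (f + (-1) *\<^sub>R g) = synth f + synth ((-1) *\<^sub>R g)"
      using linear_on_synth that g unfolding linear_on_def by blast
    moreover have "synth ((-1) *\<^sub>R g) = (-1) *\<^sub>R synth g"
      using linear_on_synth that unfolding linear_on_def by blast
    ultimately show "synth f - synth g = synth (f - g)" by simp
    show "f - g \<in> c0" using that subspace_c0 subspace_diff by blast
  qed
  define Z where "Z = synth ` c0"
  have add: "synth f + synth g = synth (f + g)" "f + g \<in> c0" if "f \<in> c0" "g \<in> c0" for f g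
    using linear_on_synth that subspace_c0 subspace_add unfolding linear_on_def by auto
  have scale: "r *\<^sub>R synth f = synth (r *\<^sub>R f)" "r *\<^sub>R f \<in> c0" if "f \<in> c0" for f r
    using linear_on_synth that subspace_c0 subspace_scale unfolding linear_on_def by auto
  have zero: "synth 0 = 0" "0 \<in> c0"
    using scale(1)[of 0 0] subspace_0[OF subspace_c0] by auto
  have "subspace Z"
    unfolding subspace_def Z_def
  proof (intro conjI ballI allI)
    show "0 \<in> synth ` c0" using zero by (metis image_eqI)
    fix x y assume "x \<in> synth ` c0" "y \<in> synth ` c0"
    then show "x + y \<in> synth ` c0" using add by auto
  next
    fix r x assume "x \<in> synth ` c0"
    then show "r *\<^sub>R x \<in> synth ` c0" using scale by auto
  qed
  moreover have "Z \<subseteq> Y"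
  proof
    fix x assume "x \<in> Z"
    then obtain f where f: "f \<in> c0" "x = synth f" by (auto simp: Z_def)
    have "(\<Sum>k<n. apply_bcontfun f k *\<^sub>R z k) \<in> Y" for n
      using assms by (intro subspace_sum subspace_scale) auto
    then show "x \<in> Y" using closed_sequentially[OF assms(2) _ synth_sums[OF f(1)]] f(2) by blast
  qed
  moreover have "homeomorphic_maps (top_of_set c0) (top_of_set Z) synth (inv_into c0 synth)"
  proof -
    have inj: "inj_on synth c0"
    proof (rule inj_onI)
      fix f g assume fg: "f \<in> c0" "g \<in> c0" "synth f = synth g"
      then have "c * norm (f - g) \<le> 0" using diff norm_le_norm_synth[of "f - g"] by (metis norm_zero right_minus_eq)
      then show "f = g" using c_pos by (simp add: mult_le_0_iff)
    qed
    have "C-lipschitz_on c0 synth"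
      using C_nonneg norm_synth_le diff by (intro lipschitz_onI) (auto simp: dist_norm)
    moreover have "(1 / c)-lipschitz_on Z (inv_into c0 synth)"
    proof (rule lipschitz_onI)
      fix x y assume xy: "x \<in> Z" "y \<in> Z"
      then obtain f g where fg: "f \<in> c0" "x = synth f" "g \<in> c0" "y = synth g" unfolding Z_def by blast
      have "c * dist f g \<le> dist x y"
        using norm_le_norm_synth[OF diff(2)[OF fg(1,3)]] diff(1)[OF fg(1,3)] fg by (simp add: dist_norm)
      then show "dist (inv_into c0 synth x) (inv_into c0 synth y) \<le> 1 / c * dist x y"
        using fg inj c_pos by (simp add: field_simps)
    qed (use c_pos in simp)
    ultimately show ?thesis
      unfolding homeomorphic_maps_def
      using inj by (auto simp: continuous_map_in_subtopology Z_def inv_into_into f_inv_into_f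
          dest: lipschitz_on_continuous_on)
  qed
  ultimately show ?thesis
    unfolding contains_c0_def linear_homeomorphism_def
    using homeomorphic_maps_imp_map linear_on_synth by (metis topspace_euclidean_subtopology)
qed

end

section \<open>Coordinates on the completion\<close>

lemma c00_finite: "x \<in> c00 \<Longrightarrow> finite (supp x)"
  by (simp add: c00_def)

lemma c00_subset: "finite (supp x) \<Longrightarrow> supp y \<subseteq> supp x \<Longrightarrow> x 0 = 0 \<Longrightarrow> y \<in> c00"
  unfolding c00_def using finite_subset by (auto simp: supp_def)

lemma c00_add: "x \<in> c00 \<Longrightarrow> y \<in> c00 \<Longrightarrow> (\<lambda>l. x l + y l) \<in> c00"
  unfolding c00_def
  by (auto simp: supp_def intro: finite_subset[of _ "{l. x l \<noteq> 0} \<union> {l. y l \<noteq> 0}"])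

lemma c00_scale: "x \<in> c00 \<Longrightarrow> (\<lambda>l. c * x l) \<in> c00"
  using c00_subset[of x "\<lambda>l. c * x l"] by (auto simp: c00_def supp_def)

lemma c00_diff: "x \<in> c00 \<Longrightarrow> y \<in> c00 \<Longrightarrow> (\<lambda>l. x l - y l) \<in> c00"
  using c00_add[OF _ c00_scale[of y "-1"]] by simp

lemma c00_zero: "(\<lambda>_. 0) \<in> c00"
  by (simp add: c00_def supp_def)

lemma c00_sum: "(\<And>k. k \<in> A \<Longrightarrow> u k \<in> c00) \<Longrightarrow> (\<lambda>l. \<Sum>k\<in>A. a k * u k l) \<in> c00"
proof (induction A rule: infinite_finite_induct)
  case (insert k A)
  then show ?case using c00_add[OF c00_scale[of "u k" "a k"]] by simp
qed (simp_all add: c00_zero)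

lemma c00_restr: "x \<in> c00 \<Longrightarrow> restr x E \<in> c00"
  by (rule c00_subset[of x]) (auto simp: c00_def supp_def restr_def)

lemma restr_in_c00: "finite E \<Longrightarrow> 0 \<notin> E \<Longrightarrow> restr x E \<in> c00"
  unfolding c00_def by (auto simp: supp_def restr_def intro: finite_subset[of _ E])

locale jt_completion = jt_tree +
  fixes \<iota> :: "(nat \<Rightarrow> real) \<Rightarrow> 'a::banach" and JTG :: "'a set"
  assumes completion: "is_completion c00 JTG_norm \<iota> JTG"
begin

lemmas \<iota>_add = completion[unfolded is_completion_def, THEN conjunct1, rule_format]
  and \<iota>_scale = completion[unfolded is_completion_def, THEN conjunct2, THEN conjunct1, rule_format]
  and norm_\<iota> = completion[unfolded is_completion_def, THEN conjunct2, THEN conjunct2, THEN conjunct1,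
    rule_format]
  and JTG_closure = completion[unfolded is_completion_def, THEN conjunct2, THEN conjunct2, THEN conjunct2]

lemma \<iota>_diff: "x \<in> c00 \<Longrightarrow> y \<in> c00 \<Longrightarrow> \<iota> (\<lambda>l. x l - y l) = \<iota> x - \<iota> y"
  using \<iota>_add[of x "\<lambda>l. (-1) * y l"] \<iota>_scale[of y "-1"] c00_scale[of y "-1"] by simp

lemma \<iota>_zero: "\<iota> (\<lambda>_. 0) = 0"
  using \<iota>_scale[OF c00_zero, of 0] by simp

lemma \<iota>_sum:
  "(\<And>k. k \<in> A \<Longrightarrow> u k \<in> c00) \<Longrightarrow> \<iota> (\<lambda>l. \<Sum>k\<in>A. a k * u k l) = (\<Sum>k\<in>A. a k *\<^sub>R \<iota> (u k))"
proof (induction A rule: infinite_finite_induct)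
  case (insert k A)
  then show ?case
    using \<iota>_add[OF c00_scale[of "u k" "a k"] c00_sum[of A u a]] \<iota>_scale[of "u k" "a k"] by simp
qed (simp_all add: \<iota>_zero)

lemma \<iota>_in_JTG: "x \<in> c00 \<Longrightarrow> \<iota> x \<in> JTG"
  unfolding JTG_closure by (intro subsetD[OF closure_subset] imageI)

lemma closed_JTG: "closed JTG"
  by (simp add: JTG_closure)

lemma approx:
  assumes "y \<in> JTG" "0 < e"
  obtains x where "x \<in> c00" "norm (y - \<iota> x) < e"
  using assms unfolding JTG_closure closure_approachable
  by (metis (no_types, lifting) dist_commute dist_norm imageE)

lemma subspace_JTG: "subspace JTG"
  unfolding subspace_def
proof (intro conjI ballI allI)
  show "0 \<in> JTG" using \<iota>_in_JTG[OF c00_zero] \<iota>_zero by simp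
next
  fix y z assume "y \<in> JTG" "z \<in> JTG"
  then obtain f g where f: "\<And>k. f k \<in> \<iota> ` c00" "f \<longlonglongrightarrow> y" and g: "\<And>k. g k \<in> \<iota> ` c00" "g \<longlonglongrightarrow> z"
    unfolding JTG_closure closure_sequential by metis
  have "f k + g k \<in> \<iota> ` c00" for k
  proof -
    obtain a b where "a \<in> c00" "f k = \<iota> a" "b \<in> c00" "g k = \<iota> b" using f(1)[of k] g(1)[of k] by auto
    then show ?thesis by (simp add: c00_add flip: \<iota>_add)
  qed
  then show "y + z \<in> JTG"
    unfolding JTG_closure closure_sequential using tendsto_add[OF f(2) g(2)]
    by (intro exI[of _ "\<lambda>k. f k + g k"] conjI allI) auto
next
  fix c y assume "y \<in> JTG"
  then obtain f where f: "\<And>k. f k \<in> \<iota> ` c00" "f \<longlonglongrightarrow> y"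
    unfolding JTG_closure closure_sequential by metis
  have "c *\<^sub>R f k \<in> \<iota> ` c00" for k
  proof -
    obtain a where "a \<in> c00" "f k = \<iota> a" using f(1)[of k] by auto
    then show ?thesis by (simp add: c00_scale flip: \<iota>_scale)
  qed
  then show "c *\<^sub>R y \<in> JTG"
    unfolding JTG_closure closure_sequential using tendsto_scaleR[OF tendsto_const f(2)]
    by (intro exI[of _ "\<lambda>k. c *\<^sub>R f k"] conjI allI) auto
qed

lemma abs_diff_le_norm:
  assumes "x \<in> c00" "y \<in> c00"
  shows "\<bar>x l - y l\<bar> \<le> norm (\<iota> x - \<iota> y)"
  using abs_le_JTG_norm[of "\<lambda>l. x l - y l" l] c00_diff[OF assms] assms
  by (simp add: c00_finite flip: \<iota>_diff norm_\<iota>)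

text \<open>The continuous extension of the \<open>l\<close>-th coordinate. Describing it by its
  distance from all finitely supported approximations yields \<open>coord_dist\<close>, from which
  linearity follows by density.\<close>

definition coord :: "'a \<Rightarrow> nat \<Rightarrow> real" where
  "coord y l = (SOME c. \<forall>x\<in>c00. \<bar>c - x l\<bar> \<le> norm (y - \<iota> x))"

lemma coord_dist:
  assumes y: "y \<in> JTG" and x: "x \<in> c00"
  shows "\<bar>coord y l - x l\<bar> \<le> norm (y - \<iota> x)"
proof -
  obtain f where f: "\<And>j. f j \<in> \<iota> ` c00" "f \<longlonglongrightarrow> y"
    using y unfolding JTG_closure closure_sequential by metis
  then have "\<forall>j. \<exists>x. x \<in> c00 \<and> f j = \<iota> x" by (metis imageE)
  then obtain a where a: "\<And>j. a j \<in> c00" "\<And>j. f j = \<iota> (a j)" by metis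
  have lim: "(\<lambda>j. \<iota> (a j)) \<longlonglongrightarrow> y" using f(2) unfolding a(2)[symmetric] .
  \<comment> \<open>Coordinates have norm at most 1 on finitely supported vectors, so they converge
    along any approximating sequence.\<close>
  have "Cauchy (\<lambda>j. a j l)"
    unfolding Cauchy_def
  proof (intro allI impI)
    fix e :: real assume "0 < e"
    then obtain M where "\<And>i j. M \<le> i \<Longrightarrow> M \<le> j \<Longrightarrow> dist (\<iota> (a i)) (\<iota> (a j)) < e"
      using LIMSEQ_imp_Cauchy[OF lim] unfolding Cauchy_def by metis
    then have "\<And>i j. M \<le> i \<Longrightarrow> M \<le> j \<Longrightarrow> dist (a i l) (a j l) < e"
      using abs_diff_le_norm[OF a(1) a(1)] by (simp add: dist_norm) (meson le_less_trans)
    then show "\<exists>M. \<forall>i\<ge>M. \<forall>j\<ge>M. dist (a i l) (a j l) < e" by blast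
  qed
  then obtain c where c: "(\<lambda>j. a j l) \<longlonglongrightarrow> c" using Cauchy_convergent convergent_def by metis
  have "\<bar>c - x l\<bar> \<le> norm (y - \<iota> x)" if "x \<in> c00" for x
  proof (rule LIMSEQ_le)
    show "(\<lambda>j. \<bar>a j l - x l\<bar>) \<longlonglongrightarrow> \<bar>c - x l\<bar>" using c by (intro tendsto_intros)
    show "(\<lambda>j. norm (\<iota> (a j) - \<iota> x)) \<longlonglongrightarrow> norm (y - \<iota> x)" using lim by (intro tendsto_intros)
  qed (use abs_diff_le_norm[OF a(1) that] in blast)
  then have "\<exists>c. \<forall>x\<in>c00. \<bar>c - x l\<bar> \<le> norm (y - \<iota> x)" by blast
  from someI_ex[OF this] show ?thesis using x by (simp add: coord_def)
qed

lemma coord_\<iota>: "x \<in> c00 \<Longrightarrow> coord (\<iota> x) = x"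
  using coord_dist[OF \<iota>_in_JTG, of x x] by fastforce

lemma coord_add:
  assumes y: "y \<in> JTG" and z: "z \<in> JTG"
  shows "coord (y + z) l = coord y l + coord z l"
proof -
  have "\<bar>coord (y + z) l - (coord y l + coord z l)\<bar> \<le> 0 + e" if "0 < e" for e
  proof -
    have "0 < e / 4" using that by simp
    obtain a where a: "a \<in> c00" "norm (y - \<iota> a) < e / 4" by (rule approx[OF y \<open>0 < e / 4\<close>])
    obtain b where b: "b \<in> c00" "norm (z - \<iota> b) < e / 4" by (rule approx[OF z \<open>0 < e / 4\<close>])
    have yz: "y + z \<in> JTG" using y z subspace_JTG subspace_add by blast
    have "norm (y + z - \<iota> (\<lambda>l. a l + b l)) \<le> norm (y - \<iota> a) + norm (z - \<iota> b)"
      using norm_triangle_ineq[of "y - \<iota> a" "z - \<iota> b"] by (simp add: \<iota>_add a b algebra_simps)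
    then show ?thesis
      using coord_dist[OF yz c00_add[OF a(1) b(1)], of l] coord_dist[OF y a(1), of l]
        coord_dist[OF z b(1), of l] a(2) b(2) by linarith
  qed
  then have "\<bar>coord (y + z) l - (coord y l + coord z l)\<bar> \<le> 0" by (rule field_le_epsilon)
  then show ?thesis by simp
qed

lemma coord_scale:
  assumes y: "y \<in> JTG"
  shows "coord (c *\<^sub>R y) l = c * coord y l"
proof -
  have "\<bar>coord (c *\<^sub>R y) l - c * coord y l\<bar> \<le> 0 + e" if "0 < e" for e
  proof -
    define d where "d = e / (2 * \<bar>c\<bar> + 1)"
    have d: "0 < d" using that by (auto simp: d_def)
    obtain a where a: "a \<in> c00" "norm (y - \<iota> a) < d" by (rule approx[OF y d])
    have cy: "c *\<^sub>R y \<in> JTG" using y subspace_JTG subspace_scale by blast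
    have "norm (c *\<^sub>R y - \<iota> (\<lambda>l. c * a l)) = \<bar>c\<bar> * norm (y - \<iota> a)"
      using a by (simp add: \<iota>_scale flip: scaleR_diff_right)
    then have 1: "\<bar>coord (c *\<^sub>R y) l - c * a l\<bar> \<le> \<bar>c\<bar> * d"
      using coord_dist[OF cy c00_scale[OF a(1), of c], of l] a(2) mult_left_mono[of "norm (y - \<iota> a)" d "\<bar>c\<bar>"]
      by linarith
    have "\<bar>c * coord y l - c * a l\<bar> = \<bar>c\<bar> * \<bar>coord y l - a l\<bar>"
      by (simp flip: abs_mult right_diff_distrib)
    also have "\<dots> \<le> \<bar>c\<bar> * d" using coord_dist[OF y a(1), of l] a(2) by (intro mult_left_mono) auto
    finally have "\<bar>coord (c *\<^sub>R y) l - c * coord y l\<bar> \<le> 2 * \<bar>c\<bar> * d" using 1 by linarith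
    also have "\<dots> \<le> (2 * \<bar>c\<bar> + 1) * d" using d by simp
    also have "\<dots> = e" unfolding d_def by (simp add: add_nonneg_eq_0_iff)
    finally show ?thesis by simp
  qed
  then have "\<bar>coord (c *\<^sub>R y) l - c * coord y l\<bar> \<le> 0" by (rule field_le_epsilon)
  then show ?thesis by simp
qed

lemma coord_diff: "y \<in> JTG \<Longrightarrow> z \<in> JTG \<Longrightarrow> coord (y - z) l = coord y l - coord z l"
  using coord_add[of y "(-1) *\<^sub>R z" l] coord_scale[of z "-1" l]
    subspace_scale[OF subspace_JTG, of z "-1"] by simp

lemma abs_coord_le: "y \<in> JTG \<Longrightarrow> \<bar>coord y l\<bar> \<le> norm y"
  using coord_dist[OF _ c00_zero] by (simp add: \<iota>_zero)

text \<open>Transfers an inequality from finitely supported vectors to the completion. The constant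
  \<open>M\<close> may be as large as the number of coordinates that \<open>f\<close> reads, because
  the approximation is chosen after it.\<close>

lemma approx_le:
  assumes y: "y \<in> JTG" and "0 \<le> M"
    and "\<And>x. x \<in> c00 \<Longrightarrow> f (coord y) \<le> norm (\<iota> x) + M * norm (y - \<iota> x)"
  shows "f (coord y) \<le> norm y"
proof (rule field_le_epsilon)
  fix e :: real assume "0 < e"
  define d where "d = e / (M + 1)"
  have d: "0 < d" using \<open>0 < e\<close> \<open>0 \<le> M\<close> by (simp add: d_def)
  obtain x where x: "x \<in> c00" "norm (y - \<iota> x) < d" by (rule approx[OF y d])
  have "norm (\<iota> x) \<le> norm y + norm (y - \<iota> x)"
    using norm_triangle_ineq4[of y "y - \<iota> x"] by simp
  moreover have "M * norm (y - \<iota> x) \<le> M * d" using x \<open>0 \<le> M\<close> by (intro mult_left_mono) auto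
  moreover have "d + M * d = (M + 1) * d" by (simp add: algebra_simps)
  moreover have "(M + 1) * d = e" using \<open>0 \<le> M\<close> by (simp add: d_def)
  ultimately show "f (coord y) \<le> norm y + e" using assms(3)[OF x(1)] x(2) by linarith
qed

lemma JTG_norm_restr_coord_le:
  assumes y: "y \<in> JTG" and p: "1 \<le> p"
  shows "JTG_norm (restr (coord y) {p..q}) \<le> norm y"
proof (rule approx_le[OF y, of "real (card {p..q})" "\<lambda>x. JTG_norm (restr x {p..q})"])
  fix x assume x: "x \<in> c00"
  let ?E = "{p..q}"
  define w where "w = restr (\<lambda>l. coord y l - x l) ?E"
  have w: "w \<in> c00" unfolding w_def using p by (intro restr_in_c00) auto
  have rx: "restr x ?E \<in> c00" using x by (rule c00_restr)
  have ry: "restr (coord y) ?E = (\<lambda>l. restr x ?E l + w l)" by (auto simp: w_def restr_def)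
  have "restr (coord y) ?E \<in> c00" using p by (intro restr_in_c00) auto
  then have "JTG_norm (restr (coord y) ?E) = norm (\<iota> (restr x ?E) + \<iota> w)"
    unfolding \<iota>_add[OF rx w, symmetric] ry[symmetric] by (simp add: norm_\<iota>)
  also have "\<dots> \<le> JTG_norm (restr x ?E) + JTG_norm w"
    using norm_triangle_ineq[of "\<iota> (restr x ?E)" "\<iota> w"] by (simp add: norm_\<iota> rx w)
  also have "JTG_norm (restr x ?E) \<le> norm (\<iota> x)"
    using JTG_norm_restr_le[OF c00_finite[OF x], of ?E] by (simp add: norm_\<iota> x)
  also have "JTG_norm w \<le> (\<Sum>l\<in>supp w. \<bar>w l\<bar>)" using c00_finite[OF w] by (rule JTG_norm_le_sum_abs)
  also have "\<dots> \<le> (\<Sum>l\<in>?E. \<bar>w l\<bar>)" by (intro sum_mono2) (auto simp: w_def supp_def restr_def)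
  also have "\<dots> \<le> real (card ?E) * norm (y - \<iota> x)"
    using coord_dist[OF y x] by (intro sum_bounded_above) (auto simp: w_def restr_def)
  finally show "JTG_norm (restr (coord y) ?E) \<le> norm (\<iota> x) + real (card ?E) * norm (y - \<iota> x)" by simp
qed simp

text \<open>The truncation at \<open>K\<close> leaves finitely many nodes even on an infinite path,
  and their number is the constant in the density argument.\<close>

lemma path_sqn_coord_le:
  assumes y: "y \<in> JTG" and h: "path h"
  shows "sqn K h (coord y) \<le> norm y"
proof (rule approx_le[OF y, of "\<Sum>i\<le>K. real (card {l\<in>h. idx l = i})" "\<lambda>x. sqn K h x"])
  fix x assume x: "x \<in> c00"
  let ?d = "norm (y - \<iota> x)"
  have "sqn K h (coord y) = sqn K h (\<lambda>l. x l + (coord y l - x l))" by simp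
  also have "\<dots> \<le> sqn K h x + sqn K h (\<lambda>l. coord y l - x l)" by (rule sqn_add)
  also have "sqn K h x \<le> norm (\<iota> x)"
    using path_sqn_le_JTG_norm[OF c00_finite[OF x] h] by (simp add: norm_\<iota> x)
  also have "sqn K h (\<lambda>l. coord y l - x l) \<le> (\<Sum>i\<le>K. \<bar>blk_sum h i (\<lambda>l. coord y l - x l)\<bar>)"
    unfolding sqn_def by (rule L2_set_le_sum_abs)
  also have "\<dots> \<le> (\<Sum>i\<le>K. real (card {l\<in>h. idx l = i}) * ?d)"
    unfolding blk_sum_def
  proof (intro sum_mono order_trans[OF sum_abs] sum_bounded_above)
    fix l
    have "\<bar>node_coeff l\<bar> * \<bar>coord y l - x l\<bar> \<le> 1 * ?d"
      using abs_node_coeff_le coord_dist[OF y x] by (intro mult_mono) auto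
    then show "\<bar>node_coeff l * (coord y l - x l)\<bar> \<le> ?d" by (simp add: abs_mult)
  qed
  also have "\<dots> = (\<Sum>i\<le>K. real (card {l\<in>h. idx l = i})) * ?d" by (simp add: sum_distrib_right)
  finally show "sqn K h (coord y) \<le> norm (\<iota> x) + (\<Sum>i\<le>K. real (card {l\<in>h. idx l = i})) * ?d" by simp
qed (simp add: sum_nonneg)

end

section \<open>The coercive case\<close>

context jt_completion
begin

text \<open>If it fails for all unit vectors of \<open>Y\<close>, finitely many coordinates and path
  operators bound the norm on \<open>Y\<close> from below.\<close>

definition small_on :: "nat set set \<Rightarrow> nat \<Rightarrow> real \<Rightarrow> 'a \<Rightarrow> bool" where
  "small_on F k0 e y \<longleftrightarrow> (\<forall>l\<le>k0. \<bar>coord y l\<bar> \<le> e) \<and> (\<forall>h\<in>F. \<forall>K. sqn K h (coord y) \<le> e)"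

text \<open>The l2 inner product of the images of \<open>y\<close> and \<open>z\<close> under the
  operator of the path.\<close>

definition path_ip :: "nat set \<Rightarrow> 'a \<Rightarrow> 'a \<Rightarrow> real" where
  "path_ip h y z = (\<Sum>i. blk_sum h i (coord y) * blk_sum h i (coord z))"

lemma sum_blk_sum_square_le:
  assumes "y \<in> JTG" "path h"
  shows "(\<Sum>i<k. (blk_sum h i (coord y))\<^sup>2) \<le> (norm y)\<^sup>2"
proof -
  have "(\<Sum>i<k. (blk_sum h i (coord y))\<^sup>2) \<le> (\<Sum>i\<le>k. (blk_sum h i (coord y))\<^sup>2)"
    by (intro sum_mono2) auto
  also have "\<dots> = (sqn k h (coord y))\<^sup>2" by (simp add: sqn_def L2_set_def sum_nonneg)
  also have "\<dots> \<le> (norm y)\<^sup>2" using path_sqn_coord_le[OF assms] by (intro power_mono) auto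
  finally show ?thesis .
qed

lemma summable_blk_sum_square:
  assumes "y \<in> JTG" "path h"
  shows "summable (\<lambda>i. (blk_sum h i (coord y))\<^sup>2)"
  using sum_blk_sum_square_le[OF assms] by (intro summableI_nonneg_bounded) auto

lemma summable_path_ip:
  assumes "y \<in> JTG" "z \<in> JTG" "path h"
  shows "summable (\<lambda>i. blk_sum h i (coord y) * blk_sum h i (coord z))"
proof (rule summable_comparison_test')
  show "summable (\<lambda>i. (blk_sum h i (coord y))\<^sup>2 + (blk_sum h i (coord z))\<^sup>2)"
    using assms by (intro summable_add summable_blk_sum_square)
  fix i
  have "2 * (\<bar>a\<bar> * \<bar>b\<bar>) \<le> a\<^sup>2 + b\<^sup>2" for a b :: real
    using sum_squares_bound[of "\<bar>a\<bar>" "\<bar>b\<bar>"] by (simp add: mult_ac)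
  moreover have "0 \<le> \<bar>a\<bar> * \<bar>b\<bar>" for a b :: real by simp
  ultimately have "\<bar>a\<bar> * \<bar>b\<bar> \<le> a\<^sup>2 + b\<^sup>2" for a b :: real by (smt (verit))
  then show "norm (blk_sum h i (coord y) * blk_sum h i (coord z))
      \<le> (blk_sum h i (coord y))\<^sup>2 + (blk_sum h i (coord z))\<^sup>2"
    by (simp add: abs_mult)
qed

lemma blk_sum_coord_add:
  assumes "x \<in> JTG" "y \<in> JTG"
  shows "blk_sum h i (coord (x + y)) = blk_sum h i (coord x) + blk_sum h i (coord y)"
proof -
  have "coord (x + y) = (\<lambda>l. coord x l + coord y l)" by (rule ext) (rule coord_add[OF assms])
  then show ?thesis by (simp add: blk_sum_add)
qed

lemma blk_sum_coord_scale:
  assumes "x \<in> JTG"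
  shows "blk_sum h i (coord (c *\<^sub>R x)) = c * blk_sum h i (coord x)"
proof -
  have "coord (c *\<^sub>R x) = (\<lambda>l. c * coord x l)" by (rule ext) (rule coord_scale[OF assms])
  then show ?thesis by (simp add: blk_sum_scale)
qed

lemma sqn_coord_scale:
  assumes "x \<in> JTG"
  shows "sqn K h (coord (c *\<^sub>R x)) = \<bar>c\<bar> * sqn K h (coord x)"
proof -
  have "coord (c *\<^sub>R x) = (\<lambda>l. c * coord x l)" by (rule ext) (rule coord_scale[OF assms])
  then show ?thesis by (simp add: sqn_scale)
qed

lemma sqn_square_le_path_ip:
  assumes "y \<in> JTG" "path h"
  shows "(sqn K h (coord y))\<^sup>2 \<le> path_ip h y y"
proof -
  have "(sqn K h (coord y))\<^sup>2 = (\<Sum>i<Suc K. (blk_sum h i (coord y))\<^sup>2)"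
    by (simp add: sqn_def L2_set_def sum_nonneg lessThan_Suc_atMost)
  also have "\<dots> \<le> (\<Sum>i. (blk_sum h i (coord y))\<^sup>2)"
    by (intro sum_le_suminf summable_blk_sum_square assms) auto
  finally show ?thesis by (simp add: path_ip_def power2_eq_square)
qed

lemma coercive_imp_hilbertian:
  assumes Y: "closed_subspace_of Y JTG" and F: "finite F" "\<forall>h\<in>F. path h" and e: "0 < e"
    and coercive: "\<And>y. y \<in> Y \<Longrightarrow> norm y = 1 \<Longrightarrow> \<not> small_on F k0 e y"
  shows "hilbertian Y \<and> complemented_in Y JTG"
proof -
  define ip where "ip y z = (\<Sum>l\<le>k0. coord y l * coord z l) + (\<Sum>h\<in>F. path_ip h y z)" for y z
  \<comment> \<open>One unit for each term: coordinates and path operators have norm at most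
    1.\<close>
  define C where "C = real (Suc k0 + card F)"
  have YJ: "Y \<subseteq> JTG" using Y by (simp add: closed_subspace_of_def)
  have sub: "y + z \<in> JTG" "c *\<^sub>R y \<in> JTG" if "y \<in> JTG" "z \<in> JTG" for y z c
    using that subspace_JTG subspace_add subspace_scale by auto
  have pos: "0 \<le> path_ip h y y" if "y \<in> JTG" "h \<in> F" for h y
    using sqn_square_le_path_ip[of y h 0] that F zero_le_power2 order_trans by blast
  interpret semi_inner_on JTG ip C
  proof
    show "subspace JTG" by (rule subspace_JTG)
    show "ip x y = ip y x" for x y by (simp add: ip_def path_ip_def mult.commute)
  next
    fix x y z assume xyz: "x \<in> JTG" "y \<in> JTG" "z \<in> JTG"
    have "path_ip h (x + y) z = path_ip h x z + path_ip h y z" if "h \<in> F" for h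
      using xyz that F by (simp add: path_ip_def blk_sum_coord_add distrib_right suminf_add summable_path_ip)
    then show "ip (x + y) z = ip x z + ip y z"
      using xyz by (simp add: ip_def coord_add distrib_right sum.distrib)
  next
    fix c x z assume xz: "x \<in> JTG" "z \<in> JTG"
    have "path_ip h (c *\<^sub>R x) z = c * path_ip h x z" if "h \<in> F" for h
    proof -
      have "path_ip h (c *\<^sub>R x) z = (\<Sum>i. c * (blk_sum h i (coord x) * blk_sum h i (coord z)))"
        using xz by (simp add: path_ip_def blk_sum_coord_scale mult.assoc)
      also have "\<dots> = c * path_ip h x z"
        unfolding path_ip_def using xz that F by (intro suminf_mult summable_path_ip) auto
      finally show ?thesis .
    qed
    then show "ip (c *\<^sub>R x) z = c * ip x z"
      using xz by (simp add: ip_def coord_scale sum_distrib_left distrib_left mult.assoc)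
  next
    fix x assume x: "x \<in> JTG"
    then show "0 \<le> ip x x" unfolding ip_def using pos by (intro add_nonneg_nonneg sum_nonneg) auto
    have "(\<Sum>l\<le>k0. coord x l * coord x l) \<le> real (card {..k0}) * (norm x)\<^sup>2"
    proof (rule sum_bounded_above)
      fix l
      have "(coord x l)\<^sup>2 \<le> (norm x)\<^sup>2" using power_mono[OF abs_coord_le[OF x, of l], of 2] by simp
      then show "coord x l * coord x l \<le> (norm x)\<^sup>2" by (simp add: power2_eq_square)
    qed
    moreover have "(\<Sum>h\<in>F. path_ip h x x) \<le> real (card F) * (norm x)\<^sup>2"
    proof (rule sum_bounded_above)
      fix h assume "h \<in> F"
      then have "path h" using F by blast
      then show "path_ip h x x \<le> (norm x)\<^sup>2"
        unfolding path_ip_def power2_eq_square[symmetric] using x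
        by (intro suminf_le_const summable_blk_sum_square sum_blk_sum_square_le)
    qed
    ultimately show "ip x x \<le> C * (norm x)\<^sup>2" by (simp add: ip_def C_def algebra_simps)
  qed
  interpret coercive_subspace JTG ip C Y "1 / e"
  proof
    show "Y \<subseteq> JTG" "subspace Y" "closed Y" using Y by (auto simp: closed_subspace_of_def)
    show "0 < 1 / e" "0 < C" using e by (auto simp: C_def)
    fix y assume y: "y \<in> Y"
    show "norm y \<le> 1 / e * sqrt (ip y y)"
    proof (cases "y = 0")
      case True
      then show ?thesis using ip_zero_left[OF subspace_0[OF subspace_JTG]] by simp
    next
      case False
      define x where "x = (1 / norm y) *\<^sub>R y"
      have yJ: "y \<in> JTG" using y YJ by blast
      have x: "x \<in> Y" "norm x = 1" "x \<in> JTG"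
        using y False YJ subspace_scale Y by (auto simp: x_def closed_subspace_of_def)
      have yx: "y = norm y *\<^sub>R x" using False by (simp add: x_def)
      have le: "(e * norm y)\<^sup>2 \<le> ip y y"
      proof -
        \<comment> \<open>The coordinate or path operator that exceeds \<open>e\<close> at the unit
          vector contributes its square to \<open>ip y y\<close>, whose other summands are
          nonnegative.\<close>
        consider l where "l \<le> k0" "e < \<bar>coord x l\<bar>" | h K where "h \<in> F" "e < sqn K h (coord x)"
          using coercive[OF x(1,2)] by (auto simp: small_on_def not_le)
        then show ?thesis
        proof cases
          case 1
          have "coord y l = norm y * coord x l" using coord_scale[OF x(3), of "norm y" l] yx by simp
          then have "e * norm y \<le> \<bar>coord y l\<bar>"
            using mult_left_mono[OF less_imp_le[OF 1(2)], of "norm y"] by (simp add: abs_mult mult.commute)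
          then have "(e * norm y)\<^sup>2 \<le> (coord y l)\<^sup>2" using e by (intro iffD1[OF abs_le_square_iff]) simp
          also have "\<dots> \<le> (\<Sum>l\<le>k0. (coord y l)\<^sup>2)" using 1(1) by (intro member_le_sum) auto
          also have "\<dots> \<le> ip y y"
            unfolding ip_def using pos[OF yJ] by (simp add: power2_eq_square sum_nonneg)
          finally show ?thesis .
        next
          case 2
          have "sqn K h (coord y) = norm y * sqn K h (coord x)"
            using sqn_coord_scale[OF x(3), of K h "norm y"] yx by simp
          then have "e * norm y \<le> sqn K h (coord y)"
            using mult_left_mono[OF less_imp_le[OF 2(2)], of "norm y"] by (simp add: mult.commute)
          then have "(e * norm y)\<^sup>2 \<le> (sqn K h (coord y))\<^sup>2" using e by (intro power_mono) auto
          also have "\<dots> \<le> path_ip h y y" using 2(1) F yJ by (intro sqn_square_le_path_ip) auto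
          also have "\<dots> \<le> (\<Sum>h\<in>F. path_ip h y y)"
            using 2(1) F(1) pos[OF yJ] by (intro member_le_sum) auto
          also have "\<dots> \<le> ip y y" unfolding ip_def by (simp add: sum_nonneg)
          finally show ?thesis .
        qed
      qed
      then have "e * norm y \<le> sqrt (ip y y)" by (rule real_le_rsqrt)
      then show ?thesis using e by (simp add: field_simps)
    qed
  qed
  show ?thesis using hilbertian complemented by blast
qed

section \<open>Blocks near a subspace without coercivity\<close>

lemma restr_supp: "supp x \<subseteq> E \<Longrightarrow> restr x E = x"
  by (fastforce simp: restr_def supp_def)

lemma path_sqn_Int: "path h \<Longrightarrow> supp x \<subseteq> E \<Longrightarrow> sqn K (h \<inter> E) x = sqn K h x"
  using blk_sum_restr[OF finite_idx_class[of h], of _ x E] by (simp add: sqn_def restr_supp)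

lemma segment_sqn_Int: "segment s \<Longrightarrow> supp x \<subseteq> E \<Longrightarrow> sqn K (s \<inter> E) x = sqn K s x"
  using sqn_segment_restr[of s K x E] by (simp add: restr_supp)

definition near_unit :: "'a set \<Rightarrow> real \<Rightarrow> (nat \<Rightarrow> real) \<Rightarrow> bool" where
  "near_unit Y \<eta> u \<longleftrightarrow> u \<in> c00 \<and> JTG_norm u = 1 \<and> (\<exists>y\<in>Y. norm (\<iota> u - y) \<le> \<eta>)"

definition non_coercive :: "'a set \<Rightarrow> bool" where
  "non_coercive Y \<longleftrightarrow> (\<forall>F k0 e. finite F \<and> (\<forall>h\<in>F. path h) \<and> 0 < e
     \<longrightarrow> (\<exists>y\<in>Y. norm y = 1 \<and> small_on F k0 e y))"

text \<open>Dividing by the norm divides the distance to \<open>Y\<close> as well, so only the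
  distance relative to the norm matters.\<close>

lemma near_unit_normalize:
  assumes Y: "subspace Y" and v: "v \<in> c00" "0 < JTG_norm v" and y: "y \<in> Y" "norm (\<iota> v - y) \<le> \<rho>"
    and \<eta>: "\<rho> \<le> \<eta> * JTG_norm v"
  shows "near_unit Y \<eta> (\<lambda>l. (1 / JTG_norm v) * v l)"
proof -
  define a where "a = 1 / JTG_norm v"
  have a: "0 < a" "a * JTG_norm v = 1" using v by (auto simp: a_def)
  have av: "(\<lambda>l. a * v l) \<in> c00" using v by (intro c00_scale)
  have "JTG_norm (\<lambda>l. a * v l) = norm (a *\<^sub>R \<iota> v)" using av v by (simp flip: norm_\<iota> \<iota>_scale)
  then have "JTG_norm (\<lambda>l. a * v l) = 1" using a v by (simp add: norm_\<iota>)
  moreover have "a *\<^sub>R y \<in> Y" using Y y subspace_scale by blast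
  moreover have "norm (\<iota> (\<lambda>l. a * v l) - a *\<^sub>R y) \<le> \<eta>"
  proof -
    have "norm (\<iota> (\<lambda>l. a * v l) - a *\<^sub>R y) = a * norm (\<iota> v - y)"
      using a v by (simp add: \<iota>_scale flip: scaleR_diff_right)
    also have "\<dots> \<le> a * (\<eta> * JTG_norm v)" using a y \<eta> by (intro mult_left_mono) auto
    also have "\<dots> = \<eta>" using a by (simp add: mult.left_commute)
    finally show ?thesis .
  qed
  ultimately show ?thesis unfolding near_unit_def a_def using av a_def by blast
qed

text \<open>Take a unit vector of \<open>Y\<close> that is small on the first coordinates and on the
  given paths. Approximating it by a finitely supported vector, deleting the first coordinates and
  normalizing change it only slightly.\<close>

lemma non_coercive_block:
  assumes nc: "non_coercive Y" and Y: "closed_subspace_of Y JTG"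
    and F: "finite F" "\<forall>h\<in>F. path h" and "0 < \<eta>"
  shows "\<exists>u. near_unit Y \<eta> u \<and> supp u \<subseteq> {k0<..} \<and> (\<forall>h\<in>F. \<forall>K. sqn K h u \<le> \<eta>)"
proof -
  \<comment> \<open>With the divisor 8 the shortened vector keeps norm at least
    \<open>1 - \<rho> \<ge> 1 / 2\<close>, and its path bound \<open>2 * \<rho>\<close> becomes at
    most \<open>4 * \<rho> \<le> \<eta>\<close> after normalizing.\<close>
  define \<rho> where "\<rho> = min \<eta> 1 / 8"
  \<comment> \<open>The \<open>k0 + 1\<close> deleted coordinates cost at most
    \<open>2 * \<delta>\<close> each and the approximation costs another \<delta>, together at most
    \<rho>.\<close>
  define \<delta> where "\<delta> = \<rho> / real (2 * k0 + 3)"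
  have \<rho>: "0 < \<rho>" "8 * \<rho> \<le> \<eta>" "8 * \<rho> \<le> 1" using \<open>0 < \<eta>\<close> by (auto simp: \<rho>_def)
  have \<delta>: "0 < \<delta>" "real (2 * k0 + 3) * \<delta> = \<rho>" using \<rho> by (auto simp: \<delta>_def)
  obtain y where y: "y \<in> Y" "norm y = 1" "small_on F k0 \<delta> y"
    using nc F \<delta>(1) unfolding non_coercive_def by blast
  have yJ: "y \<in> JTG" using y Y by (auto simp: closed_subspace_of_def)
  obtain x where x: "x \<in> c00" "norm (y - \<iota> x) < \<delta>" by (rule approx[OF yJ \<delta>(1)])
  define v where "v = restr x {k0<..}"
  define w where "w = restr x {..k0}"
  have vw: "v \<in> c00" "w \<in> c00" using x by (auto simp: v_def w_def intro: c00_restr)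
  have xvw: "x = (\<lambda>l. v l + w l)" by (auto simp: v_def w_def restr_def)
  have "JTG_norm w \<le> (\<Sum>l\<in>supp w. \<bar>w l\<bar>)" using c00_finite[OF vw(2)] by (rule JTG_norm_le_sum_abs)
  also have "\<dots> \<le> (\<Sum>l\<le>k0. \<bar>w l\<bar>)" by (intro sum_mono2) (auto simp: w_def supp_def restr_def)
  also have "\<dots> \<le> real (card {..k0}) * (2 * \<delta>)"
  proof (rule sum_bounded_above)
    fix l assume "l \<in> {..k0}"
    then have "\<bar>coord y l\<bar> \<le> \<delta>" using y(3) by (auto simp: small_on_def)
    moreover have "\<bar>coord y l - x l\<bar> \<le> \<delta>" using coord_dist[OF yJ x(1), of l] x(2) by simp
    ultimately show "\<bar>w l\<bar> \<le> 2 * \<delta>" by (simp add: w_def restr_def abs_if split: if_splits)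
  qed
  finally have w: "norm (\<iota> w) \<le> real (2 * k0 + 2) * \<delta>" using vw by (simp add: norm_\<iota> algebra_simps)
  have vyx: "\<iota> v - y = (\<iota> x - y) - \<iota> w" using \<iota>_add[OF vw] xvw by simp
  have "norm (\<iota> v - y) \<le> norm (y - \<iota> x) + norm (\<iota> w)"
    unfolding vyx norm_minus_commute[of y] by (rule norm_triangle_ineq4)
  also have "\<dots> \<le> \<rho>" using x(2) w \<delta>(2) by (simp add: algebra_simps)
  finally have vy: "norm (\<iota> v - y) \<le> \<rho>" .
  define a where "a = JTG_norm v"
  have "1 - \<rho> \<le> a"
    using norm_triangle_ineq2[of y "\<iota> v"] vy vw y(2) by (simp add: a_def norm_\<iota> norm_minus_commute)
  then have a: "1 / 2 \<le> a" using \<rho> by simp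
  then have inv: "0 < 1 / a" "1 / a \<le> 2" by (auto simp: field_simps)
  define u where "u = (\<lambda>l. (1 / a) * v l)"
  have "near_unit Y \<eta> u"
    unfolding u_def a_def
  proof (rule near_unit_normalize[OF _ vw(1) _ y(1) vy])
    show "subspace Y" using Y by (simp add: closed_subspace_of_def)
    show "0 < JTG_norm v" using a by (simp add: a_def)
    have "\<eta> * (1 / 2) \<le> \<eta> * a" using a \<open>0 < \<eta>\<close> by (intro mult_left_mono) auto
    then show "\<rho> \<le> \<eta> * JTG_norm v" using \<rho> unfolding a_def[symmetric] by linarith
  qed
  moreover have "supp u \<subseteq> {k0<..}" by (auto simp: u_def v_def supp_def restr_def split: if_splits)
  moreover have "sqn K h u \<le> \<eta>" if h: "h \<in> F" for h K
  proof -
    have d: "\<iota> v - y \<in> JTG" using yJ \<iota>_in_JTG[OF vw(1)] subspace_JTG subspace_diff by blast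
    have "v = (\<lambda>l. coord y l + coord (\<iota> v - y) l)"
      using yJ \<iota>_in_JTG[OF vw(1)] by (simp add: coord_diff coord_\<iota> vw)
    then have "sqn K h v \<le> sqn K h (coord y) + sqn K h (coord (\<iota> v - y))" using sqn_add by metis
    also have "sqn K h (coord y) \<le> \<delta>" using y(3) h by (auto simp: small_on_def)
    also have "sqn K h (coord (\<iota> v - y)) \<le> \<rho>" using path_sqn_coord_le[OF d, of h K] h F(2) vy by simp
    finally have "sqn K h v \<le> \<delta> + \<rho>" by simp
    also have "\<dots> \<le> 2 * \<rho>" using \<delta> by (simp add: \<delta>_def field_simps)
    finally have *: "sqn K h v \<le> 2 * \<rho>" .
    have "sqn K h u = (1 / a) * sqn K h v" unfolding u_def sqn_scale using inv by simp
    also have "\<dots> \<le> 2 * (2 * \<rho>)" using inv * by (intro mult_mono) auto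
    finally show ?thesis using \<rho> by simp
  qed
  ultimately show ?thesis by blast
qed

definition hits :: "real \<Rightarrow> nat set \<Rightarrow> (nat \<Rightarrow> real) \<Rightarrow> bool" where
  "hits e h u \<longleftrightarrow> path h \<and> (\<exists>K. e < sqn K h u)"

text \<open>The parts beyond \<open>j\<close> of hitting paths with different histories up to \<open>j\<close> are disjoint
  segments, so the Schreier condition bounds the number of histories.\<close>

lemma card_histories:
  assumes u: "u \<in> c00" "JTG_norm u = 1" "supp u \<subseteq> {j<..}" and "0 < e" and M: "1 / e\<^sup>2 \<le> real M" "M \<le> j"
  shows "finite {h \<inter> {..j} |h. hits e h u} \<and> card {h \<inter> {..j} |h. hits e h u} \<le> M"
proof (rule ccontr)
  let ?H = "{h \<inter> {..j} |h. hits e h u}"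
  assume many: "\<not> ?thesis"
  have "\<exists>T. T \<subseteq> ?H \<and> finite T \<and> card T = Suc M"
  proof (cases "finite ?H")
    case True
    then have "Suc M \<le> card ?H" using many by linarith
    then show ?thesis by (rule obtain_subset_with_card_n) blast
  next
    case False
    then show ?thesis using infinite_arbitrarily_large[OF False, of "Suc M"] by (elim exE conjE) blast
  qed
  then obtain T where T: "T \<subseteq> ?H" "finite T" "card T = Suc M" by (elim exE conjE)
  then have "\<forall>g\<in>T. \<exists>h K. g = h \<inter> {..j} \<and> path h \<and> e < sqn K h u" unfolding hits_def by blast
  then obtain h K where h: "\<And>g. g \<in> T \<Longrightarrow> g = h g \<inter> {..j}" "\<And>g. g \<in> T \<Longrightarrow> path (h g)"
    and K: "\<And>g. g \<in> T \<Longrightarrow> e < sqn (K g) (h g) u" by metis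
  obtain q where "\<forall>l\<in>supp u. l \<le> q"
    using c00_finite[OF u(1)] finite_nat_set_iff_bounded_le by blast
  then have supp: "supp u \<subseteq> {Suc j..q}" using u(3) by auto
  \<comment> \<open>As \<open>M \<le> j\<close>, the nodes beyond \<open>j\<close> are at least
    \<open>M + 1\<close>, the number of selected histories; so the segments form an admissible
    family.\<close>
  define s where "s g = h g \<inter> {Suc j..q}" for g
  have sq: "e < sqn (K g) (s g) u" if "g \<in> T" for g
    using K[OF that] path_sqn_Int[OF h(2)[OF that] supp] by (simp add: s_def)
  have seg: "segment (s g)" if "g \<in> T" for g
    unfolding s_def using sq[OF that] \<open>0 < e\<close> by (intro segment_of_path h(2)[OF that]) (auto simp: s_def)
  \<comment> \<open>A common node beyond \<open>j\<close> determines its predecessors, in particular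
    the history up to \<open>j\<close>.\<close>
  have eq: "g = g'" if "g \<in> T" "g' \<in> T" "c \<in> s g" "c \<in> s g'" for g g' c
  proof -
    have "h g \<inter> {..c} = h g' \<inter> {..c}" using path_atMost h(2) that by (auto simp: s_def)
    moreover have c: "X \<inter> {..j} = (X \<inter> {..c}) \<inter> {..j}" for X using that by (auto simp: s_def)
    ultimately have "h g \<inter> {..j} = h g' \<inter> {..j}" by (metis c)
    then show ?thesis using h(1)[OF that(1)] h(1)[OF that(2)] by metis
  qed
  have "sqrt (real (card T)) * e \<le> JTG_norm u"
    using eq seg T M(2) sq \<open>0 < e\<close>
    by (intro sqrt_card_mult_le_JTG_norm[of u T s e K] c00_finite u) (auto simp: s_def intro: less_imp_le)
  then have "(sqrt (real (card T)) * e)\<^sup>2 \<le> 1\<^sup>2" using u(2) \<open>0 < e\<close> by (intro power_mono) auto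
  then have "real (Suc M) * e\<^sup>2 \<le> 1" using T(3) by (simp add: power_mult_distrib)
  moreover have "1 \<le> real M * e\<^sup>2" using M(1) \<open>0 < e\<close> by (simp add: field_simps)
  ultimately have "real (Suc M) * e\<^sup>2 \<le> real M * e\<^sup>2" by simp
  then show False using \<open>0 < e\<close> by simp
qed

end

text \<open>Compactness of a countable product of two-point spaces, by a diagonal subsequence.
  Requirement \<open>p\<close> encodes a slot \<open>i\<close> and a point \<open>l\<close> and
  makes the membership of \<open>l\<close> in the \<open>i\<close>-th set eventually
  constant.\<close>

lemma convergent_set_subsequence:
  fixes E :: "nat \<Rightarrow> nat \<Rightarrow> nat set"
  shows "\<exists>(r :: nat \<Rightarrow> nat) F. strict_mono r \<and> (\<forall>i k. \<exists>J. \<forall>j\<ge>J. E (r j) i \<inter> {..k} = F i \<inter> {..k})"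
proof -
  define P where "P p s \<longleftrightarrow> (\<forall>j j'. (snd (prod_decode p) \<in> E (s j) (fst (prod_decode p)))
    = (snd (prod_decode p) \<in> E (s j') (fst (prod_decode p))))" for p and s :: "nat \<Rightarrow> nat"
  interpret subseqs P
  proof
    fix p and s :: "nat \<Rightarrow> nat"
    let ?Q = "\<lambda>j. snd (prod_decode p) \<in> E (s j) (fst (prod_decode p))"
    have "infinite {j. ?Q j} \<or> infinite {j. \<not> ?Q j}"
    proof (rule ccontr)
      assume "\<not> ?thesis"
      then have "finite ({j. ?Q j} \<union> {j. \<not> ?Q j})" by blast
      moreover have "{j. ?Q j} \<union> {j. \<not> ?Q j} = UNIV" by blast
      ultimately show False by simp
    qed
    then obtain B where B: "infinite {j. ?Q j = B}"
    proof
      assume "infinite {j. ?Q j}"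
      then show thesis using that[of True] by simp
    next
      assume "infinite {j. \<not> ?Q j}"
      then show thesis using that[of False] by simp
    qed
    have "enumerate {j. ?Q j = B} i \<in> {j. ?Q j = B}" for i by (rule enumerate_in_set[OF B])
    then have "P p (s \<circ> enumerate {j. ?Q j = B})" unfolding P_def by simp
    moreover have "strict_mono (enumerate {j. ?Q j = B})" using B by (rule strict_mono_enumerate)
    ultimately show "\<exists>r'. strict_mono r' \<and> P p (s \<circ> r')" by blast
  qed
  have const: "\<exists>J. \<forall>j\<ge>J. \<forall>j'\<ge>J. (l \<in> E (diagseq j) i) = (l \<in> E (diagseq j') i)" for i l
  proof -
    define p where "p = prod_encode (i, l)"
    have "P p (diagseq \<circ> (+) (Suc p))" by (rule diagseq_holds) (simp add: P_def)
    then have *: "(l \<in> E (diagseq (Suc p + a)) i) = (l \<in> E (diagseq (Suc p + a')) i)" for a a'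
      by (simp add: P_def p_def)
    have "(l \<in> E (diagseq j) i) = (l \<in> E (diagseq j') i)" if "Suc p \<le> j" "Suc p \<le> j'" for j j'
      using *[of "j - Suc p" "j' - Suc p"] that by simp
    then show ?thesis by blast
  qed
  define F where "F i = {l. \<exists>J. \<forall>j\<ge>J. l \<in> E (diagseq j) i}" for i
  have ev: "\<exists>J. \<forall>j\<ge>J. (l \<in> E (diagseq j) i) = (l \<in> F i)" for i l
  proof -
    obtain J where J: "\<And>j j'. J \<le> j \<Longrightarrow> J \<le> j' \<Longrightarrow> (l \<in> E (diagseq j) i) = (l \<in> E (diagseq j') i)"
      using const by metis
    have "(l \<in> F i) = (l \<in> E (diagseq J) i)"
    proof
      assume "l \<in> F i"
      then obtain J' where "\<forall>j\<ge>J'. l \<in> E (diagseq j) i" by (auto simp: F_def)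
      then show "l \<in> E (diagseq J) i" using J[of "max J J'" J] by simp
    next
      assume "l \<in> E (diagseq J) i"
      then have "\<forall>j\<ge>J. l \<in> E (diagseq j) i" using J by blast
      then show "l \<in> F i" unfolding F_def by blast
    qed
    then show ?thesis using J by blast
  qed
  have "\<exists>J. \<forall>j\<ge>J. E (diagseq j) i \<inter> {..k} = F i \<inter> {..k}" for i k
  proof -
    have "\<forall>l. \<exists>J. \<forall>j\<ge>J. (l \<in> E (diagseq j) i) = (l \<in> F i)" using ev by blast
    then obtain J where J: "\<And>l j. J l \<le> j \<Longrightarrow> (l \<in> E (diagseq j) i) = (l \<in> F i)" by metis
    have "E (diagseq j) i \<inter> {..k} = F i \<inter> {..k}" if j: "Max (J ` {..k}) \<le> j" for j
    proof -
      have "J l \<le> j" if "l \<in> {..k}" for l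
        using Max_ge[of "J ` {..k}" "J l"] j that by simp
      then have "(l \<in> E (diagseq j) i) = (l \<in> F i)" if "l \<in> {..k}" for l using J that by simp
      then show ?thesis by (simp only: set_eq_iff Int_iff) metis
    qed
    then show ?thesis by (intro exI[of _ "Max (J ` {..k})"] allI impI)
  qed
  then show ?thesis using subseq_diagseq by blast
qed

section \<open>Blocks hit by different paths\<close>

lemma increasing_up_to:
  fixes t :: "nat \<Rightarrow> nat"
  assumes "\<And>k. k < N \<Longrightarrow> t k < t (Suc k)" "k \<le> l" "l \<le> N"
  shows "t k \<le> t l"
  using assms(2)
proof (induction k rule: inc_induct)
  case (step i)
  then show ?case using assms(1)[of i] assms(3) by simp
qed simp

context jt_completion
begin

lemma path_atMost_path: "path h \<Longrightarrow> path (h \<inter> {..k})"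
  unfolding path_def Chains_def by (auto dest: compatible)

text \<open>Each condition on a path concerns at most two nodes, and some \<open>E j\<close> agrees
  with \<open>h\<close> up to these.\<close>

lemma path_of_limit:
  fixes E :: "nat \<Rightarrow> nat set"
  assumes E: "\<And>j. path (E j)" and lim: "\<And>k. \<exists>J. \<forall>j\<ge>J. E j \<inter> {..k} = h \<inter> {..k}"
  shows "path h"
proof -
  have common: "\<exists>j. a \<in> E j \<and> b \<in> E j \<and> (\<forall>c\<le>b. c \<in> E j \<longleftrightarrow> c \<in> h)" if ab: "a \<in> h" "b \<in> h" for a b
  proof -
    obtain J where J': "\<forall>j\<ge>J. E j \<inter> {..max a b} = h \<inter> {..max a b}"
      using lim[of "max a b"] by (elim exE)
    note J = J'[rule_format, OF order_refl]
    have eq: "c \<in> E J \<longleftrightarrow> c \<in> h" if "c \<le> max a b" for c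
    proof -
      have "c \<in> E J \<inter> {..max a b} \<longleftrightarrow> c \<in> h \<inter> {..max a b}" unfolding J ..
      then show ?thesis using that by simp
    qed
    then show ?thesis using ab by (intro exI[of _ J]) auto
  qed
  show ?thesis
    unfolding path_def
  proof (intro conjI ballI impI)
    show "h \<subseteq> D"
    proof
      fix a assume "a \<in> h"
      then obtain j where "a \<in> E j" using common[of a a] by metis
      then show "a \<in> D" using E[of j] by (auto simp: path_def)
    qed
    show "h \<in> Chains R"
      unfolding Chains_def
    proof (intro CollectI ballI)
      fix a b assume "a \<in> h" "b \<in> h"
      then obtain j where "a \<in> E j" "b \<in> E j" using common[of a b] by metis
      then show "(a, b) \<in> R \<or> (b, a) \<in> R" using E[of j] by (auto simp: path_def Chains_def)
    qed
    fix a b assume a: "a \<in> D" "b \<in> h" "(a, b) \<in> R"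
    then obtain j where "b \<in> E j" "\<forall>c\<le>b. c \<in> E j \<longleftrightarrow> c \<in> h" using common[of b b] by metis
    then show "a \<in> h" using a E[of j] compatible unfolding path_def by metis
  qed
qed

text \<open>Padding with a default value gives every history set the same \<open>M\<close> slots, so
  that compactness can be applied slot by slot.\<close>

lemma finite_enumeration:
  assumes "finite H" "card H \<le> M" "H \<subseteq> P" "d \<in> P"
  shows "\<exists>e. H \<subseteq> e ` {..<M} \<and> (\<forall>i. e i \<in> P)"
proof -
  obtain f where f: "bij_betw f {0..<card H} H" using ex_bij_betw_nat_finite[OF assms(1)] by blast
  define e where "e i = (if i < card H then f i else d)" for i :: nat
  have "f i \<in> H" if "i < card H" for i using bij_betwE[OF f] that by simp
  then have "\<forall>i. e i \<in> P" using assms(3,4) by (auto simp: e_def)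
  moreover have "x \<in> e ` {..<M}" if "x \<in> H" for x
  proof -
    have "x \<in> f ` {0..<card H}" using f that by (simp add: bij_betw_def)
    then obtain i where "i < card H" "x = f i" by auto
    then show ?thesis using assms(2) by (intro image_eqI[of _ _ i]) (auto simp: e_def)
  qed
  ultimately show ?thesis by blast
qed

text \<open>Since the histories of hitting paths are boundedly many, compactness yields finitely many
  paths approximating all of them.\<close>

lemma limit_paths:
  assumes nc: "non_coercive Y" and Y: "closed_subspace_of Y JTG"
    and G: "finite G" "\<forall>h\<in>G. path h" and "0 < e"
  shows "\<exists>F. finite F \<and> (\<forall>h\<in>F. path h) \<and> (\<forall>k0 \<eta>. 0 < \<eta> \<longrightarrow> (\<exists>u. near_unit Y \<eta> u \<and> supp u \<subseteq> {k0<..}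
     \<and> (\<forall>h\<in>G. \<not> hits e h u) \<and> (\<forall>h. hits e h u \<longrightarrow> (\<exists>f\<in>F. h \<inter> {..k0} = f \<inter> {..k0}))))"
proof -
  obtain M :: nat where M: "1 / e\<^sup>2 \<le> real M" using real_arch_simple by blast
  \<comment> \<open>At most \<open>e\<close>, so that no path of \<open>G\<close> hits a block;
    tending to 0, so that blocks arbitrarily close to \<open>Y\<close> occur.\<close>
  define \<eta> where "\<eta> j = min e (1 / real (Suc j))" for j
  have \<eta>: "0 < \<eta> j" for j using \<open>0 < e\<close> by (simp add: \<eta>_def)
  \<comment> \<open>The supports start beyond \<open>j + M\<close> because the bound for the number
    of histories requires a cut of at least \<open>M\<close>.\<close>
  have "\<forall>j. \<exists>u. near_unit Y (\<eta> j) u \<and> supp u \<subseteq> {j + M<..} \<and> (\<forall>h\<in>G. \<forall>K. sqn K h u \<le> \<eta> j)"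
    using non_coercive_block[OF nc Y G \<eta>] by blast
  then obtain u where u: "\<And>j. near_unit Y (\<eta> j) (u j)" "\<And>j. supp (u j) \<subseteq> {j + M<..}"
    and uG: "\<And>j h K. h \<in> G \<Longrightarrow> sqn K h (u j) \<le> \<eta> j" by metis
  define H where "H j = {h \<inter> {..j + M} |h. hits e h (u j)}" for j
  have H: "finite (H j) \<and> card (H j) \<le> M" for j
    unfolding H_def using u[of j] M \<open>0 < e\<close> by (intro card_histories) (auto simp: near_unit_def)
  have "H j \<subseteq> Collect path" for j using path_atMost_path by (auto simp: H_def hits_def)
  moreover have "{} \<in> Collect path" by (simp add: path_def Chains_def)
  ultimately have "\<forall>j. \<exists>f. H j \<subseteq> f ` {..<M} \<and> (\<forall>i. f i \<in> Collect path)"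
    using finite_enumeration H by metis
  then obtain E where E: "\<And>j. H j \<subseteq> E j ` {..<M}" "\<And>j i. path (E j i)" by (metis mem_Collect_eq)
  obtain r :: "nat \<Rightarrow> nat" and F where rF: "strict_mono r \<and> (\<forall>i k. \<exists>J. \<forall>j\<ge>J. E (r j) i \<inter> {..k} = F i \<inter> {..k})"
    using convergent_set_subsequence[of E] by (elim exE)
  note r = rF[THEN conjunct1] and F = rF[THEN conjunct2, rule_format]
  have pF: "path (F i)" for i by (rule path_of_limit[of "\<lambda>j. E (r j) i", OF E(2) F])
  have "\<exists>v. near_unit Y \<theta> v \<and> supp v \<subseteq> {k0<..}
     \<and> (\<forall>h\<in>G. \<not> hits e h v) \<and> (\<forall>h. hits e h v \<longrightarrow> (\<exists>f\<in>F ` {..<M}. h \<inter> {..k0} = f \<inter> {..k0}))"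
    if "0 < \<theta>" for k0 \<theta>
  proof -
    have "\<forall>i. \<exists>J. \<forall>j\<ge>J. E (r j) i \<inter> {..k0} = F i \<inter> {..k0}" by (intro allI F)
    then obtain J where J: "\<And>i j. J i \<le> j \<Longrightarrow> E (r j) i \<inter> {..k0} = F i \<inter> {..k0}" by metis
    obtain T :: nat where T: "1 / \<theta> \<le> real T" using real_arch_simple by blast
    \<comment> \<open>Large enough for the distance to \<open>Y\<close>, for the position of the
      support, and for all \<open>M\<close> slots to agree with their limits up to
      \<open>k0\<close>.\<close>
    define j where "j = Max (insert (max T k0) (J ` {..<M}))"
    have j: "T \<le> j" "k0 \<le> j" "\<And>i. i < M \<Longrightarrow> J i \<le> j"
    proof -
      have "max T k0 \<le> j" unfolding j_def by (intro Max_ge) auto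
      then show "T \<le> j" "k0 \<le> j" by auto
      show "J i \<le> j" if "i < M" for i unfolding j_def using that by (intro Max_ge) auto
    qed
    have rj: "j \<le> r j" using r by (rule strict_mono_imp_increasing)
    have "1 / real (Suc (r j)) \<le> \<theta>"
    proof -
      have "1 \<le> \<theta> * real T" using T that by (simp add: field_simps)
      also have "\<dots> \<le> \<theta> * real (Suc (r j))" using j rj that by (intro mult_left_mono) auto
      finally show ?thesis by (simp add: field_simps)
    qed
    then have "\<eta> (r j) \<le> \<theta>" by (simp add: \<eta>_def)
    then have "near_unit Y \<theta> (u (r j))" using u(1)[of "r j"] unfolding near_unit_def by (meson order_trans)
    moreover have "supp (u (r j)) \<subseteq> {k0<..}" using u(2)[of "r j"] j rj by fastforce
    moreover have "\<not> hits e h (u (r j))" if "h \<in> G" for h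
    proof -
      have "sqn K h (u (r j)) \<le> e" for K using uG[OF that, of K "r j"] by (simp add: \<eta>_def)
      then show ?thesis by (auto simp: hits_def not_less)
    qed
    moreover have "\<exists>f\<in>F ` {..<M}. h \<inter> {..k0} = f \<inter> {..k0}" if "hits e h (u (r j))" for h
    proof -
      have "h \<inter> {..r j + M} \<in> H (r j)" using that by (auto simp: H_def)
      then obtain i where i: "i < M" "h \<inter> {..r j + M} = E (r j) i" using E(1)[of "r j"] by auto
      have "h \<inter> {..k0} = (h \<inter> {..r j + M}) \<inter> {..k0}" using j rj by auto
      also have "\<dots> = F i \<inter> {..k0}" unfolding i(2) using J j(3)[OF i(1)] by blast
      finally show ?thesis using i(1) by blast
    qed
    ultimately show ?thesis by (intro exI[of _ "u (r j)"]) simp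
  qed
  then show ?thesis using pF by (intro exI[of _ "F ` {..<M}"]) simp
qed

lemma hits_cong:
  assumes "path h" "path f" "h \<inter> {..q} = f \<inter> {..q}" "supp u \<subseteq> {..q}"
  shows "hits e h u \<longleftrightarrow> hits e f u"
proof -
  have "sqn K h u = sqn K f u" for K
    using path_sqn_Int[OF assms(1,4), of K] path_sqn_Int[OF assms(2,4), of K] assms(3) by metis
  then show ?thesis using assms(1,2) by (simp add: hits_def)
qed

text \<open>The set \<open>G\<close> is the parameter of the induction: it collects the limit paths
  of blocks that are placed further out.\<close>

definition separated_blocks ::
    "'a set \<Rightarrow> real \<Rightarrow> real \<Rightarrow> nat set set \<Rightarrow> nat \<Rightarrow> nat \<Rightarrow> (nat \<Rightarrow> nat \<Rightarrow> real) \<Rightarrow> (nat \<Rightarrow> nat) \<Rightarrow> bool" where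
  "separated_blocks Y \<eta> e G k0 N u t \<longleftrightarrow> t 0 = k0 \<and> (\<forall>k<N. t k < t (Suc k) \<and> near_unit Y \<eta> (u k)
      \<and> supp (u k) \<subseteq> {t k<..t (Suc k)} \<and> (\<forall>h\<in>G. \<not> hits e h (u k)))
    \<and> (\<forall>l<N. \<forall>k<l. \<forall>h. hits e h (u l) \<longrightarrow> \<not> hits e h (u k))"

lemma separated_blocksD:
  assumes "separated_blocks Y \<eta> e G k0 N u t"
  shows "t 0 = k0"
    and "k < N \<Longrightarrow> t k < t (Suc k) \<and> near_unit Y \<eta> (u k) \<and> supp (u k) \<subseteq> {t k<..t (Suc k)}
      \<and> (\<forall>h\<in>G. \<not> hits e h (u k))"
    and "l < N \<Longrightarrow> k < l \<Longrightarrow> hits e h (u l) \<Longrightarrow> \<not> hits e h (u k)"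
  using assms unfolding separated_blocks_def by simp_all

text \<open>The last block is prepared first. Its limit paths \<open>F\<close> do not depend on its
  position, so the induction hypothesis for \<open>G \<union> F\<close> supplies earlier blocks that
  no path of \<open>F\<close> hits. The last block is then placed beyond them, where each path
  hitting it follows some member of \<open>F\<close> through the earlier blocks.\<close>

lemma disjointly_hit_blocks:
  assumes nc: "non_coercive Y" and Y: "closed_subspace_of Y JTG" and e: "0 < e" and \<eta>: "0 < \<eta>"
  shows "finite G \<Longrightarrow> \<forall>h\<in>G. path h \<Longrightarrow> \<exists>u t. separated_blocks Y \<eta> e G k0 N u t"
proof (induction N arbitrary: G)
  case 0
  show ?case unfolding separated_blocks_def by (intro exI[of _ "\<lambda>_. k0"] exI) auto
next
  case (Suc N)
  obtain F where FF: "finite F \<and> (\<forall>h\<in>F. path h) \<and> (\<forall>k0 \<eta>. 0 < \<eta> \<longrightarrow> (\<exists>u. near_unit Y \<eta> u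
     \<and> supp u \<subseteq> {k0<..} \<and> (\<forall>h\<in>G. \<not> hits e h u)
     \<and> (\<forall>h. hits e h u \<longrightarrow> (\<exists>f\<in>F. h \<inter> {..k0} = f \<inter> {..k0}))))"
    using limit_paths[OF nc Y Suc.prems e] by (elim exE)
  note F = FF[THEN conjunct1] FF[THEN conjunct2, THEN conjunct1]
    and lim = FF[THEN conjunct2, THEN conjunct2, rule_format]
  have "finite (G \<union> F)" "\<forall>h\<in>G \<union> F. path h" using F Suc.prems by auto
  from Suc.IH[OF this] obtain u t where UT: "separated_blocks Y \<eta> e (G \<union> F) k0 N u t" by (elim exE)
  note t0 = separated_blocksD(1)[OF UT] and ut = separated_blocksD(2)[OF UT]
    and sep = separated_blocksD(3)[OF UT]
  obtain v where V: "near_unit Y \<eta> v \<and> supp v \<subseteq> {t N<..} \<and> (\<forall>h\<in>G. \<not> hits e h v)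
    \<and> (\<forall>h. hits e h v \<longrightarrow> (\<exists>f\<in>F. h \<inter> {..t N} = f \<inter> {..t N}))"
    using lim[OF \<eta>, of "t N"] by (elim exE)
  note v = V[THEN conjunct1] V[THEN conjunct2, THEN conjunct1]
      V[THEN conjunct2, THEN conjunct2, THEN conjunct1]
    and vF = V[THEN conjunct2, THEN conjunct2, THEN conjunct2, rule_format]
  have tmono: "t k \<le> t N" if "k \<le> N" for k
    by (rule increasing_up_to[of N t, OF _ that order_refl]) (use ut in simp)
  have "finite (supp v)" using v(1) by (simp add: near_unit_def c00_finite)
  then obtain q where "\<forall>l\<in>supp v. l \<le> q" using finite_nat_set_iff_bounded_le by blast
  then have q: "supp v \<subseteq> {t N<..max q (Suc (t N))}" using v(2) by fastforce
  define u' where "u' = u(N := v)"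
  define t' where "t' = t(Suc N := max q (Suc (t N)))"
  have 1: "t' k < t' (Suc k) \<and> near_unit Y \<eta> (u' k)
      \<and> supp (u' k) \<subseteq> {t' k<..t' (Suc k)} \<and> (\<forall>h\<in>G. \<not> hits e h (u' k))" if "k < Suc N" for k
  proof (cases "k = N")
    case True
    then show ?thesis using v q by (simp add: u'_def t'_def)
  next
    case False
    then show ?thesis using ut[of k] that by (simp add: u'_def t'_def)
  qed
  have 2: "\<not> hits e h (u' k)" if "l < Suc N" "k < l" "hits e h (u' l)" for l k h
  proof (cases "l = N")
    case True
    then have hv: "hits e h v" using that by (simp add: u'_def)
    then obtain f where f: "f \<in> F" "h \<inter> {..t N} = f \<inter> {..t N}" using vF by blast
    have k: "k < N" using that True by simp
    have "t (Suc k) \<le> t N" using tmono k by simp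
    then have "supp (u k) \<subseteq> {..t N}" using ut[OF k] by fastforce
    moreover have "path h" "path f" using hv f F by (auto simp: hits_def)
    ultimately have "hits e h (u k) \<longleftrightarrow> hits e f (u k)" using hits_cong f(2) by blast
    then show ?thesis using ut[OF k] f(1) k by (simp add: u'_def)
  next
    case False
    then show ?thesis using sep[of l k h] that by (simp add: u'_def)
  qed
  have "t' 0 = k0" using t0 by (simp add: t'_def)
  then show ?case using 1 2 unfolding separated_blocks_def by (intro exI[of _ u'] exI[of _ t']) simp
qed

section \<open>Segment norms of sums of separated blocks\<close>

lemma sqn_sum_le: "sqn K s (\<lambda>l. \<Sum>k\<in>A. a k * u k l) \<le> (\<Sum>k\<in>A. \<bar>a k\<bar> * sqn K s (u k))"
proof (induction A rule: infinite_finite_induct)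
  case (insert k A)
  have "sqn K s (\<lambda>l. \<Sum>k\<in>insert k A. a k * u k l) = sqn K s (\<lambda>l. a k * u k l + (\<Sum>k\<in>A. a k * u k l))"
    using insert by simp
  also have "\<dots> \<le> sqn K s (\<lambda>l. a k * u k l) + sqn K s (\<lambda>l. \<Sum>k\<in>A. a k * u k l)" by (rule sqn_add)
  finally show ?case using insert by (simp add: sqn_scale)
qed (auto simp: sqn_def blk_sum_def L2_set_def)

lemma sqn_cong: "(\<And>l. l \<in> s \<Longrightarrow> x l = y l) \<Longrightarrow> sqn K s x = sqn K s y"
  unfolding sqn_def blk_sum_def by (intro L2_set_cong sum.cong refl) auto

lemma sqn_zero: "supp x \<inter> s = {} \<Longrightarrow> sqn K s x = 0"
proof -
  assume "supp x \<inter> s = {}"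
  then have "sqn K s x = sqn K s (\<lambda>_. 0)" by (intro sqn_cong) (auto simp: supp_def)
  then show ?thesis by (simp add: sqn_def blk_sum_def L2_set_def)
qed

text \<open>A segment \<open>h \<inter> {p..q}\<close> cuts properly into at most two of the blocks, those containing \<open>p\<close> or \<open>q\<close>;
  any other block that it meets is crossed completely, hence by the path \<open>h\<close>.\<close>

lemma successive_sum_le:
  fixes t :: "nat \<Rightarrow> nat"
  assumes t: "\<And>k. k < N \<Longrightarrow> t k < t (Suc k)"
    and u: "\<And>k. k < N \<Longrightarrow> u k \<in> c00 \<and> JTG_norm (u k) \<le> 1 \<and> supp (u k) \<subseteq> {t k<..t (Suc k)}"
    and sep: "\<And>l k h. l < N \<Longrightarrow> k < l \<Longrightarrow> hits e h (u l) \<Longrightarrow> \<not> hits e h (u k)"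
    and s: "segment s" and e: "0 \<le> e"
  shows "(\<Sum>k<N. sqn K s (u k)) \<le> 3 + real N * e"
proof -
  obtain h p q where h: "path h" "s = h \<inter> {p..q}" using segmentD(6)[OF s] by blast
  have tmono: "t k \<le> t l" if "k \<le> l" "l \<le> N" for k l
    by (rule increasing_up_to[of N t, OF t that])
  have one: "card {k\<in>{..<N}. c \<in> {t k<..t (Suc k)}} \<le> 1" for c
  proof -
    have "k = l" if "k < N" "l < N" "c \<in> {t k<..t (Suc k)}" "c \<in> {t l<..t (Suc l)}" for k l
      using that tmono[of "Suc k" l] tmono[of "Suc l" k] by (cases k l rule: linorder_cases) auto
    then show ?thesis by (intro card_le_Suc0_iff_eq[THEN iffD2, simplified One_nat_def[symmetric]]) auto
  qed
  define Hit where "Hit = {k\<in>{..<N}. hits e h (u k)}"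
  have "k = l" if "k \<in> Hit" "l \<in> Hit" for k l
    using that sep[of k l h] sep[of l k h] unfolding Hit_def by (cases k l rule: linorder_cases) auto
  then have Hit: "card Hit \<le> 1"
    by (intro card_le_Suc0_iff_eq[THEN iffD2, simplified One_nat_def[symmetric]]) (auto simp: Hit_def)
  \<comment> \<open>The exceptional blocks: at most one contains \<open>p\<close>, at most one
    contains \<open>q\<close>, and at most one is hit by \<open>h\<close>. This is the constant
    3.\<close>
  define B where "B = {k\<in>{..<N}. p \<in> {t k<..t (Suc k)}} \<union> {k\<in>{..<N}. q \<in> {t k<..t (Suc k)}} \<union> Hit"
  have "card B \<le> card ({k\<in>{..<N}. p \<in> {t k<..t (Suc k)}} \<union> {k\<in>{..<N}. q \<in> {t k<..t (Suc k)}}) + card Hit"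
    unfolding B_def by (rule card_Un_le)
  also have "card ({k\<in>{..<N}. p \<in> {t k<..t (Suc k)}} \<union> {k\<in>{..<N}. q \<in> {t k<..t (Suc k)}})
      \<le> card {k\<in>{..<N}. p \<in> {t k<..t (Suc k)}} + card {k\<in>{..<N}. q \<in> {t k<..t (Suc k)}}"
    by (rule card_Un_le)
  finally have B: "card B \<le> 3" using one[of p] one[of q] Hit by linarith
  have le: "sqn K s (u k) \<le> (if k \<in> B then 1 else 0) + e" if k: "k < N" for k
  proof (cases "k \<in> B")
    case True
    have "sqn K s (u k) \<le> JTG_norm (u k)"
      using u[OF k] s by (intro sqn_le_JTG_norm) (auto simp: c00_finite)
    then show ?thesis using u[OF k] True e by simp
  next
    case False
    then have pq: "p \<notin> {t k<..t (Suc k)}" "q \<notin> {t k<..t (Suc k)}" "\<not> hits e h (u k)"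
      using k by (auto simp: B_def Hit_def)
    have "sqn K s (u k) \<le> e"
    proof (cases "p \<le> t k \<and> t (Suc k) < q")
      case True
      then have "supp (u k) \<subseteq> {p..q}" using u[OF k] by fastforce
      then have "sqn K s (u k) = sqn K h (u k)" unfolding h(2) by (rule path_sqn_Int[OF h(1)])
      then show ?thesis using pq(3) h(1) by (auto simp: hits_def not_less)
    next
      case False
      then have "supp (u k) \<inter> s = {}" using u[OF k] pq h(2) by fastforce
      then show ?thesis using sqn_zero e by simp
    qed
    then show ?thesis using False by simp
  qed
  have "(\<Sum>k<N. sqn K s (u k)) \<le> (\<Sum>k<N. (if k \<in> B then 1 else 0) + e)" using le by (intro sum_mono) auto
  also have "\<dots> = real (card B) + real N * e"
  proof -
    have "{..<N} \<inter> B = B" by (auto simp: B_def Hit_def)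
    then show ?thesis by (simp add: sum.distrib flip: sum.inter_restrict)
  qed
  also have "\<dots> \<le> 3 + real N * e" using B by simp
  finally show ?thesis .
qed

lemma small_segment_block:
  assumes nc: "non_coercive Y" and Y: "closed_subspace_of Y JTG" and \<delta>: "0 < \<delta>"
  shows "\<exists>u. near_unit Y \<delta> u \<and> supp u \<subseteq> {k0<..} \<and> (\<forall>s K. segment s \<longrightarrow> sqn K s u \<le> \<delta>)"
proof (rule ccontr)
  assume contra: "\<not> ?thesis"
  have big: "\<exists>s K. segment s \<and> \<delta> < sqn K s u" if "near_unit Y \<delta> u" "supp u \<subseteq> {k0<..}" for u
    using contra that by (meson not_le)
  \<comment> \<open>The quotient makes \<open>sqrt (real N0) * \<delta>^2\<close> at least 4, the
    bound for the segment norms of the sum; the summand 1 makes \<open>N0\<close> positive.\<close>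
  obtain N0 :: nat where N0: "16 / \<delta> ^ 4 + 1 \<le> real N0" using real_arch_simple by blast
  have d4: "0 < \<delta> ^ 4" "0 \<le> 16 / \<delta> ^ 4" using \<delta> by auto
  have N1: "1 \<le> real N0" "0 < real N0" using N0 d4 by linarith+
  have "16 / \<delta> ^ 4 \<le> real N0" using N0 by simp
  then have "16 \<le> real N0 * \<delta> ^ 4" using d4(1) by (simp add: pos_divide_le_eq)
  moreover have "\<delta> ^ 4 = (\<delta>\<^sup>2)\<^sup>2" by (simp flip: power_mult)
  ultimately have "sqrt 16 \<le> sqrt (real N0) * sqrt ((\<delta>\<^sup>2)\<^sup>2)"
    by (simp only: flip: real_sqrt_mult) (rule real_sqrt_le_mono)
  then have N4: "4 \<le> sqrt (real N0) * \<delta>\<^sup>2" by (simp only: real_sqrt_abs abs_power2) simp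
  \<comment> \<open>The sum of \<open>N0\<close> blocks has distance at most
    \<open>N0 * \<eta> \<le> \<delta>^2\<close> from \<open>Y\<close> and norm at least \<delta>, so
    its normalization is again within \<delta> of \<open>Y\<close>.\<close>
  define \<eta> where "\<eta> = min \<delta> (\<delta>\<^sup>2 / real N0)"
  have \<eta>: "0 < \<eta>" "\<eta> \<le> \<delta>" "real N0 * \<eta> \<le> \<delta>\<^sup>2" using \<delta> N1 by (auto simp: \<eta>_def min_def field_simps)
  have eN: "0 < 1 / real N0" using N1 by simp
  have no_path: "\<forall>h\<in>{}. path h" by simp
  \<comment> \<open>Starting beyond \<open>N0\<close> makes one segment per block an admissible
    family. With the threshold \<open>1 / N0\<close> the blocks that a segment crosses without
    hitting them contribute at most 1 altogether.\<close>
  obtain u t where UT: "separated_blocks Y \<eta> (1 / real N0) {} (max k0 N0) N0 u t"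
    using disjointly_hit_blocks[OF nc Y eN \<eta>(1) finite.emptyI no_path, of "max k0 N0" N0]
    by (elim exE)
  note t0 = separated_blocksD(1)[OF UT] and ut = separated_blocksD(2)[OF UT]
    and sep = separated_blocksD(3)[OF UT]
  have tmono: "t k \<le> t l" if "k \<le> l" "l \<le> N0" for k l
    by (rule increasing_up_to[of N0 t, OF _ that]) (use ut in simp)
  have u: "u k \<in> c00" "JTG_norm (u k) = 1" "\<exists>y\<in>Y. norm (\<iota> (u k) - y) \<le> \<eta>"
    "near_unit Y \<delta> (u k)" "supp (u k) \<subseteq> {t k<..t (Suc k)}" "supp (u k) \<subseteq> {max k0 N0<..}" if "k < N0" for k
  proof -
    show "u k \<in> c00" "JTG_norm (u k) = 1" "\<exists>y\<in>Y. norm (\<iota> (u k) - y) \<le> \<eta>"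
      "supp (u k) \<subseteq> {t k<..t (Suc k)}"
      using ut[OF that] by (auto simp: near_unit_def)
    then show "near_unit Y \<delta> (u k)" using \<eta>(2) unfolding near_unit_def by (meson order_trans)
    have "max k0 N0 \<le> t k" using tmono[of 0 k] t0 that by simp
    then show "supp (u k) \<subseteq> {max k0 N0<..}" using \<open>supp (u k) \<subseteq> {t k<..t (Suc k)}\<close> by fastforce
  qed
  define w where "w = (\<lambda>l. \<Sum>k\<in>{..<N0}. 1 * u k l)"
  have wc: "w \<in> c00" unfolding w_def using u(1) by (intro c00_sum) auto
  have wu: "w l = u k l" if "k < N0" "l \<in> {t k<..t (Suc k)}" for k l
  proof -
    have "u j l = 0" if "j < N0" "j \<noteq> k" for j
    proof -
      have "l \<notin> {t j<..t (Suc j)}"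
        using that \<open>k < N0\<close> \<open>l \<in> {t k<..t (Suc k)}\<close> tmono[of "Suc k" j] tmono[of "Suc j" k]
        by (cases j k rule: linorder_cases) auto
      then show ?thesis using u(5)[OF \<open>j < N0\<close>] by (auto simp: supp_def)
    qed
    then have "(\<Sum>j<N0. u j l) = (\<Sum>j\<in>{k}. u j l)" using that by (intro sum.mono_neutral_right) auto
    then show ?thesis by (simp add: w_def)
  qed
  have "\<forall>k\<in>{..<N0}. \<exists>s K. segment s \<and> \<delta> < sqn K s (u k)"
    using big u(4,6) by (metis lessThan_iff max.cobounded1 greaterThan_subset_iff order_trans)
  then obtain s K where sK: "\<And>k. k < N0 \<Longrightarrow> segment (s k)" "\<And>k. k < N0 \<Longrightarrow> \<delta> < sqn (K k) (s k) (u k)"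
    by (metis lessThan_iff)
  \<comment> \<open>Confined to their blocks the segments become disjoint, and on each of them the
    sum \<open>w\<close> equals a single block.\<close>
  define s' where "s' k = s k \<inter> {t k<..t (Suc k)}" for k
  have sq: "\<delta> < sqn (K k) (s' k) w" if "k < N0" for k
  proof -
    have "\<delta> < sqn (K k) (s' k) (u k)"
      using sK(2)[OF that] segment_sqn_Int[OF sK(1)[OF that] u(5)[OF that]] by (simp add: s'_def)
    also have "\<dots> = sqn (K k) (s' k) w" using wu[OF that] by (intro sqn_cong) (auto simp: s'_def)
    finally show ?thesis .
  qed
  have seg: "segment (s' k)" if "k < N0" for k
    unfolding s'_def using sq[OF that] \<delta>
    by (intro segment_Int sK(1)[OF that]) (auto simp: s'_def subset_iff)
  have eq: "k = l" if "k < N0" "l < N0" "c \<in> s' k" "c \<in> s' l" for k l c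
    using that tmono[of "Suc k" l] tmono[of "Suc l" k]
    by (cases k l rule: linorder_cases) (auto simp: s'_def)
  have "N0 \<le> c" if "k < N0" "c \<in> s' k" for k c
    using that tmono[of 0 k] t0 by (simp add: s'_def)
  then have "sqrt (real (card {..<N0})) * \<delta> \<le> JTG_norm w"
    using eq seg sq \<delta>
    by (intro sqrt_card_mult_le_JTG_norm[of w "{..<N0}" s' \<delta> K] c00_finite wc) (auto intro: less_imp_le)
  then have Nw: "sqrt (real N0) * \<delta> \<le> JTG_norm w" by simp
  have sN: "1 \<le> sqrt (real N0)" using N1 by simp
  have Nw': "\<delta> \<le> JTG_norm w" using Nw mult_right_mono[OF sN, of \<delta>] \<delta> by linarith
  have "\<forall>k\<in>{..<N0}. \<exists>y. y \<in> Y \<and> norm (\<iota> (u k) - y) \<le> \<eta>" using u(3) by blast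
  then obtain y where y: "\<And>k. k < N0 \<Longrightarrow> y k \<in> Y" "\<And>k. k < N0 \<Longrightarrow> norm (\<iota> (u k) - y k) \<le> \<eta>"
    by (metis lessThan_iff)
  have sY: "subspace Y" using Y by (simp add: closed_subspace_of_def)
  have yY: "(\<Sum>k<N0. y k) \<in> Y" using y(1) by (intro subspace_sum[OF sY]) auto
  have "\<iota> w = (\<Sum>k<N0. \<iota> (u k))"
    unfolding w_def using \<iota>_sum[of "{..<N0}" u "\<lambda>_. 1"] u(1) by simp
  then have "norm (\<iota> w - (\<Sum>k<N0. y k)) = norm (\<Sum>k<N0. \<iota> (u k) - y k)" by (simp add: sum_subtractf)
  also have "\<dots> \<le> (\<Sum>k<N0. \<eta>)" using y(2) by (intro sum_norm_le) auto
  finally have wy: "norm (\<iota> w - (\<Sum>k<N0. y k)) \<le> real N0 * \<eta>" by simp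
  define v where "v = (\<lambda>l. (1 / JTG_norm w) * w l)"
  have "near_unit Y \<delta> v"
    unfolding v_def
  proof (rule near_unit_normalize[OF sY wc _ yY wy])
    show "0 < JTG_norm w" using Nw' \<delta> by simp
    have "\<delta> * \<delta> \<le> \<delta> * JTG_norm w" using Nw' \<delta> by (intro mult_left_mono) auto
    then show "real N0 * \<eta> \<le> \<delta> * JTG_norm w" using \<eta>(3) by (simp add: power2_eq_square)
  qed
  moreover have "supp v \<subseteq> {k0<..}"
  proof
    fix l assume "l \<in> supp v"
    then have "w l \<noteq> 0" by (auto simp: v_def supp_def)
    then obtain k where "k < N0" "u k l \<noteq> 0"
      unfolding w_def by (auto dest: sum.not_neutral_contains_not_neutral)
    then show "l \<in> {k0<..}" using u(6)[of k] by (auto simp: supp_def)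
  qed
  \<comment> \<open>The contradiction hypothesis is applied a second time, now to the normalized
    sum.\<close>
  ultimately obtain sg K where sg: "segment sg" "\<delta> < sqn K sg v" using big by blast
  have "sqn K sg w \<le> (\<Sum>k<N0. sqn K sg (u k))"
    using sqn_sum_le[where A = "{..<N0}" and a = "\<lambda>_. 1" and u = u and K = K and s = sg] by (simp add: w_def)
  also have "\<dots> \<le> 3 + real N0 * (1 / real N0)"
    using ut u sep sg(1) eN by (intro successive_sum_le[of N0 t]) auto
  finally have le: "sqn K sg w \<le> 4" using N1 by simp
  have "sqn K sg v = sqn K sg w / JTG_norm w"
    unfolding v_def sqn_scale using Nw' \<delta> by simp
  then have "\<delta> * JTG_norm w < sqn K sg w" using sg(2) Nw' \<delta> by (simp add: pos_less_divide_eq)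
  moreover have "4 \<le> \<delta> * JTG_norm w"
  proof -
    have "\<delta> * (sqrt (real N0) * \<delta>) \<le> \<delta> * JTG_norm w" using \<delta> by (intro mult_left_mono Nw) simp
    then show ?thesis using N4 by (simp add: power2_eq_square mult_ac)
  qed
  ultimately show False using le by simp
qed

end

section \<open>Extraction of c0\<close>

lemma sum_half_powers_le:
  fixes N :: nat
  shows "(\<Sum>k<N. (1 / 2) ^ (k + 3)) \<le> (1 / 4 :: real)"
proof -
  have "(\<Sum>k<N. (1 / 2) ^ (k + 3)) = 1 / 4 - (1 / 2 :: real) ^ N / 4"
  proof (induction N)
    case (Suc N)
    have "(1 / 2 :: real) ^ (N + 3) = (1 / 2) ^ N / 8" "(1 / 2 :: real) ^ Suc N = (1 / 2) ^ N / 2"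
      by (simp_all add: power_add power3_eq_cube)
    then show ?case unfolding sum.lessThan_Suc Suc.IH by linarith
  qed simp
  then show ?thesis by simp
qed

context jt_completion
begin

lemma L2_sqn_sum_le:
  fixes N :: nat
  shows "L2_set (\<lambda>s. sqn K s (\<lambda>l. \<Sum>k<N. a k * u k l)) A \<le> (\<Sum>k<N. \<bar>a k\<bar> * L2_set (\<lambda>s. sqn K s (u k)) A)"
proof (induction N)
  case 0
  then show ?case by (simp add: sqn_def blk_sum_def L2_set_def)
next
  case (Suc N)
  let ?v = "\<lambda>l. \<Sum>k<N. a k * u k l"
  have "L2_set (\<lambda>s. sqn K s (\<lambda>l. \<Sum>k<Suc N. a k * u k l)) A
      \<le> L2_set (\<lambda>s. sqn K s ?v + \<bar>a N\<bar> * sqn K s (u N)) A"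
  proof (rule L2_set_mono)
    fix s
    have "sqn K s (\<lambda>l. ?v l + a N * u N l) \<le> sqn K s ?v + sqn K s (\<lambda>l. a N * u N l)" by (rule sqn_add)
    then show "sqn K s (\<lambda>l. \<Sum>k<Suc N. a k * u k l) \<le> sqn K s ?v + \<bar>a N\<bar> * sqn K s (u N)"
      by (simp add: sqn_scale)
  qed simp
  also have "\<dots> \<le> L2_set (\<lambda>s. sqn K s ?v) A + L2_set (\<lambda>s. \<bar>a N\<bar> * sqn K s (u N)) A"
    by (rule L2_set_triangle_ineq)
  also have "L2_set (\<lambda>s. \<bar>a N\<bar> * sqn K s (u N)) A = \<bar>a N\<bar> * L2_set (\<lambda>s. sqn K s (u N)) A"
    by (simp add: L2_set_right_distrib)
  finally show ?case using Suc by simp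
qed

end

text \<open>The divisor \<open>t k + 1\<close> beats the number of segments in a family whose least
  minimum is at most \<open>t k\<close>. The factors \<open>(1 / 2) ^ (k + 3)\<close> add up to at
  most 1/4, which serves both for the segment sums and for the distances between \<open>u\<close>
  and \<open>z\<close>.\<close>

locale c0_blocks = jt_completion +
  fixes Y :: "'a set" and u :: "nat \<Rightarrow> nat \<Rightarrow> real" and t :: "nat \<Rightarrow> nat" and z :: "nat \<Rightarrow> 'a"
  assumes Y: "closed_subspace_of Y JTG"
    and t_less: "\<And>k. t k < t (Suc k)"
    and u_c00: "\<And>k. u k \<in> c00" and norm_u: "\<And>k. JTG_norm (u k) = 1"
    and supp_u: "\<And>k. supp (u k) \<subseteq> {t k<..t (Suc k)}"
    and small_u: "\<And>k s K. segment s \<Longrightarrow> sqn K s (u k) \<le> (1 / 2) ^ (k + 3) / real (Suc (t k))"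
    and z_Y: "\<And>k. z k \<in> Y" and near: "\<And>k. norm (\<iota> (u k) - z k) \<le> (1 / 2) ^ (k + 3)"
begin

lemma t_mono: "k \<le> l \<Longrightarrow> t k \<le> t l"
  using lift_Suc_mono_le[of t k l] t_less by (simp add: less_imp_le)

lemma block_disjoint:
  assumes "l \<in> {t k<..t (Suc k)}" "l \<in> {t j<..t (Suc j)}"
  shows "j = k"
  using assms t_mono[of "Suc k" j] t_mono[of "Suc j" k] by (cases j k rule: linorder_cases) auto

lemma u_eq_0: "l \<in> {t k<..t (Suc k)} \<Longrightarrow> j \<noteq> k \<Longrightarrow> u j l = 0"
  using supp_u[of j] block_disjoint[of l k j] by (auto simp: supp_def)

lemma sum_u_on_block:
  assumes "l \<in> {t k<..t (Suc k)}"
  shows "(\<Sum>j<N. a j * u j l) = (if k < N then a k * u k l else 0)"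
proof -
  have "(\<Sum>j<N. a j * u j l) = (\<Sum>j<N. if j = k then a k * u k l else 0)"
    using u_eq_0[OF assms] by (intro sum.cong) auto
  then show ?thesis by simp
qed

text \<open>If the least minimum lies in the block, only the norm 1 is available. If it lies beyond
  the block, every segment misses the block; if before, there are at most \<open>t k\<close>
  segments, each with a tiny value.\<close>

lemma L2_sqn_block_le:
  assumes A: "A \<in> segment_families" "A \<noteq> {}"
  shows "L2_set (\<lambda>s. sqn K s (u k)) A
    \<le> (if Min (Min ` A) \<in> {t k<..t (Suc k)} then 1 else 0) + (1 / 2) ^ (k + 3)"
proof -
  define p where "p = Min (Min ` A)"
  have A': "finite A" "\<And>s. s \<in> A \<Longrightarrow> segment s" "disjoint A" "Min ` A \<in> schreier1"
    using A by (auto simp: segment_families_def)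
  have "card A = card (Min ` A)" using inj_on_Min_family A' by (intro card_image[symmetric]) auto
  also have "\<dots> \<le> p" using A' A(2) by (auto simp: schreier1_def p_def)
  finally have cA: "card A \<le> p" .
  have ps: "p \<le> l" if "s \<in> A" "l \<in> s" for s l
  proof -
    have "p \<le> Min s" using that A' by (simp add: p_def)
    also have "\<dots> \<le> l" using that segmentD(1)[OF A'(2)] by simp
    finally show ?thesis .
  qed
  have h: "0 \<le> (1 / 2 :: real) ^ (k + 3)" by simp
  consider "p \<in> {t k<..t (Suc k)}" | "t (Suc k) < p" | "p \<le> t k" by force
  then have "L2_set (\<lambda>s. sqn K s (u k)) A \<le> (if p \<in> {t k<..t (Suc k)} then 1 else 0) + (1 / 2) ^ (k + 3)"
  proof cases
    case 1
    have "L2_set (\<lambda>s. sqn K s (u k)) A \<le> 1"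
      using L2_sqn_le_JTG_norm[OF c00_finite[OF u_c00] A(1)] norm_u by metis
    then show ?thesis unfolding if_P[OF 1] using h by linarith
  next
    case 2
    have "sqn K s (u k) = 0" if "s \<in> A" for s
    proof (rule sqn_zero)
      show "supp (u k) \<inter> s = {}" using ps[OF that] supp_u[of k] 2 by fastforce
    qed
    then have "L2_set (\<lambda>s. sqn K s (u k)) A = 0" by (simp add: L2_set_def)
    then show ?thesis using h by simp
  next
    case 3
    have "L2_set (\<lambda>s. sqn K s (u k)) A \<le> (\<Sum>s\<in>A. sqn K s (u k))" by (intro L2_set_le_sum) auto
    also have "\<dots> \<le> real (card A) * ((1 / 2) ^ (k + 3) / real (Suc (t k)))"
      using small_u A'(2) by (intro sum_bounded_above) auto
    also have "\<dots> \<le> real (Suc (t k)) * ((1 / 2) ^ (k + 3) / real (Suc (t k)))"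
      using cA 3 by (intro mult_right_mono) auto
    also have "\<dots> = (1 / 2) ^ (k + 3)" by simp
    finally show ?thesis by simp
  qed
  then show ?thesis by (simp add: p_def)
qed

text \<open>The least minimum of a family lies in at most one block, so one block may cost 1 and the
  geometric errors add at most 1/4. A single coordinate sees only one block.\<close>

lemma norm_block_sum_le:
  assumes B: "0 \<le> B" and a: "\<And>k. k < N \<Longrightarrow> \<bar>a k\<bar> \<le> B"
  shows "JTG_norm (\<lambda>l. \<Sum>k<N. a k * u k l) \<le> 2 * B"
proof (rule JTG_norm_leI)
  fix l
  show "\<bar>\<Sum>k<N. a k * u k l\<bar> \<le> 2 * B"
  proof (cases "\<exists>k. l \<in> {t k<..t (Suc k)}")
    case True
    then obtain k where k: "l \<in> {t k<..t (Suc k)}" by blast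
    have "\<bar>u k l\<bar> \<le> 1" using abs_le_JTG_norm[OF c00_finite[OF u_c00], of k l] norm_u by simp
    then have "\<bar>a k * u k l\<bar> \<le> B * 1" if "k < N"
      unfolding abs_mult using a[OF that] B by (intro mult_mono) auto
    then show ?thesis unfolding sum_u_on_block[OF k] using B by (cases "k < N") auto
  next
    case False
    then have "l \<notin> supp (u k)" for k using supp_u[of k] by blast
    then have "u k l = 0" for k by (simp add: supp_def)
    then show ?thesis using B by simp
  qed
next
  fix A K assume A: "A \<in> segment_families"
  show "L2_set (\<lambda>s. sqn K s (\<lambda>l. \<Sum>k<N. a k * u k l)) A \<le> 2 * B"
  proof (cases "A = {}")
    case False
    let ?c = "\<lambda>k. if Min (Min ` A) \<in> {t k<..t (Suc k)} then 1 else 0 :: real"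
    have c: "(\<Sum>k<N. ?c k) \<le> 1"
    proof (cases "\<exists>k. Min (Min ` A) \<in> {t k<..t (Suc k)}")
      case True
      then obtain k where k: "Min (Min ` A) \<in> {t k<..t (Suc k)}" by blast
      have "Min (Min ` A) \<in> {t j<..t (Suc j)} \<longleftrightarrow> j = k" for j
      proof
        assume "Min (Min ` A) \<in> {t j<..t (Suc j)}"
        then show "j = k" by (rule block_disjoint[OF k])
      qed (simp only: k)
      then have "(\<Sum>j<N. ?c j) = (\<Sum>j<N. if j = k then 1 else 0)" by (simp only:)
      then show ?thesis by simp
    next
      case False
      then have "(\<Sum>k<N. ?c k) = 0" by (intro sum.neutral) auto
      then show ?thesis by simp
    qed
    have "L2_set (\<lambda>s. sqn K s (\<lambda>l. \<Sum>k<N. a k * u k l)) A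
        \<le> (\<Sum>k<N. \<bar>a k\<bar> * L2_set (\<lambda>s. sqn K s (u k)) A)" by (rule L2_sqn_sum_le)
    also have "\<dots> \<le> (\<Sum>k<N. B * (?c k + (1 / 2) ^ (k + 3)))"
      using a B L2_sqn_block_le[OF A False] by (intro sum_mono mult_mono) auto
    also have "\<dots> = B * ((\<Sum>k<N. ?c k) + (\<Sum>k<N. (1 / 2) ^ (k + 3)))"
      unfolding sum.distrib[symmetric] sum_distrib_left ..
    also have "\<dots> \<le> B * 2"
      using c sum_half_powers_le[of N] B by (intro mult_left_mono) auto
    finally show ?thesis by simp
  qed (use B in simp)
qed

lemma abs_le_norm_block_sum:
  assumes "k < N"
  shows "\<bar>a k\<bar> \<le> JTG_norm (\<lambda>l. \<Sum>k<N. a k * u k l)"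
proof -
  let ?w = "\<lambda>l. \<Sum>k<N. a k * u k l"
  have w: "?w \<in> c00" using u_c00 by (intro c00_sum) auto
  have "restr ?w {t k<..t (Suc k)} = (\<lambda>l. a k * u k l)"
  proof
    fix l
    show "restr ?w {t k<..t (Suc k)} l = a k * u k l"
      using sum_u_on_block[of l k a N] assms supp_u[of k] by (auto simp: restr_def supp_def)
  qed
  moreover have "JTG_norm (\<lambda>l. a k * u k l) = \<bar>a k\<bar>"
  proof -
    have "JTG_norm (\<lambda>l. a k * u k l) = norm (\<iota> (\<lambda>l. a k * u k l))" using c00_scale[OF u_c00] by (simp add: norm_\<iota>)
    also have "\<dots> = \<bar>a k\<bar> * JTG_norm (u k)" by (simp add: \<iota>_scale u_c00 norm_\<iota>)
    finally show ?thesis using norm_u by simp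
  qed
  ultimately show ?thesis
    using JTG_norm_restr_le[OF c00_finite[OF w], of "{t k<..t (Suc k)}"] by (simp add: subset_iff)
qed

lemma norm_sum_diff_le:
  assumes "0 \<le> B" "\<And>k. k < N \<Longrightarrow> \<bar>a k\<bar> \<le> B"
  shows "norm ((\<Sum>k<N. a k *\<^sub>R \<iota> (u k)) - (\<Sum>k<N. a k *\<^sub>R z k)) \<le> B / 4"
proof -
  have "norm ((\<Sum>k<N. a k *\<^sub>R \<iota> (u k)) - (\<Sum>k<N. a k *\<^sub>R z k)) = norm (\<Sum>k<N. a k *\<^sub>R (\<iota> (u k) - z k))"
    by (simp add: scaleR_diff_right sum_subtractf)
  also have "\<dots> \<le> (\<Sum>k<N. B * (1 / 2) ^ (k + 3))"
    using assms near by (intro sum_norm_le) (auto intro!: mult_mono)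
  also have "\<dots> \<le> B * (1 / 4)"
    unfolding sum_distrib_left[symmetric] using assms(1) sum_half_powers_le by (intro mult_left_mono)
  finally show ?thesis by simp
qed

lemma norm_sum_\<iota>: "norm (\<Sum>k<N. a k *\<^sub>R \<iota> (u k)) = JTG_norm (\<lambda>l. \<Sum>k<N. a k * u k l)"
  using \<iota>_sum[of "{..<N}" u a] norm_\<iota>[OF c00_sum[of "{..<N}" u a]] u_c00 by simp

text \<open>For \<open>u\<close> the constants are 2 and 1; the perturbation to \<open>z\<close>
  costs 1/4 of the largest coefficient, and 3 and 1/2 leave room for this.\<close>

sublocale c0_sequence z 3 "1 / 2"
proof
  fix N :: nat and a :: "nat \<Rightarrow> real" and B :: real
  assume B: "0 \<le> B" and a: "\<And>k. k < N \<Longrightarrow> \<bar>a k\<bar> \<le> B"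
  have "norm (\<Sum>k<N. a k *\<^sub>R \<iota> (u k)) \<le> 2 * B" unfolding norm_sum_\<iota> by (rule norm_block_sum_le[OF B a])
  then show "norm (\<Sum>k<N. a k *\<^sub>R z k) \<le> 3 * B"
    using norm_sum_diff_le[of B N a, OF B a]
      norm_triangle_ineq4[of "\<Sum>k<N. a k *\<^sub>R \<iota> (u k)" "(\<Sum>k<N. a k *\<^sub>R \<iota> (u k)) - (\<Sum>k<N. a k *\<^sub>R z k)"] B
    by simp
next
  fix N k :: nat and a :: "nat \<Rightarrow> real"
  assume k: "k < N"
  \<comment> \<open>The perturbation is measured by the largest coefficient, so the lower estimate
    is derived for that one and then weakened to \<open>a k\<close>.\<close>
  define B where "B = Max ((\<lambda>k. \<bar>a k\<bar>) ` {..<N})"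
  have "B \<in> (\<lambda>k. \<bar>a k\<bar>) ` {..<N}" unfolding B_def using k by (intro Max_in) auto
  then obtain j where j: "j < N" "B = \<bar>a j\<bar>" by auto
  have a: "\<bar>a k\<bar> \<le> B" if "k < N" for k unfolding B_def using that by (intro Max_ge) auto
  have "0 \<le> B" using j by simp
  have "B \<le> norm (\<Sum>k<N. a k *\<^sub>R \<iota> (u k))"
    unfolding norm_sum_\<iota> j(2) by (rule abs_le_norm_block_sum[OF j(1)])
  moreover have "norm ((\<Sum>k<N. a k *\<^sub>R \<iota> (u k)) - (\<Sum>k<N. a k *\<^sub>R z k)) \<le> B / 4"
    by (rule norm_sum_diff_le[OF \<open>0 \<le> B\<close> a])
  ultimately have "B - B / 4 \<le> norm (\<Sum>k<N. a k *\<^sub>R z k)"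
    using norm_triangle_ineq2[of "\<Sum>k<N. a k *\<^sub>R \<iota> (u k)" "\<Sum>k<N. a k *\<^sub>R z k"] by linarith
  then show "1 / 2 * \<bar>a k\<bar> \<le> norm (\<Sum>k<N. a k *\<^sub>R z k)" using a[OF k] \<open>0 \<le> B\<close> by linarith
qed simp

section \<open>A functional in the bidual that no vector represents\<close>

lemma z_JTG: "z k \<in> JTG"
  using z_Y Y by (auto simp: closed_subspace_of_def)

lemma coord_sum:
  fixes N :: nat
  shows "(\<And>k. k < N \<Longrightarrow> v k \<in> JTG) \<Longrightarrow> coord (\<Sum>k<N. v k) l = (\<Sum>k<N. coord (v k) l)"
proof (induction N)
  case 0
  then show ?case using coord_\<iota>[OF c00_zero] by (simp add: \<iota>_zero)
next
  case (Suc N)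
  have "(\<Sum>k<N. v k) \<in> JTG" using Suc.prems by (intro subspace_sum[OF subspace_JTG]) auto
  then show ?case using Suc by (simp add: coord_add)
qed

text \<open>The perturbations \<open>z k - \<iota> (u k)\<close> have a convergent sum. Subtracting
  it from \<open>y\<close> leaves a vector with the coordinates of the formal sum of the
  \<open>u k\<close>; its projections to far-out blocks would have norm 1, which density of the
  finitely supported vectors forbids.\<close>

lemma blocks_not_represented:
  assumes y: "y \<in> JTG" and sums: "\<And>l. (\<lambda>k. coord (z k) l) sums coord y l"
  shows False
proof -
  define v where "v k = z k - \<iota> (u k)" for k
  have vJ: "v k \<in> JTG" for k
    unfolding v_def by (intro subspace_diff[OF subspace_JTG] z_JTG \<iota>_in_JTG u_c00)
  have nv: "norm (v k) \<le> (1 / 2) ^ (k + 3)" for k using near[of k] by (simp add: v_def norm_minus_commute)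
  have "summable (\<lambda>k. (1 / 2 :: real) ^ (k + 3))"
    using summable_ignore_initial_segment[OF summable_geometric[of "1 / 2 :: real"], of 3] by simp
  then have sv: "summable v" using nv by (rule summable_comparison_test'[of _ 0])
  define V where "V = suminf v"
  have lim: "(\<lambda>N. \<Sum>k<N. v k) \<longlonglongrightarrow> V" using summable_LIMSEQ[OF sv] by (simp add: V_def)
  have vN: "(\<Sum>k<N. v k) \<in> JTG" for N using vJ by (intro subspace_sum[OF subspace_JTG])
  have VJ: "V \<in> JTG" using closed_sequentially[OF closed_JTG vN lim] .
  have cV: "(\<lambda>k. coord (v k) l) sums coord V l" for l
    unfolding sums_def
  proof (rule LIM_zero_cancel, rule Lim_null_comparison)
    have "norm ((\<Sum>k<N. coord (v k) l) - coord V l) \<le> norm ((\<Sum>k<N. v k) - V)" for N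
      using abs_coord_le[OF subspace_diff[OF subspace_JTG vN[of N] VJ], of l]
      by (simp add: coord_diff[OF vN VJ] coord_sum[OF vJ])
    then show "\<forall>\<^sub>F N in sequentially. norm ((\<Sum>k<N. coord (v k) l) - coord V l) \<le> norm ((\<Sum>k<N. v k) - V)"
      by simp
    show "(\<lambda>N. norm ((\<Sum>k<N. v k) - V)) \<longlonglongrightarrow> 0" using lim by (simp add: tendsto_norm_zero LIM_zero)
  qed
  define y' where "y' = y - V"
  have y': "y' \<in> JTG" using y VJ subspace_JTG subspace_diff by (auto simp: y'_def)
  have cy': "coord y' l = u j l" if l: "l \<in> {t j<..t (Suc j)}" for j l
  proof -
    have "(\<lambda>k. coord (z k) l - coord (v k) l) sums (coord y l - coord V l)"
      using sums cV by (intro sums_diff)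
    moreover have "coord (z k) l - coord (v k) l = u k l" for k
      using z_JTG \<iota>_in_JTG[OF u_c00] by (simp add: v_def coord_diff coord_\<iota> u_c00)
    ultimately have "(\<lambda>k. u k l) sums coord y' l" using y VJ by (simp add: y'_def coord_diff)
    moreover have "(\<lambda>k. u k l) sums (\<Sum>k\<in>{j}. u k l)"
      using u_eq_0[OF l] by (intro sums_finite) auto
    ultimately show ?thesis using sums_unique2 by fastforce
  qed
  have half: "0 < (1 / 2 :: real)" by simp
  obtain x where x: "x \<in> c00" "norm (y' - \<iota> x) < 1 / 2" by (rule approx[OF y' half])
  obtain q where q: "\<forall>l\<in>supp x. l \<le> q" using c00_finite[OF x(1)] finite_nat_set_iff_bounded_le by blast
  \<comment> \<open>Hence block \<open>q\<close> lies beyond the support of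
    \<open>x\<close>.\<close>
  have tk: "k \<le> t k" for k using strict_mono_imp_increasing[of t k] t_less by (simp add: strict_mono_Suc_iff)
  let ?E = "{Suc (t q)..t (Suc q)}"
  have d: "y' - \<iota> x \<in> JTG" using y' \<iota>_in_JTG[OF x(1)] subspace_JTG subspace_diff by blast
  have "restr (coord (y' - \<iota> x)) ?E = u q"
  proof
    fix l
    show "restr (coord (y' - \<iota> x)) ?E l = u q l"
    proof (cases "l \<in> ?E")
      case True
      then have "l \<notin> supp x" using q tk[of q] by fastforce
      then have "x l = 0" by (simp add: supp_def)
      then have "coord (y' - \<iota> x) l = coord y' l"
        using y' \<iota>_in_JTG[OF x(1)] by (simp add: coord_diff coord_\<iota> x(1))
      then show ?thesis using cy'[of l q] True by (simp add: restr_def Suc_le_eq)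
    next
      case False
      then show ?thesis using supp_u[of q] by (auto simp: restr_def supp_def)
    qed
  qed
  then have "1 \<le> norm (y' - \<iota> x)" using JTG_norm_restr_coord_le[OF d, of "Suc (t q)" "t (Suc q)"] norm_u by simp
  then show False using x(2) by simp
qed

lemma not_reflexive: "\<not> reflexive Y"
proof
  assume refl: "reflexive Y"
  have sY: "subspace Y" and YJ: "Y \<subseteq> JTG" using Y by (auto simp: closed_subspace_of_def)
  \<comment> \<open>The formal sum of the \<open>z k\<close>. It does not converge in norm, but the
    upper c0 estimate makes it converge absolutely against every functional.\<close>
  define \<Xi> where "\<Xi> f = (\<Sum>k. f (z k))" for f :: "'a \<Rightarrow> real"
  have bound: "\<bar>f x\<bar> \<le> dual_norm Y f * norm x" if f: "f \<in> dual Y" and x: "x \<in> Y" for f x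
  proof -
    obtain K where K: "\<And>x. x \<in> Y \<Longrightarrow> norm (f x) \<le> K * norm x"
      using f by (auto simp: dual_def bounded_linear_on_def)
    have lin: "f (c *\<^sub>R x) = c * f x" if "x \<in> Y" for c x
      using f that by (auto simp: dual_def bounded_linear_on_def linear_on_def)
    have bdd: "bdd_above ((\<lambda>x. \<bar>f x\<bar>) ` {x\<in>Y. norm x \<le> 1})"
    proof (rule bdd_aboveI2)
      fix x assume "x \<in> {x\<in>Y. norm x \<le> 1}"
      then have "\<bar>f x\<bar> \<le> K * norm x" "norm x \<le> 1" using K by auto
      moreover have "K * norm x \<le> \<bar>K\<bar> * 1" using \<open>norm x \<le> 1\<close> by (intro mult_mono) auto
      ultimately show "\<bar>f x\<bar> \<le> \<bar>K\<bar>" by simp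
    qed
    show ?thesis
    proof (cases "x = 0")
      case True
      then show ?thesis using lin[OF x, of 0] by simp
    next
      case False
      define w where "w = (1 / norm x) *\<^sub>R x"
      have w: "w \<in> {x\<in>Y. norm x \<le> 1}" using x False sY subspace_scale by (auto simp: w_def)
      have "\<bar>f w\<bar> \<le> dual_norm Y f" unfolding dual_norm_def using w bdd by (intro cSUP_upper)
      moreover have "\<bar>f w\<bar> = \<bar>f x\<bar> / norm x" unfolding w_def lin[OF x] by (simp add: abs_mult)
      ultimately show ?thesis using False by (simp add: field_simps)
    qed
  qed
  have lin_sum: "f (\<Sum>k<N. a k *\<^sub>R z k) = (\<Sum>k<N. a k * f (z k))" if f: "f \<in> dual Y" for f a N
  proof (induction N)
    case 0
    have "f (0 *\<^sub>R z 0) = 0 *\<^sub>R f (z 0)"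
      using f z_Y unfolding dual_def bounded_linear_on_def linear_on_def by blast
    then show ?case by simp
  next
    case (Suc N)
    have "(\<Sum>k<N. a k *\<^sub>R z k) \<in> Y" "a N *\<^sub>R z N \<in> Y"
      using z_Y by (auto intro: subspace_sum[OF sY] subspace_scale[OF sY])
    then have "f ((\<Sum>k<N. a k *\<^sub>R z k) + a N *\<^sub>R z N) = f (\<Sum>k<N. a k *\<^sub>R z k) + f (a N *\<^sub>R z N)"
      using f unfolding dual_def bounded_linear_on_def linear_on_def by simp
    also have "f (a N *\<^sub>R z N) = a N * f (z N)"
      using f z_Y unfolding dual_def bounded_linear_on_def linear_on_def by simp
    finally show ?case using Suc by simp
  qed
  have abs_sum: "(\<Sum>k<N. \<bar>f (z k)\<bar>) \<le> dual_norm Y f * 3" if f: "f \<in> dual Y" for f N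
  proof -
    \<comment> \<open>The signs turn the sum of absolute values into the value of \<open>f\<close>
      at a vector of norm at most 3.\<close>
    define x where "x = (\<Sum>k<N. sgn (f (z k)) *\<^sub>R z k)"
    have x: "x \<in> Y" unfolding x_def using z_Y by (intro subspace_sum[OF sY] subspace_scale[OF sY])
    have nx: "norm x \<le> 3 * 1" unfolding x_def by (rule upper) (auto simp: sgn_real_def)
    \<comment> \<open>Read off from the bound at the nonzero vector \<open>z 0\<close>.\<close>
    have "0 \<le> dual_norm Y f"
    proof -
      have "z 0 \<noteq> 0" using lower[of 0 1 "\<lambda>_. 1"] by auto
      then show ?thesis using bound[OF f z_Y[of 0]] by (smt (verit) mult_neg_pos zero_less_norm_iff)
    qed
    have "(\<Sum>k<N. \<bar>f (z k)\<bar>) = f x"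
      unfolding x_def lin_sum[OF f] by (intro sum.cong) (auto simp: sgn_real_def)
    also have "\<dots> \<le> dual_norm Y f * norm x" using bound[OF f x] by simp
    also have "\<dots> \<le> dual_norm Y f * 3" using nx \<open>0 \<le> dual_norm Y f\<close> by (intro mult_left_mono) auto
    finally show ?thesis .
  qed
  have summ: "summable (\<lambda>k. \<bar>f (z k)\<bar>)" if "f \<in> dual Y" for f
    using abs_sum[OF that] by (intro summableI_nonneg_bounded) auto
  have summ': "summable (\<lambda>k. f (z k))" if "f \<in> dual Y" for f
    by (rule summable_rabs_cancel[OF summ[OF that]])
  have "\<Xi> \<in> bidual Y"
    unfolding bidual_def
  proof (intro CollectI conjI ballI allI exI)
    fix f g assume "f \<in> dual Y" "g \<in> dual Y"
    then show "\<Xi> (\<lambda>x. f x + g x) = \<Xi> f + \<Xi> g" unfolding \<Xi>_def using summ' by (simp add: suminf_add)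
  next
    fix c f assume "f \<in> dual Y"
    then show "\<Xi> (\<lambda>x. c * f x) = c * \<Xi> f" unfolding \<Xi>_def using summ' by (simp add: suminf_mult)
  next
    fix f assume f: "f \<in> dual Y"
    have "\<bar>\<Xi> f\<bar> \<le> (\<Sum>k. \<bar>f (z k)\<bar>)" unfolding \<Xi>_def using summ[OF f] by (rule summable_rabs)
    also have "\<dots> \<le> dual_norm Y f * 3" using abs_sum[OF f] summ[OF f] by (intro suminf_le_const)
    finally show "\<bar>\<Xi> f\<bar> \<le> 3 * dual_norm Y f" by simp
  qed
  then obtain y where y: "y \<in> Y" "\<And>f. f \<in> dual Y \<Longrightarrow> \<Xi> f = f y" using refl unfolding reflexive_def by metis
  have "(\<lambda>k. coord (z k) l) sums coord y l" for l
  proof -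
    \<comment> \<open>The coordinate is set to 0 off \<open>Y\<close>, as membership in
      \<open>dual Y\<close> demands.\<close>
    define f where "f x = (if x \<in> Y then coord x l else 0)" for x
    have "linear_on Y f"
      unfolding linear_on_def f_def using YJ subspace_add[OF sY] subspace_scale[OF sY]
      by (auto simp: coord_add coord_scale subset_iff)
    moreover have "\<forall>x\<in>Y. norm (f x) \<le> 1 * norm x" using YJ abs_coord_le by (auto simp: f_def)
    ultimately have f: "f \<in> dual Y"
      unfolding dual_def bounded_linear_on_def by (intro CollectI conjI exI[of _ 1]) (auto simp: f_def)
    have "(\<lambda>k. f (z k)) sums f y" using y(2)[OF f] summ'[OF f] by (simp add: \<Xi>_def sums_iff)
    then show ?thesis using y(1) z_Y by (simp add: f_def)
  qed
  then show False using blocks_not_represented y(1) YJ by blast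
qed

end

section \<open>Choice of the blocks, and the dichotomy\<close>

context jt_completion
begin

lemma ex_c0_blocks:
  assumes nc: "non_coercive Y" and Y: "closed_subspace_of Y JTG"
  shows "\<exists>u t z. c0_blocks m n \<gamma> D R \<iota> JTG Y u t z"
proof -
  define \<eta> where "\<eta> k p = (1 / 2) ^ (k + 3) / real (Suc p)" for k p :: nat
  have \<eta>: "0 < \<eta> k p" "\<eta> k p \<le> (1 / 2) ^ (k + 3)" for k p
  proof -
    show "0 < \<eta> k p" by (simp add: \<eta>_def)
    have "(1 / 2) ^ (k + 3) / real (Suc p) \<le> (1 / 2) ^ (k + 3) / 1" by (intro divide_left_mono) auto
    then show "\<eta> k p \<le> (1 / 2) ^ (k + 3)" by (simp only: \<eta>_def div_by_1)
  qed
  have "\<forall>p k. \<exists>v q. p < q \<and> near_unit Y (\<eta> k p) v \<and> supp v \<subseteq> {p<..q}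
      \<and> (\<forall>s K. segment s \<longrightarrow> sqn K s v \<le> \<eta> k p)"
  proof (intro allI)
    fix p k
    obtain v where v: "near_unit Y (\<eta> k p) v \<and> supp v \<subseteq> {p<..}
      \<and> (\<forall>s K. segment s \<longrightarrow> sqn K s v \<le> \<eta> k p)"
      using small_segment_block[OF nc Y \<eta>(1)[of k p], of p] by (elim exE)
    then have "finite (supp v)" by (simp add: near_unit_def c00_finite)
    then obtain q where "\<forall>l\<in>supp v. l \<le> q" using finite_nat_set_iff_bounded_le by blast
    then have "supp v \<subseteq> {p<..max q (Suc p)}" using v by fastforce
    then show "\<exists>v q. p < q \<and> near_unit Y (\<eta> k p) v \<and> supp v \<subseteq> {p<..q}
      \<and> (\<forall>s K. segment s \<longrightarrow> sqn K s v \<le> \<eta> k p)"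
      using v by (intro exI[of _ v] exI[of _ "max q (Suc p)"]) simp
  qed
  \<comment> \<open>Block and end point are functions of the starting point and the number of the
    block, so that iterating the end point produces the cuts \<open>t\<close>.\<close>
  then obtain U T where UT: "\<forall>p k. p < T p k \<and> near_unit Y (\<eta> k p) (U p k) \<and> supp (U p k) \<subseteq> {p<..T p k}
      \<and> (\<forall>s K. segment s \<longrightarrow> sqn K s (U p k) \<le> \<eta> k p)"
    unfolding choice_iff by (elim exE)
  define t where "t = rec_nat 0 (\<lambda>k p. T p k)"
  have t: "t (Suc k) = T (t k) k" for k by (simp add: t_def)
  define u where "u k = U (t k) k" for k
  have u: "t k < t (Suc k) \<and> near_unit Y (\<eta> k (t k)) (u k) \<and> supp (u k) \<subseteq> {t k<..t (Suc k)}
      \<and> (\<forall>s K. segment s \<longrightarrow> sqn K s (u k) \<le> \<eta> k (t k))" for k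
    unfolding t u_def using UT by blast
  have "\<forall>k. \<exists>y. y \<in> Y \<and> norm (\<iota> (u k) - y) \<le> \<eta> k (t k)" using u unfolding near_unit_def by blast
  then obtain z where z: "\<forall>k. z k \<in> Y \<and> norm (\<iota> (u k) - z k) \<le> \<eta> k (t k)"
    unfolding choice_iff by (elim exE)
  have "c0_blocks m n \<gamma> D R \<iota> JTG Y u t z"
  proof
    fix k
    show "t k < t (Suc k)" "u k \<in> c00" "JTG_norm (u k) = 1" "supp (u k) \<subseteq> {t k<..t (Suc k)}" "z k \<in> Y"
      using u[of k] z by (auto simp: near_unit_def)
    show "norm (\<iota> (u k) - z k) \<le> (1 / 2) ^ (k + 3)" using z \<eta>(2) order_trans by blast
    show "sqn K s (u k) \<le> (1 / 2) ^ (k + 3) / real (Suc (t k))" if "segment s" for s K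
      using u[of k] that by (simp add: \<eta>_def)
  qed (rule Y)
  then show ?thesis by blast
qed

text \<open>Complementation is attached to the first alternative and non-reflexivity to the second,
  so that the claim on reflexive subspaces follows by exclusion.\<close>

lemma dichotomy:
  assumes Y: "closed_subspace_of Y JTG"
  shows "(hilbertian Y \<and> complemented_in Y JTG) \<or> (contains_c0 Y \<and> \<not> reflexive Y)"
proof (cases "non_coercive Y")
  case True
  then obtain u t z where "c0_blocks m n \<gamma> D R \<iota> JTG Y u t z" using ex_c0_blocks[OF _ Y] by blast
  then interpret c0_blocks m n \<gamma> D R \<iota> JTG Y u t z .
  show ?thesis
    using contains_c0[of Y] z_Y Y not_reflexive by (simp add: closed_subspace_of_def)
next
  case False
  then obtain F k0 e where F: "finite F" "\<forall>h\<in>F. path h" "0 < e"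
    and "\<not> (\<exists>y\<in>Y. norm y = 1 \<and> small_on F k0 e y)" unfolding non_coercive_def by blast
  then have "hilbertian Y \<and> complemented_in Y JTG"
    using coercive_imp_hilbertian[OF Y F, of k0] by blast
  then show ?thesis ..
qed

end

theorem corollary2p7p9:
  fixes m n \<gamma> :: "nat \<Rightarrow> nat" and D :: "nat set" and R :: "nat rel"
    and \<iota> :: "(nat \<Rightarrow> real) \<Rightarrow> 'a::banach" and JTG :: "'a set"
  assumes "jt_tree m n \<gamma> D R"
    and "is_completion c00 (jt_data.JTG_norm m n \<gamma> D R) \<iota> JTG"
  shows "(\<forall>Y. closed_subspace_of Y JTG \<longrightarrow> hilbertian Y \<or> contains_c0 Y)
       \<and> (\<forall>Y. closed_subspace_of Y JTG \<and> reflexive Y \<longrightarrow> hilbertian Y \<and> complemented_in Y JTG)"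
proof -
  interpret jt_completion m n \<gamma> D R \<iota> JTG
    using assms unfolding jt_completion_def jt_completion_axioms_def by (rule conjI)
  show ?thesis using dichotomy by blast
qed

end
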